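(* Let $M$ be an $F$-structure manifold of degree $K$. The distributions $D_l$ and $D_m$ are both integrable if and only if $$N_l(X,Y)=0\quad\text{for all vector fields }X,Y\text{ on }M,$$ or, equivalently, if and only if $l[mX,mY]=-m[lX,lY]$ for all vector fields $X,Y$ on $M$.
   Context: An $F$-structure manifold of degree $K$ is a smooth $n$-dimensional manifold $M$ with a nonzero smooth $(1,1)$-tensor field $F$ of constant rank $r$ satisfying $\alpha F^{K+1}+\beta F^{K}+F=0$, where $K\ge 3$ is an integer and $\alpha,\beta$ are real or complex numbers (polynomials in $F$ with complex coefficients are regarded as endomorphisms of the complexified tangent bundle). Put $l=-(\alpha F^{K}+\beta F^{K-1})$ and $m=I+\alpha F^{K}+\beta F^{K-1}$; $D_l=\mathrm{Im}\,l$ and $D_m=\mathrm{Im}\,m$ are complementary distributions of dimensions $r$ and $n-r$. For a $(1,1)$-tensor field $T$, the Nijenhuis tensor is $N_T(X,Y)=[TX,TY]-T[TX,Y]-T[X,TY]+T^2[X,Y]$. A distribution $D$ is integrable if through each point of $M$ there is an integral manifold of $D$ (equivalently, by Frobenius, $D$ is involutive). *)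

theory Defs
  imports "HOL-Analysis.Analysis" "HOL-Library.Function_Algebras"
begin

section \<open>Smooth manifolds\<close>

primrec Ck_on :: "nat \<Rightarrow> 'e::euclidean_space set \<Rightarrow> ('e \<Rightarrow> 'f::real_normed_vector) \<Rightarrow> bool" where
  "Ck_on 0 S f \<longleftrightarrow> continuous_on S f"
| "Ck_on (Suc k) S f \<longleftrightarrow> (\<forall>x\<in>S. f differentiable (at x)) \<and>
     (\<forall>v. Ck_on k S (\<lambda>x. frechet_derivative f (at x) v))"

text \<open>Only used for open sets \<open>S\<close>.\<close>

definition smooth_on :: "'e::euclidean_space set \<Rightarrow> ('e \<Rightarrow> 'f::real_normed_vector) \<Rightarrow> bool" where
  "smooth_on S f \<longleftrightarrow> (\<forall>k. Ck_on k S f)"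

text \<open>A chart is a pair of a domain and a coordinate map; the values of the coordinate map outside
  the domain are irrelevant.  The carrier of the manifold is the whole type \<open>'a\<close>.\<close>

type_synonym ('a, 'e) chart = "'a set \<times> ('a \<Rightarrow> 'e)"

definition is_chart :: "('a::topological_space, 'e::euclidean_space) chart \<Rightarrow> bool" where
  "is_chart = (\<lambda>(U, \<phi>). open U \<and> open (\<phi> ` U) \<and> homeomorphism U (\<phi> ` U) \<phi> (inv_into U \<phi>))"

definition smooth_compatible ::
  "('a::topological_space, 'e::euclidean_space) chart \<Rightarrow> ('a, 'e) chart \<Rightarrow> bool" where
  "smooth_compatible = (\<lambda>(U, \<phi>) (V, \<psi>).
     smooth_on (\<phi> ` (U \<inter> V)) (\<psi> \<circ> inv_into U \<phi>) \<and>
     smooth_on (\<psi> ` (U \<inter> V)) (\<phi> \<circ> inv_into V \<psi>))"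

definition smooth_atlas :: "('a::topological_space, 'e::euclidean_space) chart set \<Rightarrow> bool" where
  "smooth_atlas A \<longleftrightarrow> (\<forall>c\<in>A. is_chart c) \<and> (\<Union>c\<in>A. fst c) = UNIV \<and>
     (\<forall>c\<in>A. \<forall>d\<in>A. smooth_compatible c d)"

text \<open>The charts of the maximal atlas determined by \<open>A\<close>.\<close>

definition smooth_chart ::
  "('a::topological_space, 'e::euclidean_space) chart set \<Rightarrow> ('a, 'e) chart \<Rightarrow> bool" where
  "smooth_chart A c \<longleftrightarrow> is_chart c \<and> (\<forall>d\<in>A. smooth_compatible c d)"

definition smooth_functions ::
  "('a::topological_space, 'e::euclidean_space) chart set \<Rightarrow> ('a \<Rightarrow> real) set" where
  "smooth_functions A = {f. \<forall>(U, \<phi>)\<in>A. smooth_on (\<phi> ` U) (f \<circ> inv_into U \<phi>)}"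

section \<open>Tangent vectors, vector fields and tensor fields\<close>

text \<open>Tangent vectors at \<open>p\<close> are derivations at \<open>p\<close> of the algebra of smooth functions, extended
  by \<open>0\<close> to all functions so that equality of tangent vectors is equality in HOL.  They are added
  pointwise.  An element of the complexified tangent space is a map with values in \<open>complex\<close>
  whose real and imaginary parts are tangent vectors.\<close>

type_synonym 'a tvec = "('a \<Rightarrow> real) \<Rightarrow> real"
type_synonym 'a ctvec = "('a \<Rightarrow> real) \<Rightarrow> complex"

definition scale :: "'k::times \<Rightarrow> ('b \<Rightarrow> 'k) \<Rightarrow> ('b \<Rightarrow> 'k)" where
  "scale a v = (\<lambda>f. a * v f)"

definition tangent_space ::
  "('a::topological_space, 'e::euclidean_space) chart set \<Rightarrow> 'a \<Rightarrow> 'a tvec set" where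
  "tangent_space A p = {v.
     (\<forall>f\<in>smooth_functions A. \<forall>g\<in>smooth_functions A. v (\<lambda>q. f q + g q) = v f + v g) \<and>
     (\<forall>a. \<forall>f\<in>smooth_functions A. v (\<lambda>q. a * f q) = a * v f) \<and>
     (\<forall>f\<in>smooth_functions A. \<forall>g\<in>smooth_functions A.
        v (\<lambda>q. f q * g q) = f p * v g + g p * v f) \<and>
     (\<forall>f. f \<notin> smooth_functions A \<longrightarrow> v f = 0)}"

definition vector_fields ::
  "('a::topological_space, 'e::euclidean_space) chart set \<Rightarrow> ('a \<Rightarrow> 'a tvec) set" where
  "vector_fields A = {X. (\<forall>p. X p \<in> tangent_space A p) \<and>
     (\<forall>f\<in>smooth_functions A. (\<lambda>p. X p f) \<in> smooth_functions A)}"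

text \<open>The values \<open>T p v\<close> for \<open>v \<notin> tangent_space A p\<close> are irrelevant.\<close>

definition tensor_field_11 ::
  "('a::topological_space, 'e::euclidean_space) chart set \<Rightarrow> ('a \<Rightarrow> 'a tvec \<Rightarrow> 'a tvec) \<Rightarrow> bool" where
  "tensor_field_11 A T \<longleftrightarrow>
     (\<forall>p. \<forall>v\<in>tangent_space A p. T p v \<in> tangent_space A p) \<and>
     (\<forall>p. \<forall>v\<in>tangent_space A p. \<forall>w\<in>tangent_space A p. T p (v + w) = T p v + T p w) \<and>
     (\<forall>p a. \<forall>v\<in>tangent_space A p. T p (scale a v) = scale a (T p v)) \<and>
     (\<forall>X\<in>vector_fields A. (\<lambda>p. T p (X p)) \<in> vector_fields A)"

definition tensor_rank ::
  "('a::topological_space, 'e::euclidean_space) chart set \<Rightarrow> ('a \<Rightarrow> 'a tvec \<Rightarrow> 'a tvec) \<Rightarrow> 'a \<Rightarrow> nat" where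
  "tensor_rank A T p =
     vector_space.dim (scale :: real \<Rightarrow> 'a tvec \<Rightarrow> 'a tvec) (T p ` tangent_space A p)"

section \<open>Complexification\<close>

definition complexify :: "'a tvec set \<Rightarrow> 'a ctvec set" where
  "complexify V = {w. (\<lambda>f. Re (w f)) \<in> V \<and> (\<lambda>f. Im (w f)) \<in> V}"

abbreviation ctangent_space ::
  "('a::topological_space, 'e::euclidean_space) chart set \<Rightarrow> 'a \<Rightarrow> 'a ctvec set" where
  "ctangent_space A p \<equiv> complexify (tangent_space A p)"

text \<open>The complex linear extension \<open>u + i v \<mapsto> T u + i T v\<close>.\<close>

definition cext :: "('a \<Rightarrow> 'a tvec \<Rightarrow> 'a tvec) \<Rightarrow> 'a \<Rightarrow> 'a ctvec \<Rightarrow> 'a ctvec" where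
  "cext T p w = (\<lambda>f. Complex (T p (\<lambda>g. Re (w g)) f) (T p (\<lambda>g. Im (w g)) f))"

definition cfield :: "('a \<Rightarrow> 'a tvec) \<Rightarrow> 'a \<Rightarrow> 'a ctvec" where
  "cfield X = (\<lambda>p f. complex_of_real (X p f))"

text \<open>A complexified tangent vector acting on a complex-valued function.\<close>

definition capply :: "'a ctvec \<Rightarrow> ('a \<Rightarrow> complex) \<Rightarrow> complex" where
  "capply w h = w (\<lambda>q. Re (h q)) + \<i> * w (\<lambda>q. Im (h q))"

text \<open>The complex bilinear extension of the Lie bracket \<open>[X, Y] f = X (Y f) - Y (X f)\<close>.\<close>

definition bracket :: "('a \<Rightarrow> 'a ctvec) \<Rightarrow> ('a \<Rightarrow> 'a ctvec) \<Rightarrow> 'a \<Rightarrow> 'a ctvec" where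
  "bracket X Y = (\<lambda>p f. capply (X p) (\<lambda>q. Y q f) - capply (Y p) (\<lambda>q. X q f))"

definition tapply :: "('a \<Rightarrow> 'a ctvec \<Rightarrow> 'a ctvec) \<Rightarrow> ('a \<Rightarrow> 'a ctvec) \<Rightarrow> 'a \<Rightarrow> 'a ctvec" where
  "tapply T X = (\<lambda>p. T p (X p))"

definition nijenhuis ::
  "('a \<Rightarrow> 'a ctvec \<Rightarrow> 'a ctvec) \<Rightarrow> ('a \<Rightarrow> 'a ctvec) \<Rightarrow> ('a \<Rightarrow> 'a ctvec) \<Rightarrow> 'a \<Rightarrow> 'a ctvec" where
  "nijenhuis T X Y =
     bracket (tapply T X) (tapply T Y) - tapply T (bracket (tapply T X) Y)
     - tapply T (bracket X (tapply T Y)) + tapply T (tapply T (bracket X Y))"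

section \<open>Integrable distributions\<close>

text \<open>Embedded submanifolds of dimension \<open>k\<close>, by the slice condition.\<close>

definition embedded_submanifold ::
  "('a::topological_space, 'e::euclidean_space) chart set \<Rightarrow> nat \<Rightarrow> 'a set \<Rightarrow> bool" where
  "embedded_submanifold A k N \<longleftrightarrow> (\<forall>q\<in>N. \<exists>U \<phi> S. smooth_chart A (U, \<phi>) \<and> q \<in> U \<and>
     subspace S \<and> dim S = k \<and> \<phi> ` (U \<inter> N) = \<phi> ` U \<inter> S)"

definition smooth_curve ::
  "('a::topological_space, 'e::euclidean_space) chart set \<Rightarrow> real \<Rightarrow> (real \<Rightarrow> 'a) \<Rightarrow> bool" where
  "smooth_curve A \<epsilon> \<gamma> \<longleftrightarrow> continuous_on {-\<epsilon><..<\<epsilon>} \<gamma> \<and>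
     (\<forall>(U, \<phi>)\<in>A. smooth_on {t\<in>{-\<epsilon><..<\<epsilon>}. \<gamma> t \<in> U} (\<phi> \<circ> \<gamma>))"

definition velocity ::
  "('a::topological_space, 'e::euclidean_space) chart set \<Rightarrow> (real \<Rightarrow> 'a) \<Rightarrow> 'a tvec" where
  "velocity A \<gamma> = (\<lambda>f. if f \<in> smooth_functions A then deriv (f \<circ> \<gamma>) 0 else 0)"

text \<open>The tangent space of an embedded submanifold consists of the velocities of curves in it.\<close>

definition submanifold_tangent_space ::
  "('a::topological_space, 'e::euclidean_space) chart set \<Rightarrow> 'a set \<Rightarrow> 'a \<Rightarrow> 'a tvec set" where
  "submanifold_tangent_space A N q = {v. \<exists>\<epsilon> \<gamma>. \<epsilon> > 0 \<and> smooth_curve A \<epsilon> \<gamma> \<and> \<gamma> 0 = q \<and>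
     \<gamma> ` {-\<epsilon><..<\<epsilon>} \<subseteq> N \<and> v = velocity A \<gamma>}"

text \<open>A distribution assigns to each point a subspace of the complexified tangent space.  Since only
  the existence of an integral manifold through each point matters below and an immersed submanifold
  is locally embedded, integral manifolds are taken to be embedded.\<close>

definition integral_manifold ::
  "('a::topological_space, 'e::euclidean_space) chart set \<Rightarrow> ('a \<Rightarrow> 'a ctvec set) \<Rightarrow> 'a set \<Rightarrow> bool" where
  "integral_manifold A D N \<longleftrightarrow> (\<exists>k. embedded_submanifold A k N) \<and>
     (\<forall>q\<in>N. complexify (submanifold_tangent_space A N q) = D q)"

definition integrable_distribution ::
  "('a::topological_space, 'e::euclidean_space) chart set \<Rightarrow> ('a \<Rightarrow> 'a ctvec set) \<Rightarrow> bool" where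
  "integrable_distribution A D \<longleftrightarrow> (\<forall>p. \<exists>N. p \<in> N \<and> integral_manifold A D N)"

section \<open>F-structures\<close>

definition F_structure_manifold ::
  "('a::{t2_space,second_countable_topology}, 'e::euclidean_space) chart set \<Rightarrow>
   ('a \<Rightarrow> 'a tvec \<Rightarrow> 'a tvec) \<Rightarrow> nat \<Rightarrow> nat \<Rightarrow> complex \<Rightarrow> complex \<Rightarrow> bool" where
  "F_structure_manifold A F r K \<alpha> \<beta> \<longleftrightarrow>
     smooth_atlas A \<and> tensor_field_11 A F \<and> K \<ge> 3 \<and>
     (\<exists>p. \<exists>v\<in>tangent_space A p. F p v \<noteq> 0) \<and>
     (\<forall>p. tensor_rank A F p = r) \<and>
     (\<forall>p. \<forall>w\<in>ctangent_space A p.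
        scale \<alpha> ((cext F p ^^ (K + 1)) w) + scale \<beta> ((cext F p ^^ K) w) + cext F p w = 0)"

definition l_op ::
  "('a \<Rightarrow> 'a tvec \<Rightarrow> 'a tvec) \<Rightarrow> nat \<Rightarrow> complex \<Rightarrow> complex \<Rightarrow> 'a \<Rightarrow> 'a ctvec \<Rightarrow> 'a ctvec" where
  "l_op F K \<alpha> \<beta> p w = - (scale \<alpha> ((cext F p ^^ K) w) + scale \<beta> ((cext F p ^^ (K - 1)) w))"

definition m_op ::
  "('a \<Rightarrow> 'a tvec \<Rightarrow> 'a tvec) \<Rightarrow> nat \<Rightarrow> complex \<Rightarrow> complex \<Rightarrow> 'a \<Rightarrow> 'a ctvec \<Rightarrow> 'a ctvec" where
  "m_op F K \<alpha> \<beta> p w = w + scale \<alpha> ((cext F p ^^ K) w) + scale \<beta> ((cext F p ^^ (K - 1)) w)"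

definition image_distribution ::
  "('a::topological_space, 'e::euclidean_space) chart set \<Rightarrow> ('a \<Rightarrow> 'a ctvec \<Rightarrow> 'a ctvec) \<Rightarrow>
   'a \<Rightarrow> 'a ctvec set" where
  "image_distribution A T p = T p ` ctangent_space A p"

end

theory Submission
  imports Defs
begin

text \<open>Since \<open>l F = F\<close> and \<open>l\<close> is a multiple of \<open>F\<close>, \<open>l\<close> is the projection onto the image of \<open>F\<close>
  along its kernel; as \<open>F\<close> is real, \<open>l\<close> is the complexification of a real smooth projection, obtained
  by taking real parts of \<open>\<alpha>\<close> and \<open>\<beta>\<close>.  For a projection, \<open>N\<^sub>l(X, Y) = m[lX, lY] + l[mX, mY]\<close>,
  with summands in complementary distributions, so both conditions say that the images of \<open>l\<close> and \<open>m\<close>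
  are involutive.  Involutive implies integrable by the theorem of Frobenius.  In a chart, an involutive
  image of projections is the range of operators \<open>Q z\<close> with \<open>DQ z (Q z v) w\<close> symmetric in \<open>v\<close> and \<open>w\<close>,
  and an integral manifold is parametrized by a solution of \<open>Dg = Q \<circ> g\<close>, which is obtained as a
  fixed point of \<open>g x = z0 + \<integral>\<^sub>0\<^sup>1 Q (g (t x)) x dt\<close>.\<close>

section \<open>Calculus of smooth maps\<close>

text \<open>Two obstacles shape the development. Tangent vectors are derivations that see only
  globally defined smooth functions, while Frobenius' theorem is local; bump functions extend local
  data to the manifold, and Hadamard's lemma shows that every derivation is a directional derivative
  in coordinates. Moreover \<alpha> and \<beta> may be complex, while curves and integral manifolds
  are real: on real vectors the structure equation splits into a real part, \<open>F = L F\<close>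
  for the real part \<open>L\<close> of \<open>l\<close>, and an imaginary part, from which the rest
  of \<open>l\<close> is seen to vanish. The proof of Frobenius' theorem uses no flows. In normal
  form the leaf is a graph over the range of \<open>L z0\<close>, so a total differential equation
  determines it; the fixed point is at the outset merely continuous, its derivative comes from an
  estimate on rays, and smoothness follows from \<open>Dg = Q o g\<close> by induction. For the
  converse, fields tangent to a linear slice have brackets tangent to it, because the derivative
  along the slice of a map into a subspace stays in that subspace.\<close>

lemma Ck_on_subset: "Ck_on k S f \<Longrightarrow> T \<subseteq> S \<Longrightarrow> Ck_on k T f"
  by (induction k arbitrary: f) (auto intro: continuous_on_subset)

lemma has_derivative_frechet:
  "f differentiable (at x) \<Longrightarrow> (f has_derivative frechet_derivative f (at x)) (at x)"
  by (simp add: frechet_derivative_works)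

text \<open>Derivatives in \<open>Ck_on\<close> are taken in the whole space, so equality on
  \<open>S\<close> controls them only because \<open>S\<close> is open.\<close>

lemma Ck_on_cong:
  assumes "Ck_on k S f" "open S" "\<And>x. x \<in> S \<Longrightarrow> f x = g x"
  shows "Ck_on k S g"
  using assms
proof (induction k arbitrary: f g)
  case 0
  then show ?case by (metis Ck_on.simps(1) continuous_on_cong)
next
  case (Suc k)
  have d: "(g has_derivative frechet_derivative f (at x)) (at x)" if "x \<in> S" for x
    using Suc.prems that has_derivative_frechet
    by (intro has_derivative_transform_within_open[of f _ _ UNIV S g]) auto
  have e: "frechet_derivative g (at x) = frechet_derivative f (at x)" if "x \<in> S" for x
    using frechet_derivative_at[OF d[OF that]] by simp
  have "Ck_on k S (\<lambda>x. frechet_derivative g (at x) v)" for v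
  proof (rule Suc.IH)
    show "Ck_on k S (\<lambda>x. frechet_derivative f (at x) v)" using Suc.prems(1) by simp
  qed (simp_all add: e Suc.prems(2))
  moreover have "g differentiable (at x)" if "x \<in> S" for x
    using d[OF that] by (rule differentiableI)
  ultimately show ?case by simp
qed

text \<open>Lets an explicit derivative formula replace the choice made by
  \<open>frechet_derivative\<close>. Most closure properties below are inductions on
  \<open>k\<close> through this rule, with the functions generalised because the derivative is again
  a combination of functions of the same kind.\<close>

lemma Ck_on_SucI:
  assumes "open S" "\<And>x. x \<in> S \<Longrightarrow> (f has_derivative f' x) (at x)"
    "\<And>v. Ck_on k S (\<lambda>x. f' x v)"
  shows "Ck_on (Suc k) S f"
proof -
  have "Ck_on k S (\<lambda>x. frechet_derivative f (at x) v)" for v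
    using assms frechet_derivative_at[OF assms(2)]
    by (intro Ck_on_cong[OF assms(3)]) auto
  moreover have "f differentiable (at x)" if "x \<in> S" for x
    using assms(2)[OF that] by (rule differentiableI)
  ultimately show ?thesis by simp
qed

lemma Ck_on_SucD: "Ck_on (Suc k) S f \<Longrightarrow> Ck_on k S f"
proof (induction k arbitrary: f)
  case 0
  then show ?case
    by (auto intro!: continuous_at_imp_continuous_on differentiable_imp_continuous_within)
qed auto

lemma Ck_on_local:
  assumes "\<And>x. x \<in> S \<Longrightarrow> \<exists>T. open T \<and> x \<in> T \<and> Ck_on k T f"
  shows "Ck_on k S f"
  using assms
proof (induction k arbitrary: f)
  case 0
  show ?case unfolding Ck_on.simps
  proof (rule continuous_at_imp_continuous_on, rule ballI)
    fix x assume "x \<in> S"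
    then obtain T where "open T" "x \<in> T" "continuous_on T f" using 0[of x] by auto
    then show "isCont f x" by (simp add: continuous_on_eq_continuous_at)
  qed
next
  case (Suc k)
  have "\<exists>T. open T \<and> x \<in> T \<and> Ck_on k T (\<lambda>x. frechet_derivative f (at x) v)" if "x \<in> S" for x v
    using Suc.prems[OF that] by auto
  then have "Ck_on k S (\<lambda>x. frechet_derivative f (at x) v)" for v
    by (intro Suc.IH) auto
  moreover have "f differentiable (at x)" if "x \<in> S" for x
    using Suc.prems[OF that] by auto
  ultimately show ?case by auto
qed

lemma Ck_on_const: "open S \<Longrightarrow> Ck_on k S (\<lambda>x. c)"
proof (induction k arbitrary: c)
  case (Suc k)
  then show ?case by (intro Ck_on_SucI[where f' = "\<lambda>x v. 0"]) auto
qed auto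

lemma Ck_on_bounded_linear:
  assumes "bounded_linear T" "open S" "Ck_on k S f"
  shows "Ck_on k S (\<lambda>x. T (f x))"
  using assms(3)
proof (induction k arbitrary: f)
  case 0
  then show ?case using bounded_linear.continuous_on[OF assms(1)] by simp
next
  case (Suc k)
  then show ?case
    by (intro Ck_on_SucI[where f' = "\<lambda>x v. T (frechet_derivative f (at x) v)"] assms)
      (auto intro!: bounded_linear.has_derivative[OF assms(1)] has_derivative_frechet)
qed

lemma Ck_on_add:
  assumes "open S" "Ck_on k S f" "Ck_on k S g"
  shows "Ck_on k S (\<lambda>x. f x + g x)"
  using assms(2,3)
proof (induction k arbitrary: f g)
  case 0
  then show ?case by (simp add: continuous_on_add)
next
  case (Suc k)
  show ?case
  proof (rule Ck_on_SucI)
    show "((\<lambda>x. f x + g x) has_derivative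
        (\<lambda>v. frechet_derivative f (at x) v + frechet_derivative g (at x) v)) (at x)"
      if "x \<in> S" for x
      using Suc.prems that by (intro has_derivative_add has_derivative_frechet) auto
    show "Ck_on k S (\<lambda>x. frechet_derivative f (at x) v + frechet_derivative g (at x) v)" for v
      using Suc.prems by (intro Suc.IH) auto
  qed fact
qed

lemma Ck_on_bilinear:
  assumes "bounded_bilinear B" "open S" "Ck_on k S f" "Ck_on k S g"
  shows "Ck_on k S (\<lambda>x. B (f x) (g x))"
  using assms(3,4)
proof (induction k arbitrary: f g)
  case 0
  then show ?case using bounded_bilinear.continuous_on[OF assms(1)] by simp
next
  case (Suc k)
  have k: "Ck_on k S f" "Ck_on k S g" using Suc.prems by (blast dest: Ck_on_SucD)+
  show ?case
  proof (rule Ck_on_SucI)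
    show "((\<lambda>x. B (f x) (g x)) has_derivative (\<lambda>v. B (f x) (frechet_derivative g (at x) v)
        + B (frechet_derivative f (at x) v) (g x))) (at x)" if "x \<in> S" for x
      using Suc.prems that
      by (intro bounded_bilinear.FDERIV[OF assms(1)] has_derivative_frechet) auto
    show "Ck_on k S (\<lambda>x. B (f x) (frechet_derivative g (at x) v)
        + B (frechet_derivative f (at x) v) (g x))" for v
      using Suc.prems k by (intro Ck_on_add Suc.IH assms(2)) auto
  qed fact
qed

lemma Ck_on_sum:
  assumes "open S" "\<And>i. i \<in> I \<Longrightarrow> Ck_on k S (f i)"
  shows "Ck_on k S (\<lambda>x. \<Sum>i\<in>I. f i x)"
  using assms(2)
proof (induction I rule: infinite_finite_induct)
  case (insert i I)
  then have "Ck_on k S (\<lambda>x. f i x + (\<Sum>i\<in>I. f i x))" by (intro Ck_on_add assms(1)) simp_all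
  then show ?case using insert.hyps by simp
qed (simp_all add: Ck_on_const assms(1))

lemma Ck_on_id:
  assumes "open S"
  shows "Ck_on k S (\<lambda>x. x)"
proof (cases k)
  case (Suc j)
  have "Ck_on (Suc j) S (\<lambda>x. x)"
    by (rule Ck_on_SucI[where f' = "\<lambda>x v. v"]) (simp_all add: assms Ck_on_const)
  then show ?thesis using Suc by simp
qed simp

lemma Ck_on_compose:
  fixes f :: "'d::euclidean_space \<Rightarrow> 'e::euclidean_space" and g :: "'e \<Rightarrow> 'f::real_normed_vector"
  assumes "open S" "Ck_on k S f" "Ck_on k T g" "f ` S \<subseteq> T"
  shows "Ck_on k S (\<lambda>x. g (f x))"
  using assms(2,3)
proof (induction k arbitrary: g)
  case 0
  show ?case using 0 by (auto intro: continuous_on_compose2[OF _ _ assms(4)])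
next
  case (Suc k)
  have fk: "Ck_on k S f" using Suc.prems by (blast dest: Ck_on_SucD)
  \<comment> \<open>In the chain rule the direction in which \<open>g\<close> is differentiated
    depends on \<open>x\<close>, whereas \<open>Ck_on\<close> fixes directions; expanding it in the
    basis leaves products of scalars with derivatives of \<open>g\<close> in constant
    directions.\<close>
  show ?case
  proof (rule Ck_on_SucI[where f' = "\<lambda>x v. \<Sum>b\<in>Basis. (frechet_derivative f (at x) v \<bullet> b) *\<^sub>R
        frechet_derivative g (at (f x)) b"])
    fix x assume x: "x \<in> S"
    have g: "(g has_derivative frechet_derivative g (at (f x))) (at (f x))"
      using x Suc.prems assms(4) by (intro has_derivative_frechet) auto
    interpret G: bounded_linear "frechet_derivative g (at (f x))"
      using g by (rule has_derivative_bounded_linear)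
    have rep: "frechet_derivative g (at (f x)) w
        = (\<Sum>b\<in>Basis. (w \<bullet> b) *\<^sub>R frechet_derivative g (at (f x)) b)" for w
      by (subst euclidean_representation[of w, symmetric]) (simp add: G.sum G.scaleR)
    have "((\<lambda>x. g (f x)) has_derivative
        (\<lambda>v. frechet_derivative g (at (f x)) (frechet_derivative f (at x) v))) (at x)"
      using x Suc.prems by (intro has_derivative_compose[where g = g and f = f, OF _ g] has_derivative_frechet) auto
    then show "((\<lambda>x. g (f x)) has_derivative (\<lambda>v. \<Sum>b\<in>Basis.
        (frechet_derivative f (at x) v \<bullet> b) *\<^sub>R frechet_derivative g (at (f x)) b)) (at x)"
      by (simp only: rep[symmetric])
  next
    fix v
    show "Ck_on k S (\<lambda>x. \<Sum>b\<in>Basis. (frechet_derivative f (at x) v \<bullet> b) *\<^sub>R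
        frechet_derivative g (at (f x)) b)"
      using Suc.prems fk assms
      by (intro Ck_on_sum Ck_on_bilinear[OF bounded_bilinear_scaleR]
          Ck_on_bounded_linear[OF bounded_linear_inner_left] Suc.IH) auto
  qed fact
qed

section \<open>Maps of class C^k for all k\<close>

lemma smooth_on_subset: "smooth_on S f \<Longrightarrow> T \<subseteq> S \<Longrightarrow> smooth_on T f"
  unfolding smooth_on_def using Ck_on_subset by blast

lemma smooth_on_cong:
  "smooth_on S f \<Longrightarrow> open S \<Longrightarrow> (\<And>x. x \<in> S \<Longrightarrow> f x = g x) \<Longrightarrow> smooth_on S g"
  unfolding smooth_on_def using Ck_on_cong by blast

lemma smooth_on_local:
  "(\<And>x. x \<in> S \<Longrightarrow> \<exists>T. open T \<and> x \<in> T \<and> smooth_on T f) \<Longrightarrow> smooth_on S f"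
  unfolding smooth_on_def by (meson Ck_on_local)

lemma smooth_on_const: "open S \<Longrightarrow> smooth_on S (\<lambda>x. c)"
  and smooth_on_id: "open S \<Longrightarrow> smooth_on S (\<lambda>x. x)"
  unfolding smooth_on_def by (auto intro: Ck_on_const Ck_on_id)

lemma smooth_on_bounded_linear:
  "bounded_linear T \<Longrightarrow> open S \<Longrightarrow> smooth_on S f \<Longrightarrow> smooth_on S (\<lambda>x. T (f x))"
  unfolding smooth_on_def by (auto intro: Ck_on_bounded_linear)

lemma smooth_on_add:
  "open S \<Longrightarrow> smooth_on S f \<Longrightarrow> smooth_on S g \<Longrightarrow> smooth_on S (\<lambda>x. f x + g x)"
  unfolding smooth_on_def by (auto intro: Ck_on_add)

lemma smooth_on_bilinear:
  "bounded_bilinear B \<Longrightarrow> open S \<Longrightarrow> smooth_on S f \<Longrightarrow> smooth_on S g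
    \<Longrightarrow> smooth_on S (\<lambda>x. B (f x) (g x))"
  unfolding smooth_on_def by (auto intro: Ck_on_bilinear)

lemma smooth_on_diff:
  assumes "open S" "smooth_on S f" "smooth_on S g"
  shows "smooth_on S (\<lambda>x. f x - g x)"
  using smooth_on_add[OF assms(1,2) smooth_on_bounded_linear[OF bounded_linear_minus[OF
        bounded_linear_ident] assms(1,3)]]
  by simp

lemma smooth_on_sum:
  "open S \<Longrightarrow> (\<And>i. i \<in> I \<Longrightarrow> smooth_on S (f i)) \<Longrightarrow> smooth_on S (\<lambda>x. \<Sum>i\<in>I. f i x)"
  unfolding smooth_on_def by (auto intro: Ck_on_sum)

lemmas smooth_on_mult = smooth_on_bilinear[OF bounded_bilinear_mult]
  and smooth_on_scaleR = smooth_on_bilinear[OF bounded_bilinear_scaleR]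
  and smooth_on_inner_left = smooth_on_bounded_linear[OF bounded_linear_inner_left]

lemma smooth_on_compose:
  fixes f :: "'d::euclidean_space \<Rightarrow> 'e::euclidean_space" and g :: "'e \<Rightarrow> 'f::real_normed_vector"
  shows "open S \<Longrightarrow> smooth_on S f \<Longrightarrow> smooth_on T g \<Longrightarrow> f ` S \<subseteq> T \<Longrightarrow> smooth_on S (\<lambda>x. g (f x))"
  unfolding smooth_on_def using Ck_on_compose by blast

lemma smooth_on_imp_continuous_on: "smooth_on S f \<Longrightarrow> continuous_on S f"
  unfolding smooth_on_def using Ck_on.simps(1) by blast

lemma smooth_on_has_derivative:
  "smooth_on S f \<Longrightarrow> x \<in> S \<Longrightarrow> (f has_derivative frechet_derivative f (at x)) (at x)"
  unfolding smooth_on_def using Ck_on.simps(2) has_derivative_frechet by blast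

lemma smooth_on_frechet_derivative:
  "smooth_on S f \<Longrightarrow> smooth_on S (\<lambda>x. frechet_derivative f (at x) v)"
  unfolding smooth_on_def by (metis Ck_on.simps(2))

lemma smooth_on_euclidean:
  fixes f :: "'e::euclidean_space \<Rightarrow> 'f::euclidean_space"
  assumes "open S" "\<And>b. b \<in> Basis \<Longrightarrow> smooth_on S (\<lambda>x. f x \<bullet> b)"
  shows "smooth_on S f"
proof (rule smooth_on_cong)
  show "smooth_on S (\<lambda>x. \<Sum>b\<in>Basis. (f x \<bullet> b) *\<^sub>R b)"
    by (intro smooth_on_sum smooth_on_bounded_linear[OF bounded_linear_scaleR_left] assms)
qed (simp_all add: assms euclidean_representation)

section \<open>Total differential equations\<close>

text \<open>Banach's fixed point theorem for the integral operator on bounded continuous functions.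
  \<open>\<delta> * M \<le> \<epsilon>\<close> keeps the values in the ball around
  \<open>z0\<close>, and \<open>\<delta> * C \<le> 1/2\<close> makes the operator a
  contraction.\<close>

lemma integral_equation_solution:
  fixes Q :: "'e::euclidean_space \<Rightarrow> ('f::euclidean_space \<Rightarrow>\<^sub>L 'e)"
  assumes Qb: "\<And>z. z \<in> cball z0 \<epsilon> \<Longrightarrow> norm (Q z) \<le> M"
    and Ql: "C-lipschitz_on (cball z0 \<epsilon>) Q"
    and pos: "0 < \<delta>" "0 \<le> M" "\<delta> * M \<le> \<epsilon>" "\<delta> * C \<le> 1/2"
  obtains g where "continuous_on UNIV g"
    "\<And>x. x \<in> cball 0 \<delta> \<Longrightarrow> g x \<in> cball z0 \<epsilon>"
    "\<And>x. x \<in> cball 0 \<delta> \<Longrightarrow> g x = z0 + integral {0..1} (\<lambda>t. Q (g (t *\<^sub>R x)) x)"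
proof -
  \<comment> \<open>The closest-point retractions \<open>cE\<close> and \<open>cF\<close> are
    nonexpansive. Inserting them makes the operator act on all bounded continuous functions on the
    whole space, a complete type; they disappear again at the fixed point.\<close>
  define cE where "cE = closest_point (cball z0 \<epsilon>)"
  define cF where "cF = closest_point (cball (0::'f) \<delta>)"
  define K where "K h x = z0 + integral {0..1} (\<lambda>t. Q (cE (h (t *\<^sub>R cF x))) (cF x))" for h x
  have C0: "0 \<le> C" using Ql by (rule lipschitz_on_nonneg)
  have e0: "0 \<le> \<epsilon>" using pos by (meson dual_order.trans less_imp_le mult_nonneg_nonneg)
  have neE: "cball z0 \<epsilon> \<noteq> {}" and neF: "cball (0::'f) \<delta> \<noteq> {}" using pos(1) e0 by auto
  have cE_in: "cE z \<in> cball z0 \<epsilon>" for z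
    unfolding cE_def by (rule closest_point_in_set[OF closed_cball neE])
  have cF_in: "norm (cF x) \<le> \<delta>" for x
    using closest_point_in_set[OF closed_cball neF] unfolding cF_def by simp
  have cE_lip: "dist (cE y) (cE z) \<le> dist y z" for y z
    unfolding cE_def by (rule closest_point_lipschitz[OF convex_cball closed_cball neE])
  have ccE: "continuous_on T cE" for T
    unfolding cE_def by (rule continuous_on_closest_point[OF convex_cball closed_cball neE])
  have ccF: "continuous_on T cF" for T
    unfolding cF_def by (rule continuous_on_closest_point[OF convex_cball closed_cball neF])
  have Qc: "continuous_on (cball z0 \<epsilon>) Q" using Ql by (rule lipschitz_on_continuous_on)
  have QcE: "continuous_on T (\<lambda>x. Q (cE (f x)))" if "continuous_on T f" for f :: "'x::topological_space \<Rightarrow> 'e" and T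
    by (rule continuous_on_compose2[OF Qc]) (use cE_in continuous_on_compose2[OF ccE that] in auto)
  have app: "continuous_on T (\<lambda>x. blinfun_apply (f x) (k x))" if "continuous_on T f" "continuous_on T k"
    for f :: "'x::topological_space \<Rightarrow> ('f \<Rightarrow>\<^sub>L 'e)" and k T
    using that by (rule bounded_bilinear.continuous_on[OF bounded_bilinear_blinfun_apply])
  have jc: "continuous_on (T \<times> cbox 0 1) (\<lambda>(x, t). Q (cE (h (t *\<^sub>R cF x))) (cF x))"
    if h: "continuous_on UNIV h" for h and T :: "'f set"
  proof -
    have F: "continuous_on (T \<times> cbox 0 1) (\<lambda>p. cF (fst p))"
      by (rule continuous_on_compose2[OF ccF[of UNIV]]) (auto intro: continuous_on_fst continuous_on_id)
    have "continuous_on (T \<times> cbox 0 1) (\<lambda>p. h (snd p *\<^sub>R cF (fst p)))"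
      by (rule continuous_on_compose2[OF h continuous_on_scaleR[OF _ F]])
        (auto intro: continuous_on_snd continuous_on_id)
    from app[OF QcE[OF this] F] show ?thesis by (simp add: case_prod_beta)
  qed
  have rc: "continuous_on {0..1} (\<lambda>t. Q (cE (h (t *\<^sub>R cF x))) (cF x))"
    if h: "continuous_on UNIV h" for h x
    by (rule continuous_on_compose2[OF jc[OF h, of UNIV], of "{0..1}" "\<lambda>t. (x, t)", simplified])
      (auto intro!: continuous_on_Pair continuous_on_const continuous_on_id)
  have Kc: "continuous_on UNIV (K h)" if h: "continuous_on UNIV h" for h
    unfolding K_def using integral_continuous_on_param[OF jc[OF h]]
    by (intro continuous_on_add continuous_on_const) simp
  have Kb: "dist z0 (K h x) \<le> \<epsilon>" if h: "continuous_on UNIV h" for h x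
  proof -
    have "norm (Q (cE (h (t *\<^sub>R cF x))) (cF x)) \<le> M * \<delta>" for t
      by (rule order_trans[OF norm_blinfun])
        (intro mult_mono Qb cE_in cF_in pos norm_ge_zero)
    then have "norm (integral {0..1} (\<lambda>t. Q (cE (h (t *\<^sub>R cF x))) (cF x))) \<le> M * \<delta> * (1 - 0)"
      by (intro integral_bound rc h) auto
    then show ?thesis using pos by (simp add: K_def dist_norm mult.commute)
  qed
  have Kbc: "K h \<in> bcontfun" if h: "continuous_on UNIV h" for h
  proof (rule bcontfun_normI[OF Kc[OF h]])
    show "norm (K h x) \<le> norm z0 + \<epsilon>" for x
      using Kb[OF h, of x] norm_triangle_ineq4[of z0 "z0 - K h x"] by (simp add: dist_norm)
  qed
  define T where "T h = Bcontfun (K (apply_bcontfun h))" for h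
  have hc: "continuous_on UNIV (apply_bcontfun h)" for h :: "'f \<Rightarrow>\<^sub>C 'e" by simp
  have Tap: "apply_bcontfun (T h) = K (apply_bcontfun h)" for h
    unfolding T_def by (rule Bcontfun_inverse[OF Kbc[OF hc]])
  have "dist (T h) (T k) \<le> 1/2 * dist h k" for h k
  proof (rule dist_bound)
    fix x
    let ?q = "\<lambda>h t. Q (cE (apply_bcontfun h (t *\<^sub>R cF x)))"
    have "norm (?q h t (cF x) - ?q k t (cF x)) \<le> (C * dist h k) * \<delta>" for t
    proof -
      have "norm (?q h t - ?q k t) \<le> C * dist (cE (apply_bcontfun h (t *\<^sub>R cF x)))
          (cE (apply_bcontfun k (t *\<^sub>R cF x)))"
        using lipschitz_onD[OF Ql cE_in cE_in] by (simp add: dist_norm)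
      also have "\<dots> \<le> C * dist h k"
        using cE_lip dist_bounded C0 by (intro mult_left_mono) (blast intro: order_trans)+
      finally have "norm (?q h t - ?q k t) * norm (cF x) \<le> (C * dist h k) * \<delta>"
        by (intro mult_mono cF_in) (auto simp: C0)
      then show ?thesis
        using norm_blinfun[of "?q h t - ?q k t" "cF x"] by (simp add: blinfun.diff_left)
    qed
    then have "norm (integral {0..1} (\<lambda>t. ?q h t (cF x) - ?q k t (cF x)))
        \<le> (C * dist h k) * \<delta> * (1 - 0)"
      by (intro integral_bound continuous_on_diff rc hc) auto
    moreover have "integral {0..1} (\<lambda>t. ?q h t (cF x) - ?q k t (cF x))
        = K (apply_bcontfun h) x - K (apply_bcontfun k) x"
      unfolding K_def by (simp add: Henstock_Kurzweil_Integration.integral_diff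
          integrable_continuous_real rc hc)
    moreover have "(C * dist h k) * \<delta> \<le> 1/2 * dist h k"
      using mult_right_mono[OF pos(4), of "dist h k"] by (simp add: mult_ac)
    ultimately show "dist (apply_bcontfun (T h) x) (apply_bcontfun (T k) x) \<le> 1/2 * dist h k"
      by (simp add: Tap dist_norm)
  qed
  then obtain h where h: "T h = h" using banach_fix_type[of "1/2" T] by auto
  define g where "g = apply_bcontfun h"
  have gK: "g = K g" using Tap[of h] unfolding h g_def .
  have gc: "continuous_on UNIV g" unfolding g_def by (rule hc)
  have gin: "g x \<in> cball z0 \<epsilon>" for x
    using Kb[OF gc, of x] unfolding gK[symmetric] by simp
  have "cE (g x) = g x" for x unfolding cE_def by (rule closest_point_self[OF gin])
  moreover have "cF x = x" if "x \<in> cball 0 \<delta>" for x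
    unfolding cF_def using that by (rule closest_point_self)
  ultimately have "g x = z0 + integral {0..1} (\<lambda>t. Q (g (t *\<^sub>R x)) x)" if "x \<in> cball 0 \<delta>" for x
    using fun_cong[OF gK, of x] that unfolding K_def by simp
  then show ?thesis using that gc gin by blast
qed

text \<open>A substitute for Gronwall's inequality on the unit interval: at a point \<open>s\<close>
  where \<open>norm (e s)\<close> is maximal, the mean value inequality gives
  \<open>norm (e s) \<le> norm (e s) / 2 + c\<close>.\<close>

lemma max_argument_bound:
  fixes e :: "real \<Rightarrow> 'e::real_normed_vector"
  assumes d: "\<And>t. t \<in> {0..1} \<Longrightarrow> (e has_vector_derivative e' t) (at t within {0..1})"
    and e0: "e 0 = 0"
    and b: "\<And>t. t \<in> {0..1} \<Longrightarrow> norm (e' t) \<le> norm (e t) / 2 + c"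
    and t: "t \<in> {0..1}"
  shows "norm (e t) \<le> 2 * c"
proof -
  have "continuous_on {0..1} (\<lambda>t. norm (e t))"
    by (rule continuous_on_norm[OF continuous_on_vector_derivative[OF d]])
  then obtain s where s: "s \<in> {0..1}" "\<And>t. t \<in> {0..1} \<Longrightarrow> norm (e t) \<le> norm (e s)"
    using continuous_attains_sup[of "{0..1::real}" "\<lambda>t. norm (e t)"] by auto
  have B: "norm (e' t) \<le> norm (e s) / 2 + c" if "t \<in> {0..1}" for t
    using b[OF that] s(2)[OF that] by simp
  have B0: "0 \<le> norm (e s) / 2 + c" using B[OF s(1)] norm_ge_zero order_trans by blast
  have "norm (e s - e 0) \<le> (norm (e s) / 2 + c) * norm (s - 0)"
  proof (rule differentiable_bound[of "{0..1}" e "\<lambda>t h. h *\<^sub>R e' t"])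
    show "onorm (\<lambda>h. h *\<^sub>R e' t) \<le> norm (e s) / 2 + c" if "t \<in> {0..1}" for t
      by (rule onorm_le) (use B[OF that] in \<open>simp add: mult.commute[of _ "norm (e' t)"] mult_right_mono\<close>)
  qed (use d s(1) in \<open>auto simp: has_vector_derivative_def\<close>)
  also have "\<dots> \<le> norm (e s) / 2 + c"
    using s(1) B0 mult_left_le[of "\<bar>s\<bar>" "norm (e s) / 2 + c"] by simp
  finally have "norm (e s) \<le> norm (e s) / 2 + c" by (simp add: e0)
  with s(2)[OF t] show ?thesis by simp
qed

text \<open>\<open>Q'\<close> is uniformly continuous on the compact set, and by convexity the
  segment from \<open>z\<close> to \<open>y\<close> stays in it; so one \<open>\<rho>\<close> serves
  all base points, as is required along a whole curve.\<close>

lemma uniform_linearization: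
  fixes Q :: "'e::euclidean_space \<Rightarrow> 'g::real_normed_vector"
  assumes K: "compact K" "convex K"
    and Q': "\<And>z. z \<in> K \<Longrightarrow> (Q has_derivative blinfun_apply (Q' z)) (at z)"
    and cont: "continuous_on K Q'" and \<eta>: "0 < \<eta>"
  obtains \<rho> where "0 < \<rho>" "\<And>y z. y \<in> K \<Longrightarrow> z \<in> K \<Longrightarrow> norm (y - z) < \<rho>
    \<Longrightarrow> norm (Q y - Q z - Q' z (y - z)) \<le> \<eta> * norm (y - z)"
proof -
  obtain \<rho> where \<rho>: "0 < \<rho>" "\<And>y z. y \<in> K \<Longrightarrow> z \<in> K \<Longrightarrow> dist y z < \<rho> \<Longrightarrow> dist (Q' y) (Q' z) < \<eta>"
    using compact_uniformly_continuous[OF cont K(1)] \<eta> unfolding uniformly_continuous_on_def by metis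
  have "norm (Q y - Q z - Q' z (y - z)) \<le> norm (y - z) * \<eta>"
    if yz: "y \<in> K" "z \<in> K" "norm (y - z) < \<rho>" for y z
  proof (rule differentiable_bound_linearization[where S = "closed_segment z y" and f' = "\<lambda>z. blinfun_apply (Q' z)"])
    have sub: "closed_segment z y \<subseteq> K" using K yz by (simp add: closed_segment_subset)
    show "(Q has_derivative blinfun_apply (Q' x)) (at x within closed_segment z y)"
      if "x \<in> closed_segment z y" for x
      using Q' sub that has_derivative_at_withinI by blast
    show "onorm (blinfun_apply (Q' x) - blinfun_apply (Q' z)) \<le> \<eta>" if x: "x \<in> closed_segment z y" for x
    proof -
      have "dist x z < \<rho>" using x yz(3) dist_in_closed_segment[of x z y]
        by (simp add: dist_norm norm_minus_commute)
      then have "norm (Q' x - Q' z) < \<eta>" using \<rho>(2)[of x z] x sub yz by (auto simp: dist_norm)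
      then show ?thesis by (simp add: norm_blinfun.rep_eq minus_blinfun.rep_eq fun_diff_def)
    qed
    show "z + t *\<^sub>R (y - z) \<in> closed_segment z y" if "t \<in> {0..1}" for t
      using that by (auto simp: closed_segment_def algebra_simps intro!: exI[of _ t])
  qed simp
  then show ?thesis using that[OF \<rho>(1)] by (simp add: mult.commute)
qed

text \<open>Substituting \<open>\<sigma> = s t\<close> shows that \<open>g (s x) - z0\<close> is the
  integral of \<open>G (\<sigma> x) x\<close> over \<open>[0, s]\<close>, so \<open>g\<close> is a
  primitive along each ray.\<close>

lemma ray_derivative:
  fixes G :: "'f::real_normed_vector \<Rightarrow> ('f \<Rightarrow>\<^sub>L 'e::banach)"
  assumes G: "continuous_on (cball 0 \<delta>) G"
    and eq: "\<And>x. x \<in> cball 0 \<delta> \<Longrightarrow> g x = z0 + integral {0..1} (\<lambda>t. G (t *\<^sub>R x) x)"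
    and x: "x \<in> cball 0 \<delta>" and t: "t \<in> {0..1}"
  shows "((\<lambda>s. g (s *\<^sub>R x)) has_vector_derivative G (t *\<^sub>R x) x) (at t within {0..1})"
proof -
  define k where "k s = G (s *\<^sub>R x) x" for s
  define I where "I s = integral {0..s} k" for s
  have in_ball: "s *\<^sub>R x \<in> cball 0 \<delta>" if "s \<in> {0..1}" for s
    using that x mult_left_le_one_le[of "norm x" s] by simp
  have kc: "continuous_on {0..1} k"
    unfolding k_def
    by (intro bounded_bilinear.continuous_on[OF bounded_bilinear_blinfun_apply] continuous_on_const
        continuous_on_compose2[OF G]) (use in_ball in \<open>auto intro!: continuous_on_scaleR continuous_on_id continuous_on_const\<close>)
  have Id: "(I has_vector_derivative k s) (at s within {0..1})" if "s \<in> {0..1}" for s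
    unfolding I_def using integral_has_vector_derivative[OF kc that] .
  have "g (s *\<^sub>R x) = z0 + I s" if s: "s \<in> {0..1}" for s
  proof -
    \<comment> \<open>The substitution is carried out by differentiating
      \<open>I (\<tau> * s)\<close> and applying the fundamental theorem, which includes the
      degenerate case \<open>s = 0\<close>.\<close>
    have "((\<lambda>\<tau>. I (\<tau> * s)) has_vector_derivative s *\<^sub>R k (\<tau> * s)) (at \<tau> within {0..1})"
      if \<tau>: "\<tau> \<in> {0..1}" for \<tau>
    proof -
      have im: "(\<lambda>\<tau>. \<tau> * s) ` {0..1} \<subseteq> {0..1}" using s by (auto intro: mult_le_one)
      have 1: "((\<lambda>\<tau>. \<tau> * s) has_vector_derivative s) (at \<tau> within {0..1})"
        by (rule has_vector_derivative_eq_rhs[OF has_vector_derivative_mult_left[OF has_vector_derivative_id]]) simp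
      have 2: "(I has_vector_derivative k (\<tau> * s)) (at (\<tau> * s) within (\<lambda>\<tau>. \<tau> * s) ` {0..1})"
        by (rule has_vector_derivative_within_subset[OF Id im]) (use \<tau> s in \<open>auto intro: mult_le_one\<close>)
      show ?thesis using vector_diff_chain_within[OF 1 2] by (simp add: o_def)
    qed
    then have "((\<lambda>\<tau>. s *\<^sub>R k (\<tau> * s)) has_integral (I (1 * s) - I (0 * s))) {0..1}"
      by (intro fundamental_theorem_of_calculus) auto
    from integral_unique[OF this] have "integral {0..1} (\<lambda>\<tau>. s *\<^sub>R k (\<tau> * s)) = I s"
      by (simp add: I_def)
    moreover have "(\<lambda>\<tau>. s *\<^sub>R k (\<tau> * s)) = (\<lambda>\<tau>. G (\<tau> *\<^sub>R (s *\<^sub>R x)) (s *\<^sub>R x))"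
      by (simp add: k_def blinfun.scaleR_right)
    ultimately have "integral {0..1} (\<lambda>\<tau>. G (\<tau> *\<^sub>R (s *\<^sub>R x)) (s *\<^sub>R x)) = I s"
      by (simp only:)
    then show ?thesis using eq[OF in_ball[OF s]] by (simp only:)
  qed
  then have gI: "g (s *\<^sub>R x) = z0 + I s" if "s \<in> {0..1}" for s using that by simp
  have "((\<lambda>s. z0 + I s) has_vector_derivative k t) (at t within {0..1})"
    using has_vector_derivative_add[OF has_vector_derivative_const Id[OF t], of z0] by simp
  from has_vector_derivative_transform[OF t gI this] show ?thesis unfolding k_def .
qed

text \<open>The symmetry assumption is the integrability condition of Frobenius: \<open>g\<close> solves the equation
  along each ray through the origin, and symmetry shows that
  \<open>g (t x) + t Q (g (t x)) v\<close> solves the equation along the ray of \<open>x + v\<close> up to \<open>o(v)\<close>.\<close>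

lemma total_differential_equation:
  fixes Q :: "'e::euclidean_space \<Rightarrow> ('f::euclidean_space \<Rightarrow>\<^sub>L 'e)"
  assumes U: "open U" "z0 \<in> U"
    and Q': "\<And>z. z \<in> U \<Longrightarrow> (Q has_derivative blinfun_apply (Q' z)) (at z)"
    and cont: "continuous_on U Q'"
    and sym: "\<And>z v w. z \<in> U \<Longrightarrow> Q' z (Q z v) w = Q' z (Q z w) v"
  obtains \<delta> g where "0 < \<delta>" "g 0 = z0" "\<And>x. x \<in> ball 0 \<delta> \<Longrightarrow> g x \<in> U"
    "\<And>x. x \<in> ball 0 \<delta> \<Longrightarrow> (g has_derivative blinfun_apply (Q (g x))) (at x)"
proof -
  obtain \<epsilon> where \<epsilon>: "0 < \<epsilon>" "cball z0 \<epsilon> \<subseteq> U" using U open_contains_cball by blast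
  let ?B = "cball z0 \<epsilon>"
  have Qd: "(Q has_derivative blinfun_apply (Q' z)) (at z)" if "z \<in> ?B" for z using Q' \<epsilon> that by blast
  have cQ': "continuous_on ?B Q'" using cont \<epsilon> continuous_on_subset by blast
  have cQ: "continuous_on ?B Q"
    using Qd by (meson continuous_at_imp_continuous_on has_derivative_continuous)
  obtain M where M: "0 < M" "\<And>z. z \<in> ?B \<Longrightarrow> norm (Q z) \<le> M"
    using compact_imp_bounded[OF compact_continuous_image[OF cQ compact_cball]] unfolding bounded_pos by auto
  obtain C where C: "0 < C" "\<And>z. z \<in> ?B \<Longrightarrow> norm (Q' z) \<le> C"
    using compact_imp_bounded[OF compact_continuous_image[OF cQ' compact_cball]] unfolding bounded_pos by auto
  have "norm (Q y - Q z) \<le> C * norm (y - z)" if "y \<in> ?B" "z \<in> ?B" for y z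
    using differentiable_bound[OF convex_cball has_derivative_at_withinI[OF Qd], of z0 \<epsilon> C y z] C that
    by (simp add: norm_blinfun.rep_eq)
  then have Ql: "norm (Q y - Q z) \<le> C * norm (y - z)" if "y \<in> ?B" "z \<in> ?B" for y z
    using that by blast
  then have lip: "C-lipschitz_on ?B Q" using C(1) by (auto intro!: lipschitz_onI simp: dist_norm)
  define \<delta> where "\<delta> = min (\<epsilon> / M) (1 / (2 * C))"
  have \<delta>: "0 < \<delta>" "\<delta> * M \<le> \<epsilon>" "\<delta> * C \<le> 1/2"
    using \<epsilon>(1) M(1) C(1) unfolding \<delta>_def by (auto simp: min_def field_simps)
  obtain g where g: "continuous_on UNIV g" "\<And>x. x \<in> cball 0 \<delta> \<Longrightarrow> g x \<in> ?B"
    "\<And>x. x \<in> cball 0 \<delta> \<Longrightarrow> g x = z0 + integral {0..1} (\<lambda>t. Q (g (t *\<^sub>R x)) x)"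
    using integral_equation_solution[OF M(2) lip \<delta>(1) _ \<delta>(2,3)] M(1) by auto
  have in_ball: "t *\<^sub>R x \<in> cball 0 \<delta>" if "t \<in> {0..1}" "x \<in> cball 0 \<delta>" for t and x :: 'f
    using that mult_left_le_one_le[of "norm x" t] by simp
  have ray: "((\<lambda>s. g (s *\<^sub>R x)) has_vector_derivative Q (g (t *\<^sub>R x)) x) (at t within {0..1})"
    if "x \<in> cball 0 \<delta>" "t \<in> {0..1}" for x t
    by (rule ray_derivative[where G = "\<lambda>x. Q (g x)" and g = g, OF _ g(3) that])
      (rule continuous_on_compose2[OF cQ continuous_on_subset[OF g(1)]], use g(2) in auto)
  have g0: "g 0 = z0" using g(3)[of 0] \<delta>(1) by simp
  have "(g has_derivative blinfun_apply (Q (g x))) (at x)" if x: "x \<in> ball 0 \<delta>" for x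
    unfolding has_derivative_at_alt
  proof (intro conjI allI impI blinfun.bounded_linear_right)
    fix e :: real assume e: "0 < e"
    \<comment> \<open>Chosen so that \<open>4 * M * \<delta> * \<eta> = e / 2\<close>. In
      \<open>r\<close> below, the first entry keeps \<open>y\<close> in the ball, the second bounds
      the quadratic term by the other half of \<open>e\<close>, and the third brings the two rays
      within \<open>\<rho>\<close> of each other.\<close>
    define \<eta> where "\<eta> = e / (8 * M * \<delta>)"
    have \<eta>: "0 < \<eta>" unfolding \<eta>_def using e M(1) \<delta>(1) by simp
    obtain \<rho> where \<rho>: "0 < \<rho>" "\<And>y z. y \<in> ?B \<Longrightarrow> z \<in> ?B \<Longrightarrow> norm (y - z) < \<rho>
        \<Longrightarrow> norm (Q y - Q z - Q' z (y - z)) \<le> \<eta> * norm (y - z)"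
      using uniform_linearization[OF compact_cball convex_cball Qd cQ' \<eta>] by blast
    define r where "r = min (\<delta> - norm x) (min (e / (8 * M * C)) (\<rho> / (4 * M)))"
    have "0 < r" unfolding r_def using x e M(1) C(1) \<rho>(1) by simp
    moreover have "norm (g y - g x - Q (g x) (y - x)) \<le> e * norm (y - x)" if y: "norm (y - x) < r" for y
    proof -
      define v where "v = y - x"
      have v: "norm v < \<delta> - norm x" "norm v \<le> e / (8 * M * C)" "norm v < \<rho> / (4 * M)"
        using y unfolding v_def r_def by auto
      have xb: "x \<in> cball 0 \<delta>" and yb: "x + v \<in> cball 0 \<delta>" and nb: "norm (x + v) \<le> \<delta>"
        using x v(1) norm_triangle_ineq[of x v] by auto
      define a where "a t = g (t *\<^sub>R x)" for t
      define b where "b t = g (t *\<^sub>R (x + v))" for t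
      have aB: "a t \<in> ?B" and bB: "b t \<in> ?B" if "t \<in> {0..1}" for t
        unfolding a_def b_def using g(2) in_ball that xb yb by blast+
      have ad: "(a has_vector_derivative Q (a t) x) (at t within {0..1})"
        and bd: "(b has_vector_derivative Q (b t) (x + v)) (at t within {0..1})" if "t \<in> {0..1}" for t
        using ray[OF xb that] ray[OF yb that] unfolding a_def b_def by simp_all
      have ab0: "a 0 = b 0" by (simp add: a_def b_def)
      \<comment> \<open>The rays to \<open>x\<close> and \<open>x + v\<close> separate at most
        linearly in \<open>v\<close>: the change of \<open>Q\<close> between them is absorbed with
        factor 1/2, and \<open>Q (a t) v\<close> contributes \<open>M * norm v\<close>.\<close>
      define d where "d t = b t - a t" for t
      have d: "norm (d t) \<le> 2 * (M * norm v)" if "t \<in> {0..1}" for t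
      proof (rule max_argument_bound[OF _ _ _ that])
        fix t :: real assume t: "t \<in> {0..1}"
        show "(d has_vector_derivative Q (b t) (x + v) - Q (a t) x) (at t within {0..1})"
          unfolding d_def by (intro has_vector_derivative_diff ad bd t)
        have "Q (b t) (x + v) - Q (a t) x = (Q (b t) - Q (a t)) (x + v) + Q (a t) v"
          by (simp add: blinfun.bilinear_simps)
        moreover have "norm ((Q (b t) - Q (a t)) (x + v)) \<le> C * norm (d t) * \<delta>"
          unfolding d_def by (rule order_trans[OF norm_blinfun])
            (intro mult_mono Ql aB bB t nb mult_nonneg_nonneg less_imp_le[OF C(1)] norm_ge_zero)
        moreover have "norm (Q (a t) v) \<le> M * norm v"
          by (rule order_trans[OF norm_blinfun]) (intro mult_right_mono M(2) aB t norm_ge_zero)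
        moreover have "C * norm (d t) * \<delta> \<le> norm (d t) / 2"
          using mult_right_mono[OF \<delta>(3), of "norm (d t)"] by (simp add: mult_ac)
        ultimately show "norm (Q (b t) (x + v) - Q (a t) x) \<le> norm (d t) / 2 + M * norm v"
          using norm_triangle_ineq[of "(Q (b t) - Q (a t)) (x + v)" "Q (a t) v"] by simp
      qed (simp add: d_def ab0)
      \<comment> \<open>\<open>t *\<^sub>R Q (a t) v\<close> is the expected first-order separation,
        so \<open>f 1\<close> is the error of the claimed derivative at \<open>x\<close>.\<close>
      define f where "f t = d t - t *\<^sub>R Q (a t) v" for t
      have "norm (f 1) \<le> 2 * (\<eta> * (2 * (M * norm v)) * \<delta> + C * (2 * (M * norm v)) * norm v)"
      proof (rule max_argument_bound)
        fix t :: real assume t: "t \<in> {0..1}"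
        let ?f' = "Q (b t) (x + v) - Q (a t) x - (t *\<^sub>R Q' (a t) (Q (a t) x) v + 1 *\<^sub>R Q (a t) v)"
        have "((\<lambda>t. Q (a t)) has_vector_derivative Q' (a t) (Q (a t) x)) (at t within {0..1})"
          using vector_derivative_diff_chain_within[OF ad[OF t] has_derivative_at_withinI[OF Qd[OF aB[OF t]]]]
          by (simp add: o_def)
        then have "((\<lambda>t. Q (a t) v) has_vector_derivative Q' (a t) (Q (a t) x) v) (at t within {0..1})"
          by (rule bounded_linear.has_vector_derivative[OF blinfun.bounded_linear_left])
        then have "((\<lambda>t. t *\<^sub>R Q (a t) v) has_vector_derivative
            t *\<^sub>R Q' (a t) (Q (a t) x) v + 1 *\<^sub>R Q (a t) v) (at t within {0..1})"
          by (intro has_vector_derivative_scaleR DERIV_ident)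
        then show "(f has_vector_derivative ?f') (at t within {0..1})"
          unfolding f_def d_def by (intro has_vector_derivative_diff ad bd t)
        let ?R = "Q (b t) - Q (a t) - Q' (a t) (d t)"
        \<comment> \<open>Symmetry swaps \<open>x\<close> and \<open>v\<close>; then the term from
          differentiating \<open>t *\<^sub>R Q (a t) v\<close> combines with
          \<open>Q' (a t) (d t) x\<close> to \<open>Q' (a t) (f t) x\<close>, which the estimate
          absorbs. The other two terms of the next identity are bounded by \<open>\<eta>\<close>
          times, and by \<open>norm v\<close> times, a multiple of \<open>norm v\<close>.\<close>
        have s: "Q' (a t) (Q (a t) x) v = Q' (a t) (Q (a t) v) x" using sym aB[OF t] \<epsilon>(2) by blast
        have "?f' = ?R (x + v) + Q' (a t) (d t) v + Q' (a t) (f t) x"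
          unfolding s f_def by (simp add: blinfun.bilinear_simps algebra_simps)
        moreover have "norm (?R (x + v)) \<le> \<eta> * (2 * (M * norm v)) * \<delta>"
        proof (rule order_trans[OF norm_blinfun], intro mult_mono nb)
          have "2 * (M * norm v) < \<rho>"
            using v(3) M(1) \<rho>(1) by (simp add: field_simps)
          then have "norm ?R \<le> \<eta> * norm (d t)"
            using \<rho>(2)[OF bB[OF t] aB[OF t]] d[OF t] unfolding d_def by simp
          also have "\<dots> \<le> \<eta> * (2 * (M * norm v))" using d[OF t] \<eta> by simp
          finally show "norm ?R \<le> \<eta> * (2 * (M * norm v))" .
        qed (use \<eta> M(1) in simp_all)
        moreover have "norm (Q' (a t) (d t) v) \<le> C * (2 * (M * norm v)) * norm v"
          by (rule order_trans[OF norm_blinfun], rule mult_right_mono, rule order_trans[OF norm_blinfun])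
            (intro mult_mono C(2) aB t d less_imp_le[OF C(1)] norm_ge_zero)+
        moreover have "norm (Q' (a t) (f t) x) \<le> C * norm (f t) * \<delta>"
          by (rule order_trans[OF norm_blinfun], rule mult_mono, rule order_trans[OF norm_blinfun])
            (use x C aB t in \<open>auto intro!: mult_right_mono\<close>)
        moreover have "C * norm (f t) * \<delta> \<le> norm (f t) / 2"
          using mult_right_mono[OF \<delta>(3), of "norm (f t)"] by (simp add: mult_ac)
        ultimately show "norm ?f' \<le> norm (f t) / 2
            + (\<eta> * (2 * (M * norm v)) * \<delta> + C * (2 * (M * norm v)) * norm v)"
          using norm_triangle_ineq[of "?R (x + v) + Q' (a t) (d t) v" "Q' (a t) (f t) x"]
            norm_triangle_ineq[of "?R (x + v)" "Q' (a t) (d t) v"] by simp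
      qed (simp_all add: f_def d_def ab0)
      also have "\<dots> = (4 * M * \<delta> * \<eta> + 4 * M * C * norm v) * norm v" by (simp add: algebra_simps)
      also have "\<dots> \<le> e * norm v"
      proof (rule mult_right_mono)
        have "4 * M * \<delta> * \<eta> = e / 2" unfolding \<eta>_def using M(1) \<delta>(1) by (simp add: field_simps)
        moreover have "4 * M * C * norm v \<le> e / 2"
          using v(2) M(1) C(1) by (simp add: field_simps)
        ultimately show "4 * M * \<delta> * \<eta> + 4 * M * C * norm v \<le> e" by simp
      qed simp
      finally show ?thesis by (simp add: f_def d_def a_def b_def v_def)
    qed
    ultimately show "\<exists>d>0. \<forall>y. norm (y - x) < d \<longrightarrow>
        norm (g y - g x - Q (g x) (y - x)) \<le> e * norm (y - x)" by blast
  qed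
  moreover have "g x \<in> U" if "x \<in> ball 0 \<delta>" for x using g(2)[of x] \<epsilon>(2) that by auto
  ultimately show ?thesis using that \<delta>(1) g0 by blast
qed

section \<open>Bump functions and Hadamard's lemma\<close>

text \<open>The exponent \<open>m\<close> makes the family closed under differentiation.\<close>

definition flat_exp :: "nat \<Rightarrow> real \<Rightarrow> real" where
  "flat_exp m x = (if 0 < x then exp (- inverse x) * inverse x ^ m else 0)"

text \<open>Under \<open>x \<mapsto> 1/x\<close> the limit becomes that of
  \<open>x ^ m / exp x\<close> at infinity.\<close>

lemma flat_exp_tendsto_0: "(flat_exp m \<longlongrightarrow> 0) (at_right 0)"
proof -
  have "((\<lambda>x. flat_exp m (inverse x)) \<longlongrightarrow> 0) at_top"
  proof (rule Lim_transform_eventually[OF tendsto_power_div_exp_0[of m]])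
    show "\<forall>\<^sub>F x in at_top. x ^ m / exp x = flat_exp m (inverse x)"
      using eventually_gt_at_top[of 0]
      by eventually_elim (simp add: flat_exp_def exp_minus field_simps)
  qed
  then show ?thesis unfolding filterlim_at_right_to_top .
qed

text \<open>For \<open>x > 0\<close> this is the product rule; the delicate point is
  \<open>0\<close>, where the difference quotient of \<open>flat_exp m\<close> from the right is
  \<open>flat_exp (m + 1)\<close> and tends to zero.\<close>

lemma flat_exp_deriv:
  "(flat_exp m has_real_derivative flat_exp (m + 2) x - real m * flat_exp (m + 1) x) (at x)"
proof (cases x "0::real" rule: linorder_cases)
  case less
  have "(flat_exp m has_real_derivative 0) (at x)"
    by (rule has_field_derivative_transform_within_open[of "\<lambda>_. 0" _ _ "{..<0}"])
      (use less in \<open>auto simp: flat_exp_def\<close>)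
  with less show ?thesis by (simp add: flat_exp_def)
next
  case greater
  have 1: "((\<lambda>x. inverse x ^ m) has_real_derivative - real m * inverse x ^ (m + 1)) (at x)"
  proof (cases m)
    case (Suc n)
    have "((\<lambda>x. inverse x) has_real_derivative - (inverse x * inverse x)) (at x)"
      using greater by (auto intro!: derivative_eq_intros)
    from DERIV_power_Suc[OF this, of n] show ?thesis
      unfolding Suc by (rule DERIV_cong) (simp add: algebra_simps)
  qed simp
  have 2: "((\<lambda>x. exp (- inverse x)) has_real_derivative exp (- inverse x) * (inverse x * inverse x)) (at x)"
    using greater by (auto intro!: derivative_eq_intros)
  have "((\<lambda>x. exp (- inverse x) * inverse x ^ m) has_real_derivative
      flat_exp (m + 2) x - real m * flat_exp (m + 1) x) (at x)"
    by (rule DERIV_cong[OF DERIV_mult[OF 2 1]])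
      (use greater in \<open>simp add: flat_exp_def algebra_simps\<close>)
  then show ?thesis
    by (rule has_field_derivative_transform_within_open[of _ _ _ "{0<..}"])
      (use greater in \<open>auto simp: flat_exp_def\<close>)
next
  case equal
  have "((\<lambda>h. flat_exp m h / h) \<longlongrightarrow> 0) (at_right 0)"
  proof (rule Lim_transform_eventually[OF flat_exp_tendsto_0[of "m + 1"]])
    show "\<forall>\<^sub>F x in at_right 0. flat_exp (m + 1) x = flat_exp m x / x"
      using eventually_at_right_less[of "0::real"]
      by eventually_elim (simp add: flat_exp_def field_simps)
  qed
  moreover have "((\<lambda>h. flat_exp m h / h) \<longlongrightarrow> 0) (at_left 0)"
  proof (rule Lim_transform_eventually[OF tendsto_const])
    show "\<forall>\<^sub>F x in at_left 0. 0 = flat_exp m x / x"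
      using eventually_at_left_real[of "-1" "0::real"]
      by (auto elim!: eventually_mono simp: flat_exp_def)
  qed
  ultimately have "((\<lambda>h. flat_exp m h / h) \<longlongrightarrow> 0) (at 0)" by (simp add: filterlim_at_split)
  then show ?thesis using equal by (simp add: DERIV_def flat_exp_def)
qed

lemma smooth_on_flat_exp: "smooth_on UNIV (flat_exp m)"
proof -
  have "Ck_on k UNIV (flat_exp m)" for k
  proof (induction k arbitrary: m)
    case 0
    then show ?case
      by (simp add: DERIV_continuous_on[OF has_field_derivative_at_within[OF flat_exp_deriv]])
  next
    case (Suc k)
    show ?case
    proof (rule Ck_on_SucI)
      show "(flat_exp m has_derivative (\<lambda>v. (flat_exp (m + 2) x + (- real m) * flat_exp (m + 1) x) * v)) (at x)"
        for x using flat_exp_deriv[of m x] by (simp add: has_field_derivative_def)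
      show "Ck_on k UNIV (\<lambda>x. (flat_exp (m + 2) x + (- real m) * flat_exp (m + 1) x) * v)" for v
        by (rule Ck_on_bilinear[OF bounded_bilinear_mult] Ck_on_add Ck_on_const Suc.IH open_UNIV)+
    qed simp
  qed
  then show ?thesis by (simp add: smooth_on_def)
qed

lemma flat_exp_0_mono:
  assumes "x \<le> y"
  shows "flat_exp 0 x \<le> flat_exp 0 y"
  using assms by (auto simp: flat_exp_def intro: le_imp_inverse_le)

lemma smooth_bump:
  fixes z0 :: "'e::euclidean_space"
  assumes r: "0 < r"
  obtains \<theta> :: "'e \<Rightarrow> real" where "smooth_on UNIV \<theta>" "\<And>z. z \<notin> ball z0 r \<Longrightarrow> \<theta> z = 0"
    "\<And>z. z \<in> ball z0 (r / 2) \<Longrightarrow> \<theta> z = 1"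
proof -
  \<comment> \<open>\<open>t \<mapsto> 1 - flat_exp 0 (c - t) / flat_exp 0 c\<close> is \<open>0\<close> at \<open>0\<close> and \<open>1\<close> on \<open>[c, \<infinity>)\<close>, so a plateau
    arises without dividing by a function.\<close>
  define c where "c = flat_exp 0 (r\<^sup>2 / 2)"
  define s where "s z = r\<^sup>2 - (z - z0) \<bullet> (z - z0)" for z
  define \<theta> where "\<theta> z = 1 - inverse (flat_exp 0 c) * flat_exp 0 (c - flat_exp 0 (s z))" for z
  have c: "0 < c" using r by (simp add: c_def flat_exp_def)
  then have fc: "0 < flat_exp 0 c" by (simp add: flat_exp_def)
  have "smooth_on UNIV s"
    unfolding s_def
    by (rule smooth_on_diff smooth_on_bilinear[OF bounded_bilinear_inner] smooth_on_const
        smooth_on_id open_UNIV)+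
  then have "smooth_on UNIV (\<lambda>z. c - flat_exp 0 (s z))"
    by (intro smooth_on_diff smooth_on_const smooth_on_compose[OF _ _ smooth_on_flat_exp]) auto
  then have "smooth_on UNIV (\<lambda>z. flat_exp 0 (c - flat_exp 0 (s z)))"
    by (rule smooth_on_compose[OF open_UNIV _ smooth_on_flat_exp]) simp
  then have "smooth_on UNIV \<theta>"
    unfolding \<theta>_def by (intro smooth_on_diff smooth_on_mult smooth_on_const open_UNIV)
  moreover have "\<theta> z = 0" if "z \<notin> ball z0 r" for z
  proof -
    have "r\<^sup>2 \<le> (norm (z - z0))\<^sup>2"
      using that r by (intro power_mono) (auto simp: dist_norm norm_minus_commute)
    then have "s z \<le> 0" by (simp add: s_def power2_norm_eq_inner)
    then have "flat_exp 0 (s z) = 0" by (simp add: flat_exp_def)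
    then show ?thesis using fc by (simp add: \<theta>_def)
  qed
  \<comment> \<open>Here \<open>s\<close> is at least \<open>3 r^2 / 4\<close>, above the level
    \<open>r^2 / 2\<close> that defines \<open>c\<close>; hence the argument of the outer
    \<open>flat_exp\<close> is not positive.\<close>
  moreover have "\<theta> z = 1" if "z \<in> ball z0 (r / 2)" for z
  proof -
    have "(norm (z - z0))\<^sup>2 \<le> (r / 2)\<^sup>2"
      using that r by (intro power_mono) (auto simp: dist_norm norm_minus_commute)
    then have "(norm (z - z0))\<^sup>2 \<le> r\<^sup>2 / 4" by (simp add: power_divide)
    then have "r\<^sup>2 / 2 \<le> r\<^sup>2 - (norm (z - z0))\<^sup>2"
      using zero_le_power2[of r] by linarith
    then have "r\<^sup>2 / 2 \<le> s z" by (simp add: s_def power2_norm_eq_inner)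
    then have "c \<le> flat_exp 0 (s z)" unfolding c_def by (rule flat_exp_0_mono)
    then show ?thesis by (simp add: \<theta>_def flat_exp_def)
  qed
  ultimately show ?thesis using that by blast
qed

section \<open>First-order expansion with smooth coefficients\<close>

lemma has_derivative_gradient:
  fixes f :: "'e::euclidean_space \<Rightarrow> real"
  assumes "(f has_derivative f') (at x)"
  shows "f' v = v \<bullet> (\<Sum>b\<in>Basis. f' b *\<^sub>R b)"
proof -
  interpret bounded_linear f' using assms by (rule has_derivative_bounded_linear)
  have "f' v = f' (\<Sum>b\<in>Basis. (v \<bullet> b) *\<^sub>R b)" by (simp only: euclidean_representation)
  also have "\<dots> = (\<Sum>b\<in>Basis. (v \<bullet> b) * f' b)" by (simp only: sum scaleR real_scaleR_def)
  also have "\<dots> = v \<bullet> (\<Sum>b\<in>Basis. f' b *\<^sub>R b)" by (simp add: inner_sum_right mult.commute)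
  finally show ?thesis .
qed

text \<open>Differentiating under the integral replaces \<open>f\<close> by a directional derivative
  and, by the chain rule, raises the power of \<open>t\<close> by one. The weight
  \<open>t ^ m\<close> makes the family closed under this, so the induction on the order of
  differentiability goes through.\<close>

lemma smooth_on_segment_integral:
  fixes f :: "'e::euclidean_space \<Rightarrow> real"
  assumes "smooth_on (ball z0 r) f"
  shows "smooth_on (ball z0 r) (\<lambda>z. integral {0..1} (\<lambda>t. t ^ m * f (z0 + t *\<^sub>R (z - z0))))"
proof -
  let ?B = "ball z0 r"
  let ?p = "\<lambda>z t. z0 + t *\<^sub>R (z - z0)"
  have p: "?p z t \<in> ?B" if "z \<in> ?B" "t \<in> {0..1}" for z t
    using that mult_left_le_one_le[of "norm (z - z0)" t]
    by (simp add: dist_norm norm_minus_commute)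
  have cp: "continuous_on (?B \<times> cbox 0 1) (\<lambda>p. h (?p (fst p) (snd p)))"
    if "continuous_on ?B h" for h :: "'e \<Rightarrow> 'h::topological_space"
    by (rule continuous_on_compose2[OF that])
      (use p in \<open>auto intro!: continuous_intros\<close>)
  have cz: "continuous_on {0..1} (\<lambda>t. t ^ m * h (?p z t))"
    if "continuous_on ?B h" "z \<in> ?B" for h :: "'e \<Rightarrow> real" and z m
    by (intro continuous_on_mult continuous_on_power continuous_on_id continuous_on_compose2[OF that(1)])
      (use p that(2) in \<open>auto intro!: continuous_intros\<close>)
  have "Ck_on k ?B (\<lambda>z. integral (cbox 0 1) (\<lambda>t. t ^ m * f (?p z t)))" if "smooth_on ?B f" for k m f
    using that
  proof (induction k arbitrary: m f)
    case 0
    have "continuous_on (?B \<times> cbox 0 1) (\<lambda>p. snd p ^ m * f (?p (fst p) (snd p)))"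
      using 0 by (intro continuous_on_mult continuous_on_power cp continuous_on_snd continuous_on_id
          smooth_on_imp_continuous_on)
    then show ?case
      unfolding Ck_on.simps
      by (intro integral_continuous_on_param) (simp add: case_prod_beta)
  next
    case (Suc k)
    let ?df = "\<lambda>y. frechet_derivative f (at y)"
    define G where "G y = (\<Sum>b\<in>Basis. ?df y b *\<^sub>R b)" for y
    have sd: "smooth_on ?B (\<lambda>y. ?df y v)" for v
      using Suc.prems by (rule smooth_on_frechet_derivative)
    have G: "?df y v = v \<bullet> G y" if "y \<in> ?B" for y v
      unfolding G_def using has_derivative_gradient smooth_on_has_derivative[OF Suc.prems that] by blast
    have cG: "continuous_on ?B G"
      unfolding G_def
      by (intro continuous_on_sum continuous_on_scaleR continuous_on_const smooth_on_imp_continuous_on sd)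
    \<comment> \<open>The derivative of the integrand in the form suited to differentiation under
      the integral: a continuous function into bounded linear functionals, represented by the
      gradient \<open>G\<close>.\<close>
    define F where "F z t = t ^ (m + 1) *\<^sub>R blinfun_inner_left (G (?p z t))" for z t
    have cF: "continuous_on (?B \<times> cbox 0 1) (\<lambda>p. F (fst p) (snd p))"
      unfolding F_def
      by (intro continuous_on_scaleR continuous_on_power continuous_on_snd continuous_on_id
          bounded_linear.continuous_on[OF bounded_linear_blinfun_inner_left] cp[OF cG])
    have cFz: "continuous_on {0..1} (F z)" if "z \<in> ?B" for z
      by (rule continuous_on_compose2[OF cF, of _ "\<lambda>t. (z, t)", simplified])
        (use that in \<open>auto intro!: continuous_intros\<close>)
    show ?case
    proof (rule Ck_on_SucI)
      fix z assume z: "z \<in> ?B"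
      have "((\<lambda>z. integral (cbox 0 1) (\<lambda>t. t ^ m * f (?p z t))) has_derivative
          blinfun_apply (integral (cbox 0 1) (F z))) (at z within ?B)"
      proof (rule leibniz_rule[OF _ _ _ z convex_ball])
        fix y and t :: real assume y: "y \<in> ?B" and t: "t \<in> cbox 0 1"
        have pyt: "?p y t \<in> ?B" using p y t by simp
        have "((\<lambda>y. ?p y t) has_derivative (\<lambda>v. 0 + t *\<^sub>R (v - 0))) (at y)"
          by (intro has_derivative_add has_derivative_scaleR_right has_derivative_diff
              has_derivative_const has_derivative_ident)
        from has_derivative_mult_right[OF has_derivative_compose[OF this
              smooth_on_has_derivative[OF Suc.prems pyt]], of "t ^ m"]
        have "((\<lambda>y. t ^ m * f (?p y t)) has_derivative blinfun_apply (F y t)) (at y)"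
          by (rule has_derivative_eq_rhs) (simp add: fun_eq_iff G[OF pyt] F_def blinfun.scaleR_left)
        then show "((\<lambda>y. t ^ m * f (?p y t)) has_derivative blinfun_apply (F y t)) (at y within ?B)"
          by (rule has_derivative_at_withinI)
      next
        show "(\<lambda>t. t ^ m * f (?p y t)) integrable_on cbox 0 1" if "y \<in> ?B" for y
          using cz[OF smooth_on_imp_continuous_on[OF Suc.prems] that]
          by (simp add: integrable_continuous_real)
      qed (use cF in \<open>simp add: case_prod_beta\<close>)
      moreover have "blinfun_apply (integral (cbox 0 1) (F z))
          = (\<lambda>v. integral (cbox 0 1) (\<lambda>t. t ^ (m + 1) * ?df (?p z t) v))"
      proof
        fix v
        have "blinfun_apply (integral (cbox 0 1) (F z)) v = integral (cbox 0 1) (\<lambda>t. F z t v)"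
          using cFz[OF z] by (intro blinfun_apply_integral) (simp add: integrable_continuous_real)
        also have "\<dots> = integral (cbox 0 1) (\<lambda>t. t ^ (m + 1) * ?df (?p z t) v)"
          by (rule integral_cong) (use G[OF p[OF z]] in \<open>simp add: F_def blinfun.scaleR_left\<close>)
        finally show "blinfun_apply (integral (cbox 0 1) (F z)) v
          = integral (cbox 0 1) (\<lambda>t. t ^ (m + 1) * ?df (?p z t) v)" .
      qed
      ultimately show "((\<lambda>z. integral (cbox 0 1) (\<lambda>t. t ^ m * f (?p z t))) has_derivative
          (\<lambda>v. integral (cbox 0 1) (\<lambda>t. t ^ (m + 1) * ?df (?p z t) v))) (at z)"
        using at_within_open[OF z open_ball] by simp
    next
      show "Ck_on k ?B (\<lambda>z. integral (cbox 0 1) (\<lambda>t. t ^ (m + 1) * ?df (?p z t) v))" for v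
        by (rule Suc.IH[OF sd])
    qed simp
  qed
  with assms show ?thesis by (simp add: smooth_on_def)
qed

text \<open>The coefficient \<open>g b z\<close> is the integral over \<open>[0, 1]\<close> of the
  partial derivative in direction \<open>b\<close> at \<open>z0 + t (z - z0)\<close>; the expansion
  is the fundamental theorem of calculus on the segment, written in the basis.\<close>

lemma Hadamard:
  fixes f :: "'e::euclidean_space \<Rightarrow> real"
  assumes f: "smooth_on (ball z0 r) f"
  obtains g where "\<And>b. smooth_on (ball z0 r) (g b)"
    "\<And>z. z \<in> ball z0 r \<Longrightarrow> f z = f z0 + (\<Sum>b\<in>Basis. ((z - z0) \<bullet> b) * g b z)"
    "\<And>b. g b z0 = frechet_derivative f (at z0) b"
proof -
  let ?B = "ball z0 r"
  let ?p = "\<lambda>z t. z0 + t *\<^sub>R (z - z0)"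
  let ?df = "\<lambda>y. frechet_derivative f (at y)"
  define g where "g b z = integral {0..1} (\<lambda>t. t ^ 0 * ?df (?p z t) b)" for b z
  have p: "?p z t \<in> ?B" if "z \<in> ?B" "t \<in> {0..1}" for z t
    using that mult_left_le_one_le[of "norm (z - z0)" t]
    by (simp add: dist_norm norm_minus_commute)
  have "smooth_on ?B (g b)" for b
    unfolding g_def using smooth_on_segment_integral smooth_on_frechet_derivative[OF f] by blast
  moreover have "g b z0 = ?df z0 b" for b by (simp add: g_def)
  moreover have "f z = f z0 + (\<Sum>b\<in>Basis. ((z - z0) \<bullet> b) * g b z)" if z: "z \<in> ?B" for z
  proof -
    have d: "((\<lambda>t. f (?p z t)) has_vector_derivative ?df (?p z t) (z - z0)) (at t within {0..1})"
      if "t \<in> {0..1}" for t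
    proof -
      have 1: "((\<lambda>t. ?p z t) has_derivative (\<lambda>s. s *\<^sub>R (z - z0))) (at t)"
        by (auto intro!: derivative_eq_intros)
      have 2: "(f has_derivative ?df (?p z t)) (at (?p z t))"
        using smooth_on_has_derivative[OF f p[OF z that]] .
      have "linear (?df (?p z t))" using 2 by (rule has_derivative_linear)
      then show ?thesis
        using has_derivative_at_withinI[OF has_derivative_compose[OF 1 2]]
        by (simp add: has_vector_derivative_def linear_scale)
    qed
    have "((\<lambda>t. ?df (?p z t) (z - z0)) has_integral f (?p z 1) - f (?p z 0)) {0..1}"
      by (rule fundamental_theorem_of_calculus) (use d in auto)
    then have "f z - f z0 = integral {0..1} (\<lambda>t. ?df (?p z t) (z - z0))"
      by (simp add: integral_unique)
    also have "\<dots> = integral {0..1} (\<lambda>t. \<Sum>b\<in>Basis. ((z - z0) \<bullet> b) * ?df (?p z t) b)"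
    proof (rule integral_cong)
      fix t :: real assume "t \<in> {0..1}"
      from has_derivative_gradient[OF smooth_on_has_derivative[OF f p[OF z this]], of "z - z0"]
      show "?df (?p z t) (z - z0) = (\<Sum>b\<in>Basis. ((z - z0) \<bullet> b) * ?df (?p z t) b)"
        by (simp add: inner_sum_right mult.commute)
    qed
    also have "\<dots> = (\<Sum>b\<in>Basis. integral {0..1} (\<lambda>t. ((z - z0) \<bullet> b) * ?df (?p z t) b))"
    proof (rule Henstock_Kurzweil_Integration.integral_sum, simp)
      fix b
      show "(\<lambda>t. ((z - z0) \<bullet> b) * ?df (?p z t) b) integrable_on {0..1}"
      proof (intro integrable_continuous_real continuous_on_mult continuous_on_const)
        show "continuous_on {0..1} (\<lambda>t. ?df (?p z t) b)"
          by (rule continuous_on_compose2[OF smooth_on_imp_continuous_on[OF smooth_on_frechet_derivative[OF f]]])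
            (use p z in \<open>auto intro!: continuous_intros\<close>)
      qed
    qed
    also have "\<dots> = (\<Sum>b\<in>Basis. ((z - z0) \<bullet> b) * g b z)" by (simp add: g_def)
    finally show ?thesis by simp
  qed
  ultimately show ?thesis using that by blast
qed

section \<open>Inverses of operator-valued maps\<close>

text \<open>Operators on a Euclidean space are finite sums of rank-one operators built from their
  values on the basis.\<close>

lemma smooth_on_blinfun:
  fixes L :: "'e::euclidean_space \<Rightarrow> ('f::euclidean_space \<Rightarrow>\<^sub>L 'g::real_normed_vector)"
  assumes S: "open S" and L: "\<And>b. smooth_on S (\<lambda>z. L z b)"
  shows "smooth_on S L"
proof (rule smooth_on_cong)
  show "smooth_on S (\<lambda>z. \<Sum>b\<in>Basis. blinfun_scaleR_left (L z b) o\<^sub>L blinfun_inner_left b)"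
    by (intro smooth_on_sum S smooth_on_bilinear[OF bounded_bilinear_blinfun_compose] smooth_on_const
        smooth_on_bounded_linear[OF bounded_linear_blinfun_scaleR_left] L)
  fix z
  have "(\<Sum>b\<in>Basis. (v \<bullet> b) *\<^sub>R L z b) = L z v" for v
    using blinfun.sum_right[of "L z" "\<lambda>b. (v \<bullet> b) *\<^sub>R b" Basis]
    by (simp add: euclidean_representation blinfun.scaleR_right)
  then show "(\<Sum>b\<in>Basis. blinfun_scaleR_left (L z b) o\<^sub>L blinfun_inner_left b) = L z"
    by (intro blinfun_eqI) (simp add: blinfun.sum_left)
qed fact

text \<open>A product rule in which \<open>f\<close> is only continuous: since \<open>g\<close>
  vanishes at \<open>x\<close>, the correction \<open>p (f y - f x) (g y)\<close> is
  \<open>o(1)\<close> times \<open>O(norm (y - x))\<close>. It allows an operator inverse to be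
  differentiated before it is known to be differentiable.\<close>

lemma has_derivative_vanishing_factor:
  assumes p: "bounded_bilinear p" and f: "isCont f x" and g: "(g has_derivative g') (at x)" and g0: "g x = 0"
  shows "((\<lambda>y. p (f y) (g y)) has_derivative (\<lambda>h. p (f x) (g' h))) (at x)"
proof -
  interpret bounded_bilinear p by fact
  obtain K where K: "0 < K" "\<And>a b. norm (p a b) \<le> norm a * norm b * K" using pos_bounded by blast
  obtain C where C: "0 < C" "\<And>h. norm (g' h) \<le> norm h * C"
    using bounded_linear.pos_bounded[OF has_derivative_bounded_linear[OF g]] by blast
  have "((\<lambda>y. p (f y - f x) (g y)) has_derivative (\<lambda>h. 0)) (at x)"
    unfolding has_derivative_at_alt
  proof (intro conjI allI impI bounded_linear_zero)
    fix e :: real assume e: "0 < e"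
    obtain d1 where d1: "0 < d1" "\<And>y. norm (y - x) < d1 \<Longrightarrow> norm (g y - g x - g' (y - x)) \<le> 1 * norm (y - x)"
      using g unfolding has_derivative_at_alt by (meson zero_less_one)
    have "0 < e / ((1 + C) * K)" using e K(1) C(1) by simp
    then obtain d2 where d2: "0 < d2" "\<And>y. dist y x < d2 \<Longrightarrow> dist (f y) (f x) < e / ((1 + C) * K)"
      using f unfolding continuous_at_eps_delta by blast
    have "norm (p (f y - f x) (g y) - p (f x - f x) (g x) - 0) \<le> e * norm (y - x)"
      if y: "norm (y - x) < min d1 d2" for y
    proof -
      have "norm (g y) \<le> norm (g y - g' (y - x)) + norm (g' (y - x))"
        using norm_triangle_sub[of "g y" "g' (y - x)"] by simp
      also have "\<dots> \<le> (1 + C) * norm (y - x)"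
        using d1(2)[of y] C(2)[of "y - x"] y g0 by (simp add: algebra_simps)
      finally have 1: "norm (g y) \<le> (1 + C) * norm (y - x)" .
      have "norm (p (f y - f x) (g y)) \<le> norm (f y - f x) * norm (g y) * K" by (rule K)
      also have "\<dots> \<le> e / ((1 + C) * K) * ((1 + C) * norm (y - x)) * K"
        using 1 d2(2)[of y] y K(1) C(1) e
        by (intro mult_right_mono mult_mono) (auto simp: dist_norm)
      also have "\<dots> = (e / ((1 + C) * K) * ((1 + C) * K)) * norm (y - x)" by (simp only: mult_ac)
      also have "\<dots> = e * norm (y - x)" using K(1) C(1) by simp
      finally show ?thesis by (simp add: g0 zero_right)
    qed
    then show "\<exists>d>0. \<forall>y. norm (y - x) < d \<longrightarrow>
        norm (p (f y - f x) (g y) - p (f x - f x) (g x) - 0) \<le> e * norm (y - x)"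
      using d1(1) d2(1) by (intro exI[of _ "min d1 d2"]) auto
  qed
  from has_derivative_add[OF bounded_linear.has_derivative[OF bounded_linear_right[of "f x"] g] this]
  show ?thesis by (simp add: diff_left)
qed

text \<open>Everything rests on the identity \<open>R y = R z - R y (H y - H z) R z\<close>. With
  the bound on \<open>R\<close> it yields continuity; then, as \<open>H y - H z\<close> vanishes at
  \<open>z\<close>, it yields the derivative \<open>- R DH R\<close>. That formula contains only
  \<open>R\<close> and a derivative of \<open>H\<close>, so differentiability passes from order
  \<open>k\<close> to \<open>k + 1\<close>.\<close>

lemma smooth_on_blinfun_inverse:
  fixes H R :: "'e::euclidean_space \<Rightarrow> ('g::real_normed_vector \<Rightarrow>\<^sub>L 'g)"
  assumes S: "open S" and H: "smooth_on S H"
    and RH: "\<And>z. z \<in> S \<Longrightarrow> R z o\<^sub>L H z = id_blinfun" and HR: "\<And>z. z \<in> S \<Longrightarrow> H z o\<^sub>L R z = id_blinfun"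
    and b: "\<And>z. z \<in> S \<Longrightarrow> norm (R z) \<le> B"
  shows "smooth_on S R"
proof -
  have eq: "R y = R z - ((R y o\<^sub>L (H y - H z)) o\<^sub>L R z)" if "y \<in> S" "z \<in> S" for y z
  proof (rule blinfun_eqI)
    fix v
    have "R y (H y (R z v)) = R z v" using arg_cong[OF RH[OF that(1)], of "\<lambda>f. f (R z v)"] by simp
    moreover have "H z (R z v) = v" using arg_cong[OF HR[OF that(2)], of "\<lambda>f. f v"] by simp
    ultimately show "R y v = (R z - ((R y o\<^sub>L (H y - H z)) o\<^sub>L R z)) v"
      by (simp add: blinfun.bilinear_simps)
  qed
  have B0: "0 \<le> B" if "z \<in> S" for z using b[OF that] norm_ge_zero order_trans by blast
  have cont: "isCont R z" if z: "z \<in> S" for z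
  proof -
    have "isCont H z"
      using smooth_on_imp_continuous_on[OF H] S z by (simp add: continuous_on_eq_continuous_at)
    then have "(H \<longlongrightarrow> H z) (at z)" by (simp add: isCont_def)
    then have 1: "((\<lambda>y. B * norm (H y - H z) * B) \<longlongrightarrow> 0) (at z)"
      by (intro tendsto_mult_left_zero tendsto_mult_right_zero tendsto_norm_zero) (simp add: LIM_zero)
    have "\<forall>\<^sub>F y in at z. norm (R y - R z) \<le> B * norm (H y - H z) * B"
      using eventually_at_in_open'[OF S z]
    proof eventually_elim
      case (elim y)
      have "R y - R z = - ((R y o\<^sub>L (H y - H z)) o\<^sub>L R z)" using eq[OF elim z] by (metis add_diff_cancel_left' diff_conv_add_uminus)
      then have "norm (R y - R z) \<le> norm (R y o\<^sub>L (H y - H z)) * norm (R z)"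
        using norm_blinfun_compose by simp
      also have "\<dots> \<le> (norm (R y) * norm (H y - H z)) * norm (R z)"
        by (intro mult_right_mono norm_blinfun_compose norm_ge_zero)
      also have "\<dots> \<le> B * norm (H y - H z) * B"
        by (intro mult_mono b elim z order_refl norm_ge_zero mult_nonneg_nonneg B0[OF z])
      finally show ?case .
    qed
    with 1 have "((\<lambda>y. R y - R z) \<longlongrightarrow> 0) (at z)" by (rule Lim_null_comparison[rotated])
    then show ?thesis by (simp add: isCont_def LIM_zero_iff)
  qed
  have deriv: "(R has_derivative (\<lambda>v. - ((R z o\<^sub>L frechet_derivative H (at z) v) o\<^sub>L R z))) (at z)"
    if z: "z \<in> S" for z
  proof -
    have "((\<lambda>y. H y - H z) has_derivative (\<lambda>v. frechet_derivative H (at z) v - 0)) (at z)"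
      by (intro has_derivative_diff has_derivative_const smooth_on_has_derivative[OF H z])
    then have "((\<lambda>y. H y - H z) has_derivative frechet_derivative H (at z)) (at z)" by simp
    from has_derivative_vanishing_factor[OF bounded_bilinear_blinfun_compose cont[OF z] this]
    have 1: "((\<lambda>y. R y o\<^sub>L (H y - H z)) has_derivative (\<lambda>v. R z o\<^sub>L frechet_derivative H (at z) v)) (at z)"
      by simp
    have "((\<lambda>y. R z - ((R y o\<^sub>L (H y - H z)) o\<^sub>L R z)) has_derivative
        (\<lambda>v. 0 - ((R z o\<^sub>L frechet_derivative H (at z) v) o\<^sub>L R z))) (at z)"
      by (intro has_derivative_diff has_derivative_const bounded_linear.has_derivative[OF
            bounded_bilinear.bounded_linear_left[OF bounded_bilinear_blinfun_compose] 1])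
    then have "(R has_derivative (\<lambda>v. 0 - ((R z o\<^sub>L frechet_derivative H (at z) v) o\<^sub>L R z))) (at z)"
      by (rule has_derivative_transform_within_open[OF _ S z]) (simp add: eq[OF _ z, symmetric])
    then show ?thesis by simp
  qed
  have "Ck_on k S R" for k
  proof (induction k)
    case 0
    show ?case using cont by (simp add: continuous_at_imp_continuous_on)
  next
    case (Suc k)
    show ?case
    proof (rule Ck_on_SucI[OF S deriv])
      have "Ck_on k S (\<lambda>z. frechet_derivative H (at z) v)" for v
        using smooth_on_frechet_derivative[OF H] by (simp add: smooth_on_def)
      then show "Ck_on k S (\<lambda>z. - ((R z o\<^sub>L frechet_derivative H (at z) v) o\<^sub>L R z))" for v
        by (intro Ck_on_bounded_linear[OF bounded_linear_minus[OF bounded_linear_ident]] S Suc.IH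
            Ck_on_bilinear[OF bounded_bilinear_blinfun_compose])
    qed
  qed
  then show ?thesis by (simp add: smooth_on_def)
qed

text \<open>The estimate \<open>norm x \<le> 2 * norm (x + A x)\<close> gives injectivity, hence
  bijectivity in finite dimension, and at the same time the uniform bound 2 on which the smoothness
  of the inverse relies.\<close>

lemma blinfun_inverse_near_identity:
  fixes A :: "'e::euclidean_space \<Rightarrow>\<^sub>L 'e"
  assumes "norm A \<le> 1/2"
  obtains R where "R o\<^sub>L (id_blinfun + A) = id_blinfun" "(id_blinfun + A) o\<^sub>L R = id_blinfun" "norm R \<le> 2"
proof -
  let ?f = "\<lambda>x. x + A x"
  have lin: "linear ?f"
    by (intro linear_compose_add linear_ident bounded_linear.linear blinfun.bounded_linear_right)
  have low: "norm x \<le> 2 * norm (?f x)" for x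
  proof -
    have "norm (A x) \<le> 1/2 * norm x"
      by (rule order_trans[OF norm_blinfun]) (intro mult_right_mono assms norm_ge_zero)
    moreover have "norm x \<le> norm (?f x) + norm (A x)"
      using norm_triangle_ineq4[of "?f x" "A x"] by simp
    ultimately show ?thesis by simp
  qed
  have "inj ?f"
    unfolding linear_injective_0[OF lin] using low by (metis mult_zero_right norm_le_zero_iff norm_zero)
  then obtain h where h: "linear h" "\<And>x. h (?f x) = x" "\<And>x. ?f (h x) = x"
    using linear_injective_isomorphism[OF lin] by blast
  have bl: "bounded_linear h" using h(1) by (simp add: linear_conv_bounded_linear)
  show ?thesis
  proof
    show "Blinfun h o\<^sub>L (id_blinfun + A) = id_blinfun" "(id_blinfun + A) o\<^sub>L Blinfun h = id_blinfun"
      using h(2,3) by (auto intro!: blinfun_eqI simp: bounded_linear_Blinfun_apply[OF bl] blinfun.add_left)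
    show "norm (Blinfun h) \<le> 2"
      using low[of "h x" for x] h(3)
      by (intro norm_blinfun_bound) (auto simp: bounded_linear_Blinfun_apply[OF bl])
  qed
qed

section \<open>The theorem of Frobenius in Euclidean space\<close>

text \<open>The projections \<open>L z\<close> have a graph-like normal form \<open>Q z\<close>: it has the same range as
  \<open>L z\<close>, and \<open>L z0 \<circ> Q z\<close> does not depend on \<open>z\<close>.  For such a \<open>Q\<close> involutivity becomes symmetry
  of \<open>DQ z (Q z v) w\<close>.\<close>

lemma projection_normal_form:
  fixes L :: "'e::euclidean_space \<Rightarrow> ('e \<Rightarrow>\<^sub>L 'e)"
  assumes U: "open U" "z0 \<in> U" and L: "smooth_on U L"
    and idem: "\<And>z u. z \<in> U \<Longrightarrow> L z (L z u) = L z u"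
  obtains V and Q :: "'e \<Rightarrow> ('e \<Rightarrow>\<^sub>L 'e)" where "open V" "z0 \<in> V" "V \<subseteq> U" "smooth_on V Q"
    "\<And>z u. z \<in> V \<Longrightarrow> L z (Q z u) = Q z u"
    "\<And>z u. z \<in> V \<Longrightarrow> L z0 (Q z u) = L z0 u"
    "\<And>z u. z \<in> V \<Longrightarrow> Q z (L z0 u) = Q z u"
    "\<And>z w. z \<in> V \<Longrightarrow> L z w = w \<Longrightarrow> L z0 w = 0 \<Longrightarrow> w = 0"
proof -
  let ?L0 = "L z0"
  \<comment> \<open>Makes \<open>norm (A z) \<le> 1/2\<close> for the \<open>A\<close> below. The
    summand 1 covers \<open>L z0 = 0\<close> and also gives \<open>\<kappa> \<le> 1/2\<close>, from
    which \<open>L z0\<close> is injective on the range of \<open>L z\<close>.\<close>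
  define \<kappa> where "\<kappa> = 1 / (2 * (1 + norm ?L0) ^ 2)"
  have k0: "0 < 1 + norm ?L0" by (simp add: add_pos_nonneg)
  have "1 \<le> (1 + norm ?L0) ^ 2" by (intro one_le_power) simp
  then have k: "0 < \<kappa>" "\<kappa> \<le> 1/2" unfolding \<kappa>_def using k0 by (simp_all add: field_simps)
  define V where "V = U \<inter> L -` ball ?L0 \<kappa>"
  have V: "open V" "z0 \<in> V" "V \<subseteq> U"
    unfolding V_def using U k continuous_open_preimage[OF smooth_on_imp_continuous_on[OF L] U(1) open_ball]
    by auto
  have Vd: "norm (L z - ?L0) < \<kappa>" if "z \<in> V" for z
    using that by (simp add: V_def dist_norm norm_minus_commute)
  \<comment> \<open>Since \<open>L z0\<close> is a projection, \<open>id + A z\<close> equals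
    \<open>L z0 o L z\<close> on the range of \<open>L z0\<close>. Its inverse \<open>R z\<close>
    corrects \<open>L z\<close> so that composition with \<open>L z0\<close> becomes constant in
    \<open>z\<close>.\<close>
  define A where "A z = ?L0 o\<^sub>L ((L z - ?L0) o\<^sub>L ?L0)" for z
  have LV: "smooth_on V L" using L V(3) by (rule smooth_on_subset)
  have A: "smooth_on V A"
    unfolding A_def
    by (intro smooth_on_bilinear[OF bounded_bilinear_blinfun_compose] smooth_on_diff smooth_on_const V LV)
  have "norm (A z) \<le> 1/2" if z: "z \<in> V" for z
  proof -
    have "norm (A z) \<le> norm ?L0 * (norm (L z - ?L0) * norm ?L0)"
      unfolding A_def by (rule order_trans[OF norm_blinfun_compose])
        (intro mult_left_mono norm_blinfun_compose norm_ge_zero)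
    also have "\<dots> \<le> (1 + norm ?L0) * (\<kappa> * (1 + norm ?L0))"
      using Vd[OF z] k by (intro mult_mono) auto
    also have "\<dots> = 1/2" unfolding \<kappa>_def using k0 by (simp add: power2_eq_square)
    finally show ?thesis .
  qed
  then have "\<exists>R. R o\<^sub>L (id_blinfun + A z) = id_blinfun \<and> (id_blinfun + A z) o\<^sub>L R = id_blinfun \<and> norm R \<le> 2"
    if "z \<in> V" for z
    using blinfun_inverse_near_identity that by metis
  then obtain R where R: "\<And>z. z \<in> V \<Longrightarrow> R z o\<^sub>L (id_blinfun + A z) = id_blinfun"
      "\<And>z. z \<in> V \<Longrightarrow> (id_blinfun + A z) o\<^sub>L R z = id_blinfun" "\<And>z. z \<in> V \<Longrightarrow> norm (R z) \<le> 2"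
    by metis
  have Rs: "smooth_on V R"
    by (rule smooth_on_blinfun_inverse[OF V(1) smooth_on_add[OF V(1) smooth_on_const[OF V(1)] A] R])
  define Q where "Q z = L z o\<^sub>L (?L0 o\<^sub>L (R z o\<^sub>L ?L0))" for z
  have id0: "?L0 (?L0 u) = ?L0 u" for u by (rule idem[OF U(2)])
  have LQ: "L z (Q z u) = Q z u" and QL: "Q z (?L0 u) = Q z u" if "z \<in> V" for z u
    using idem[of z] V(3) that by (auto simp: Q_def id0)
  have Qs: "smooth_on V Q"
    unfolding Q_def
    by (intro smooth_on_bilinear[OF bounded_bilinear_blinfun_compose] smooth_on_const V LV Rs)
  have L0Q: "?L0 (Q z u) = ?L0 u" if z: "z \<in> V" for z u
  proof -
    have "?L0 (Q z u) = ?L0 ((id_blinfun + A z) (R z (?L0 u)))"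
      by (simp add: Q_def A_def blinfun.bilinear_simps id0)
    also have "(id_blinfun + A z) (R z (?L0 u)) = ?L0 u"
      using arg_cong[OF R(2)[OF z], of "\<lambda>f. f (?L0 u)"] by simp
    finally show ?thesis by (simp add: id0)
  qed
  \<comment> \<open>On such a \<open>w\<close> the operator \<open>L z - L z0\<close> acts as the
    identity, although its norm is less than 1/2.\<close>
  have inj: "w = 0" if z: "z \<in> V" and w: "L z w = w" "?L0 w = 0" for z w
  proof -
    have "norm ((L z - ?L0) w) \<le> norm (L z - ?L0) * norm w" by (rule norm_blinfun)
    also have "\<dots> \<le> 1/2 * norm w" using Vd[OF z] k by (intro mult_right_mono) auto
    finally show ?thesis using w by (simp add: blinfun.diff_left)
  qed
  show ?thesis by (rule that[OF V Qs LQ L0Q QL inj])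
qed

lemma frechet_derivative_blinfun_apply:
  assumes "smooth_on S L" "z \<in> S"
  shows "((\<lambda>y. blinfun_apply (L y) u) has_derivative (\<lambda>a. blinfun_apply (frechet_derivative L (at z) a) u)) (at z)"
  by (rule bounded_linear.has_derivative[OF blinfun.bounded_linear_left])
    (rule smooth_on_has_derivative[OF assms])

text \<open>The hypothesis \<open>inv\<close> is involutivity in coordinates: its expression is the
  bracket of the fields \<open>y \<mapsto> L y u\<close> and \<open>y \<mapsto> L y w\<close>.
  Differentiating \<open>L Q = Q\<close> shows that the antisymmetric part \<open>s\<close>
  satisfies \<open>s = L s + c\<close> with \<open>c\<close> such a bracket. Applying the projection
  \<open>L\<close>, which fixes \<open>c\<close>, yields \<open>c = 0\<close>; so \<open>s\<close>
  lies in the range of \<open>L\<close>, and differentiating the constant \<open>L0 Q\<close> puts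
  it in the kernel of \<open>L0\<close>.\<close>

lemma normal_form_symmetric:
  fixes L Q :: "'e::euclidean_space \<Rightarrow> ('e \<Rightarrow>\<^sub>L 'e)" and L0 :: "'e \<Rightarrow>\<^sub>L 'e"
  assumes V: "open V" "z \<in> V" and L: "smooth_on V L" and Q: "smooth_on V Q"
    and LQ: "\<And>z u. z \<in> V \<Longrightarrow> L z (Q z u) = Q z u"
    and L0Q: "\<And>z u. z \<in> V \<Longrightarrow> L0 (Q z u) = L0 u"
    and inj: "\<And>w. L z w = w \<Longrightarrow> L0 w = 0 \<Longrightarrow> w = 0"
    and idem: "\<And>u. L z (L z u) = L z u"
    and inv: "\<And>u w. L z (frechet_derivative L (at z) (L z u) w - frechet_derivative L (at z) (L z w) u)
        = frechet_derivative L (at z) (L z u) w - frechet_derivative L (at z) (L z w) u"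
  shows "frechet_derivative Q (at z) (Q z v) w = frechet_derivative Q (at z) (Q z w) v"
proof -
  let ?dQ = "frechet_derivative Q (at z)" and ?dL = "frechet_derivative L (at z)"
  have dQ: "?dQ a u = L z (?dQ a u) + ?dL a (Q z u)" for a u
  proof -
    have "((\<lambda>y. L y (Q y u)) has_derivative (\<lambda>a. L z (?dQ a u) + ?dL a (Q z u))) (at z)"
      by (rule bounded_bilinear.FDERIV[OF bounded_bilinear_blinfun_apply
            smooth_on_has_derivative[OF L V(2)] frechet_derivative_blinfun_apply[OF Q V(2)]])
    then have "((\<lambda>y. Q y u) has_derivative (\<lambda>a. L z (?dQ a u) + ?dL a (Q z u))) (at z)"
      by (rule has_derivative_transform_within_open[OF _ V]) (rule LQ)
    from has_derivative_unique[OF frechet_derivative_blinfun_apply[OF Q V(2)] this]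
    show ?thesis by (rule fun_cong)
  qed
  have L0dQ: "L0 (?dQ a u) = 0" for a u
  proof -
    have "((\<lambda>y. L0 (Q y u)) has_derivative (\<lambda>a. L0 (?dQ a u))) (at z)"
      by (rule bounded_linear.has_derivative[OF blinfun.bounded_linear_right
            frechet_derivative_blinfun_apply[OF Q V(2)]])
    then have "((\<lambda>y. L0 u) has_derivative (\<lambda>a. L0 (?dQ a u))) (at z)"
      by (rule has_derivative_transform_within_open[OF _ V]) (rule L0Q)
    from has_derivative_unique[OF has_derivative_const this] show ?thesis by metis
  qed
  define s where "s = ?dQ (Q z v) w - ?dQ (Q z w) v"
  \<comment> \<open>The bracket of involutivity for the constant vectors \<open>Q z v\<close> and
    \<open>Q z w\<close>, both fixed by \<open>L z\<close>.\<close>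
  define c where "c = ?dL (L z (Q z v)) (Q z w) - ?dL (L z (Q z w)) (Q z v)"
  have Lc: "L z c = c" unfolding c_def by (rule inv)
  have s: "s = L z s + c"
    unfolding s_def c_def by (subst (1 2) dQ) (simp add: LQ[OF V(2)] blinfun.diff_right)
  have "L z s = L z (L z s) + L z c"
    using arg_cong[OF s, of "blinfun_apply (L z)"] by (simp only: blinfun.add_right)
  then have "c = 0" by (simp add: idem Lc)
  with s have "L z s = s" by simp
  then have "s = 0" by (rule inj) (simp add: s_def L0dQ blinfun.diff_right)
  then show ?thesis by (simp add: s_def)
qed

text \<open>Only the leaf through \<open>z0\<close> is straightened: \<open>\<Phi>\<close> maps the
  slice \<open>S\<close>, the range of \<open>L z0\<close>, into the leaf, and moves off it by
  translations along the kernel of \<open>L z0\<close>. The equation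
  \<open>L z0 (g x) = L z0 z0 + L z0 x\<close> recovers the leaf parameter of a point, so the
  inverse \<open>\<Theta>\<close> is explicit and the inverse function theorem does not
  enter.\<close>

lemma Frobenius_euclidean:
  fixes L :: "'e::euclidean_space \<Rightarrow> ('e \<Rightarrow>\<^sub>L 'e)"
  assumes U: "open U" "z0 \<in> U" and L: "smooth_on U L"
    and idem: "\<And>z u. z \<in> U \<Longrightarrow> L z (L z u) = L z u"
    and inv: "\<And>z u w. z \<in> U
      \<Longrightarrow> L z (frechet_derivative L (at z) (L z u) w - frechet_derivative L (at z) (L z w) u)
        = frechet_derivative L (at z) (L z u) w - frechet_derivative L (at z) (L z w) u"
  obtains W W' S and \<Theta> \<Phi> :: "'e \<Rightarrow> 'e" where "open W" "z0 \<in> W" "W \<subseteq> U" "open W'"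
    "smooth_on W \<Theta>" "smooth_on W' \<Phi>" "\<Theta> ` W \<subseteq> W'" "\<Phi> ` W' \<subseteq> W"
    "\<And>z. z \<in> W \<Longrightarrow> \<Phi> (\<Theta> z) = z" "\<And>x. x \<in> W' \<Longrightarrow> \<Theta> (\<Phi> x) = x"
    "subspace S" "\<Theta> z0 \<in> S"
    "\<And>x. x \<in> W' \<Longrightarrow> x \<in> S \<Longrightarrow> frechet_derivative \<Phi> (at x) ` S = range (blinfun_apply (L (\<Phi> x)))"
proof -
  let ?L0 = "L z0"
  obtain V and Q :: "'e \<Rightarrow> ('e \<Rightarrow>\<^sub>L 'e)" where V: "open V" "z0 \<in> V" "V \<subseteq> U" and Q: "smooth_on V Q"
    and LQ: "\<And>z u. z \<in> V \<Longrightarrow> L z (Q z u) = Q z u"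
    and L0Q: "\<And>z u. z \<in> V \<Longrightarrow> ?L0 (Q z u) = ?L0 u"
    and QL0: "\<And>z u. z \<in> V \<Longrightarrow> Q z (?L0 u) = Q z u"
    and inj: "\<And>z w. z \<in> V \<Longrightarrow> L z w = w \<Longrightarrow> ?L0 w = 0 \<Longrightarrow> w = 0"
    by (rule projection_normal_form[OF U L idem]) (assumption, blast)
  have LV: "smooth_on V L" using L V(3) by (rule smooth_on_subset)
  have id0: "?L0 (?L0 u) = ?L0 u" for u by (rule idem[OF U(2)])
  have rangeQ: "range (blinfun_apply (Q z)) = range (blinfun_apply (L z))" if z: "z \<in> V" for z
  proof -
    \<comment> \<open>Both sides are fixed by \<open>L z\<close> and have the same image under
      \<open>L z0\<close>, so they agree.\<close>
    have LQL: "L z w = Q z (L z w)" for w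
    proof -
      have "Q z (L z w) - L z w = 0"
        by (rule inj[OF z]) (use z V(3) idem[of z] in \<open>auto simp: blinfun.diff_right LQ L0Q\<close>)
      then show ?thesis by simp
    qed
    show ?thesis
    proof (intro equalityI image_subsetI)
      show "Q z w \<in> range (blinfun_apply (L z))" for w by (rule range_eqI) (rule LQ[OF z, symmetric])
      show "L z w \<in> range (blinfun_apply (Q z))" for w by (rule range_eqI) (rule LQL)
    qed
  qed
  define Q' where "Q' z = Blinfun (frechet_derivative Q (at z))" for z
  have Q'ap: "blinfun_apply (Q' z) = frechet_derivative Q (at z)" if "z \<in> V" for z
    unfolding Q'_def using smooth_on_has_derivative[OF Q that]
    by (intro bounded_linear_Blinfun_apply has_derivative_bounded_linear)
  have "continuous_on V Q'"
  proof (rule continuous_on_blinfun_componentwise)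
    show "continuous_on V (\<lambda>z. Q' z b)" for b
      using smooth_on_imp_continuous_on[OF smooth_on_frechet_derivative[OF Q]]
      by (rule continuous_on_eq) (simp add: Q'ap)
  qed
  moreover have "Q' z (Q z v) w = Q' z (Q z w) v" if z: "z \<in> V" for z v w
    unfolding Q'ap[OF z]
    by (rule normal_form_symmetric[OF V(1) z LV Q LQ L0Q])
      (use z V(3) inj idem inv in blast)+
  moreover have "(Q has_derivative blinfun_apply (Q' z)) (at z)" if "z \<in> V" for z
    unfolding Q'ap[OF that] by (rule smooth_on_has_derivative[OF Q that])
  ultimately obtain \<delta> g where \<delta>: "0 < \<delta>" and g0: "g 0 = z0" and gV: "\<And>x. x \<in> ball 0 \<delta> \<Longrightarrow> g x \<in> V"
    and gd: "\<And>x. x \<in> ball 0 \<delta> \<Longrightarrow> (g has_derivative blinfun_apply (Q (g x))) (at x)"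
    using total_differential_equation[OF V(1,2)] by blast
  let ?B = "ball (0::'e) \<delta>"
  \<comment> \<open>Bootstrapping: if \<open>g\<close> is of class C^k, so is its derivative
    \<open>Q (g x)\<close>.\<close>
  have gs: "smooth_on ?B g"
  proof -
    have "Ck_on k ?B g" for k
    proof (induction k)
      case 0
      show ?case
        unfolding Ck_on.simps
        by (rule continuous_at_imp_continuous_on, rule ballI, rule has_derivative_continuous, rule gd)
    next
      case (Suc k)
      show ?case
      proof (rule Ck_on_SucI[OF open_ball gd])
        have "Ck_on k ?B (\<lambda>x. Q (g x))"
          by (rule Ck_on_compose[OF open_ball Suc.IH, of V])
            (use Q gV in \<open>auto simp: smooth_on_def\<close>)
        then show "Ck_on k ?B (\<lambda>x. Q (g x) v)" for v
          by (rule Ck_on_bounded_linear[OF blinfun.bounded_linear_left open_ball])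
      qed
    qed
    then show ?thesis by (simp add: smooth_on_def)
  qed
  \<comment> \<open>The derivative of \<open>L z0 (g x)\<close> is
    \<open>L z0 o Q (g x) = L z0\<close>, so \<open>L z0 (g x) - L z0 x\<close> is constant on the
    ball.\<close>
  have L0g: "?L0 (g x) = ?L0 z0 + ?L0 x" if x: "x \<in> ?B" for x
  proof -
    have "((\<lambda>x. ?L0 (g x) - ?L0 x) has_derivative (\<lambda>v. 0)) (at x within ?B)" if "x \<in> ?B" for x
    proof -
      have "((\<lambda>x. ?L0 (g x) - ?L0 x) has_derivative (\<lambda>v. ?L0 (Q (g x) v) - ?L0 v)) (at x)"
        by (intro has_derivative_diff bounded_linear.has_derivative[OF blinfun.bounded_linear_right]
            gd that has_derivative_ident)
      then show ?thesis using L0Q[OF gV[OF that]] by (simp add: has_derivative_at_withinI)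
    qed
    then have "?L0 (g x) - ?L0 x = ?L0 (g 0) - ?L0 0"
      by (rule has_derivative_zero_unique[OF convex_ball]) (use x \<delta> in auto)
    then show ?thesis by (simp add: g0 algebra_simps)
  qed
  define \<Theta> where "\<Theta> z = ?L0 (z - z0) + (z - g (?L0 (z - z0)))" for z
  define \<Phi> where "\<Phi> x = g (?L0 x) + (x - ?L0 x)" for x
  define W where "W = U \<inter> (\<lambda>z. ?L0 (z - z0)) -` ?B"
  define W0 where "W0 = (\<lambda>x. ?L0 x) -` ?B"
  define W' where "W' = W0 \<inter> \<Phi> -` U"
  have "continuous_on UNIV (\<lambda>z. ?L0 (z - z0))"
    by (intro bounded_linear.continuous_on[OF blinfun.bounded_linear_right] continuous_on_diff
        continuous_on_id continuous_on_const)
  then have Wo: "open W"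
    unfolding W_def by (rule open_Int[OF U(1) open_vimage[OF open_ball]])
  have "continuous_on UNIV (\<lambda>x. ?L0 x)"
    by (intro bounded_linear.continuous_on[OF blinfun.bounded_linear_right] continuous_on_id)
  then have W0o: "open W0"
    unfolding W0_def by (rule open_vimage[OF open_ball])
  have lin: "smooth_on T (\<lambda>x. ?L0 (f x))" if "open T" "smooth_on T f" for T and f :: "'e \<Rightarrow> 'e"
    using smooth_on_bounded_linear[OF blinfun.bounded_linear_right that] .
  have \<Phi>0: "smooth_on W0 \<Phi>"
    unfolding \<Phi>_def
    by (intro smooth_on_add smooth_on_diff smooth_on_compose[OF W0o _ gs] lin smooth_on_id W0o)
      (auto simp: W0_def)
  have \<Theta>s: "smooth_on W \<Theta>"
    unfolding \<Theta>_def
    by (intro smooth_on_add smooth_on_diff smooth_on_compose[OF Wo _ gs] lin smooth_on_id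
        smooth_on_const Wo) (auto simp: W_def)
  have W'o: "open W'"
    unfolding W'_def by (rule continuous_open_preimage[OF smooth_on_imp_continuous_on[OF \<Phi>0] W0o U(1)])
  have \<Phi>s: "smooth_on W' \<Phi>" using \<Phi>0 by (rule smooth_on_subset) (simp add: W'_def)
  have L0\<Phi>: "?L0 (\<Phi> x - z0) = ?L0 x" if "x \<in> W0" for x
    using L0g[of "?L0 x"] that by (simp add: \<Phi>_def W0_def blinfun.bilinear_simps id0)
  have L0\<Theta>: "?L0 (\<Theta> z) = ?L0 (z - z0)" if "z \<in> W" for z
    using L0g[of "?L0 (z - z0)"] that by (simp add: \<Theta>_def W_def blinfun.bilinear_simps id0)
  have \<Theta>\<Phi>: "\<Theta> (\<Phi> x) = x" if "x \<in> W'" for x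
    using L0\<Phi>[of x] that unfolding W'_def \<Theta>_def by (simp add: \<Phi>_def)
  have \<Phi>\<Theta>: "\<Phi> (\<Theta> z) = z" if "z \<in> W" for z
    using L0\<Theta>[OF that] unfolding \<Phi>_def by (simp add: \<Theta>_def)
  have im: "\<Theta> ` W \<subseteq> W'" "\<Phi> ` W' \<subseteq> W"
    using L0\<Theta> L0\<Phi> \<Phi>\<Theta> by (auto simp: W'_def W_def W0_def)
  have S: "subspace (range (blinfun_apply ?L0))"
    by (intro linear_subspace_image subspace_UNIV bounded_linear.linear blinfun.bounded_linear_right)
  have "\<Theta> z0 \<in> range (blinfun_apply ?L0)" by (auto simp: \<Theta>_def g0 intro!: image_eqI[of 0 _ 0])
  moreover have "frechet_derivative \<Phi> (at x) ` range (blinfun_apply ?L0) = range (blinfun_apply (L (\<Phi> x)))"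
    if x: "x \<in> W'" "x \<in> range (blinfun_apply ?L0)" for x
  proof -
    have L0x: "?L0 x = x" using x(2) id0 by auto
    have xB: "x \<in> ?B" using x(1) L0x by (simp add: W'_def W0_def)
    have "((\<lambda>x. g (?L0 x)) has_derivative (\<lambda>v. Q (g x) (?L0 v))) (at x)"
      by (rule has_derivative_compose[OF bounded_linear_imp_has_derivative[OF blinfun.bounded_linear_right]])
        (use gd[OF xB] L0x in simp)
    then have "(\<Phi> has_derivative (\<lambda>v. Q (g x) (?L0 v) + (v - ?L0 v))) (at x)"
      unfolding \<Phi>_def
      by (intro has_derivative_add has_derivative_diff has_derivative_ident
          bounded_linear_imp_has_derivative blinfun.bounded_linear_right)
    then have "frechet_derivative \<Phi> (at x) = (\<lambda>v. Q (g x) (?L0 v) + (v - ?L0 v))"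
      by (rule frechet_derivative_at[symmetric])
    moreover have "\<Phi> x = g x" by (simp add: \<Phi>_def L0x)
    ultimately have "frechet_derivative \<Phi> (at x) ` range (blinfun_apply ?L0) = range (\<lambda>v. Q (\<Phi> x) v)"
      using QL0[OF gV[OF xB]] by (simp add: image_image id0)
    then show ?thesis using rangeQ gV[OF xB] \<open>\<Phi> x = g x\<close> by simp
  qed
  moreover have "z0 \<in> W" using U(2) \<delta> by (simp add: W_def)
  ultimately show ?thesis
    using that[OF Wo _ _ W'o \<Theta>s \<Phi>s im \<Phi>\<Theta> \<Theta>\<Phi> S] by (simp add: W_def)
qed

section \<open>Charts and smooth functions\<close>

text \<open>Holds at points of non-differentiability as well: \<open>frechet_derivative\<close> is a
  choice from the set of all derivatives, and at \<open>x\<close> both functions have the same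
  ones.\<close>

lemma frechet_derivative_cong:
  assumes S: "open S" "x \<in> S" and eq: "\<And>y. y \<in> S \<Longrightarrow> f y = g y"
  shows "frechet_derivative f (at x) = frechet_derivative g (at x)"
proof -
  have "(f has_derivative f') (at x) \<longleftrightarrow> (g has_derivative f') (at x)" for f'
    using has_derivative_transform_within_open[OF _ S, of f f' UNIV g]
      has_derivative_transform_within_open[OF _ S, of g f' UNIV f] eq by auto
  then show ?thesis unfolding frechet_derivative_def by presburger
qed

locale smooth_manifold =
  fixes A :: "('a::t2_space, 'e::euclidean_space) chart set"
  assumes atlas: "smooth_atlas A"

text \<open>The chart is taken from the maximal atlas, so that the charts of \<open>A\<close>, the
  slice charts of submanifolds and the straightened charts constructed later are all
  instances.\<close>

locale manifold_chart = smooth_manifold A for A :: "('a::t2_space, 'e::euclidean_space) chart set" +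
  fixes U :: "'a set" and \<phi> :: "'a \<Rightarrow> 'e"
  assumes chart: "smooth_chart A (U, \<phi>)"
begin

abbreviation par :: "'e \<Rightarrow> 'a" where "par \<equiv> inv_into U \<phi>"

lemma is_chart: "is_chart (U, \<phi>)"
  using chart by (simp add: smooth_chart_def)

lemma open_domain: "open U" and open_image: "open (\<phi> ` U)"
  and continuous_on_chart: "continuous_on U \<phi>" and continuous_on_par: "continuous_on (\<phi> ` U) par"
  using is_chart by (auto simp: is_chart_def homeomorphism_def)

lemma par_chart: "q \<in> U \<Longrightarrow> par (\<phi> q) = q"
  using is_chart by (auto simp: is_chart_def homeomorphism_def)

lemma chart_par: "z \<in> \<phi> ` U \<Longrightarrow> \<phi> (par z) = z" and par_in: "z \<in> \<phi> ` U \<Longrightarrow> par z \<in> U"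
  by (simp_all add: f_inv_into_f inv_into_into)

lemma image_eq_par_vimage: "V \<subseteq> U \<Longrightarrow> \<phi> ` V = \<phi> ` U \<inter> par -` V"
  using par_chart chart_par par_in by (auto simp: image_iff)

lemma open_chart_image:
  assumes "open V" "V \<subseteq> U"
  shows "open (\<phi> ` V)"
  unfolding image_eq_par_vimage[OF assms(2)]
  by (rule continuous_open_preimage[OF continuous_on_par open_image assms(1)])

lemma open_chart_preimage: "open T \<Longrightarrow> open (U \<inter> \<phi> -` T)"
  by (rule continuous_open_preimage[OF continuous_on_chart open_domain])

lemma smooth_transition:
  assumes "(V, \<psi>) \<in> A"
  shows "smooth_on (\<phi> ` (U \<inter> V)) (\<lambda>z. \<psi> (par z))"
    and "smooth_on (\<psi> ` (U \<inter> V)) (\<lambda>z. \<phi> (inv_into V \<psi> z))"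
  using chart assms by (auto simp: smooth_chart_def smooth_compatible_def comp_def)

end

context smooth_manifold
begin

lemma atlas_chart: "(V, \<psi>) \<in> A \<Longrightarrow> manifold_chart A V \<psi>"
  using atlas by unfold_locales (auto simp: smooth_atlas_def smooth_chart_def)

lemma atlas_cover: obtains V \<psi> where "(V, \<psi>) \<in> A" "p \<in> V"
  using atlas unfolding smooth_atlas_def by (metis UN_E UNIV_I prod.collapse)

lemma smooth_functionsI:
  "(\<And>V \<psi>. (V, \<psi>) \<in> A \<Longrightarrow> smooth_on (\<psi> ` V) (\<lambda>z. f (inv_into V \<psi> z))) \<Longrightarrow> f \<in> smooth_functions A"
  by (auto simp: smooth_functions_def comp_def)

lemma smooth_functionsD:
  "f \<in> smooth_functions A \<Longrightarrow> (V, \<psi>) \<in> A \<Longrightarrow> smooth_on (\<psi> ` V) (\<lambda>z. f (inv_into V \<psi> z))"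
  by (auto simp: smooth_functions_def comp_def)

lemma atlas_open_image: "(V, \<psi>) \<in> A \<Longrightarrow> open (\<psi> ` V)"
  using manifold_chart.open_image[OF atlas_chart] .

lemma smooth_functions_const: "(\<lambda>q. c) \<in> smooth_functions A"
  by (rule smooth_functionsI) (rule smooth_on_const[OF atlas_open_image])

lemma smooth_functions_add:
  "f \<in> smooth_functions A \<Longrightarrow> g \<in> smooth_functions A \<Longrightarrow> (\<lambda>q. f q + g q) \<in> smooth_functions A"
  by (rule smooth_functionsI) (rule smooth_on_add[OF atlas_open_image smooth_functionsD smooth_functionsD])

lemma smooth_functions_mult:
  "f \<in> smooth_functions A \<Longrightarrow> g \<in> smooth_functions A \<Longrightarrow> (\<lambda>q. f q * g q) \<in> smooth_functions A"
  by (rule smooth_functionsI) (rule smooth_on_mult[OF atlas_open_image smooth_functionsD smooth_functionsD])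

lemma smooth_functions_cmult: "f \<in> smooth_functions A \<Longrightarrow> (\<lambda>q. c * f q) \<in> smooth_functions A"
  by (rule smooth_functions_mult[OF smooth_functions_const])

lemma smooth_functions_diff:
  "f \<in> smooth_functions A \<Longrightarrow> g \<in> smooth_functions A \<Longrightarrow> (\<lambda>q. f q - g q) \<in> smooth_functions A"
  by (rule smooth_functionsI) (rule smooth_on_diff[OF atlas_open_image smooth_functionsD smooth_functionsD])

lemma smooth_functions_sum:
  "(\<And>i. i \<in> I \<Longrightarrow> f i \<in> smooth_functions A) \<Longrightarrow> (\<lambda>q. \<Sum>i\<in>I. f i q) \<in> smooth_functions A"
  by (rule smooth_functionsI) (rule smooth_on_sum[OF atlas_open_image smooth_functionsD])

lemma tangent_spaceD:
  assumes "v \<in> tangent_space A p"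
  shows "f \<in> smooth_functions A \<Longrightarrow> g \<in> smooth_functions A \<Longrightarrow> v (\<lambda>q. f q + g q) = v f + v g"
    and "f \<in> smooth_functions A \<Longrightarrow> v (\<lambda>q. a * f q) = a * v f"
    and "f \<in> smooth_functions A \<Longrightarrow> g \<in> smooth_functions A
      \<Longrightarrow> v (\<lambda>q. f q * g q) = f p * v g + g p * v f"
    and "f \<notin> smooth_functions A \<Longrightarrow> v f = 0"
  using assms unfolding tangent_space_def by blast+

lemma tangent_space_zero_function:
  assumes "v \<in> tangent_space A p" shows "v (\<lambda>q. 0) = 0"
  using tangent_spaceD(2)[OF assms smooth_functions_const, of 0 0] by simp

lemma tangent_space_const:
  assumes "v \<in> tangent_space A p" shows "v (\<lambda>q. c) = 0"
proof -
  have "v (\<lambda>q. 1 * 1) = 1 * v (\<lambda>q. 1) + 1 * v (\<lambda>q. 1)"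
    by (rule tangent_spaceD(3)[OF assms smooth_functions_const smooth_functions_const])
  then have "v (\<lambda>q. 1) = 0" by simp
  then show ?thesis using tangent_spaceD(2)[OF assms smooth_functions_const, of c 1] by simp
qed

lemma tangent_space_diff:
  assumes v: "v \<in> tangent_space A p" and f: "f \<in> smooth_functions A" and g: "g \<in> smooth_functions A"
  shows "v (\<lambda>q. f q - g q) = v f - v g"
  using tangent_spaceD(1)[OF v f smooth_functions_cmult[OF g, of "-1"]] tangent_spaceD(2)[OF v g, of "-1"]
  by simp

lemma tangent_space_sum:
  assumes v: "v \<in> tangent_space A p" and "\<And>i. i \<in> I \<Longrightarrow> f i \<in> smooth_functions A"
  shows "v (\<lambda>q. \<Sum>i\<in>I. f i q) = (\<Sum>i\<in>I. v (f i))"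
  using assms(2)
proof (induction I rule: infinite_finite_induct)
  case (insert i I)
  have "v (\<lambda>q. f i q + (\<Sum>i\<in>I. f i q)) = v (f i) + v (\<lambda>q. \<Sum>i\<in>I. f i q)"
    by (rule tangent_spaceD(1)[OF v]) (use insert.prems in \<open>auto intro: smooth_functions_sum\<close>)
  then show ?case using insert by simp
qed (simp_all add: tangent_space_zero_function[OF v])

end

context manifold_chart
begin

text \<open>Smoothness is defined through the charts in \<open>A\<close>; near each point a
  transition map carries it over to an arbitrary chart of the maximal atlas.\<close>

lemma smooth_function_in_chart:
  assumes f: "f \<in> smooth_functions A"
  shows "smooth_on (\<phi> ` U) (\<lambda>z. f (par z))"
proof (rule smooth_on_local)
  fix z assume z: "z \<in> \<phi> ` U"
  obtain V \<psi> where V: "(V, \<psi>) \<in> A" "par z \<in> V" by (rule atlas_cover)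
  interpret V: manifold_chart A V \<psi> by (rule atlas_chart[OF V(1)])
  let ?T = "\<phi> ` (U \<inter> V)"
  have T: "open ?T" by (rule open_chart_image) (auto intro: open_domain V.open_domain)
  have pT: "par y \<in> V" if "y \<in> ?T" for y using that par_chart by auto
  have "smooth_on ?T (\<lambda>z. f (V.par (\<psi> (par z))))"
    by (rule smooth_on_compose[OF T smooth_transition(1)[OF V(1)] smooth_functionsD[OF f V(1)]])
      (use pT in auto)
  then have "smooth_on ?T (\<lambda>z. f (par z))"
    by (rule smooth_on_cong[OF _ T]) (simp add: V.par_chart pT)
  moreover have "z \<in> ?T" using z V(2) chart_par[OF z] par_in[OF z] by (metis IntI image_eqI)
  ultimately show "\<exists>T. open T \<and> z \<in> T \<and> smooth_on T (\<lambda>z. f (par z))" using T by blast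
qed

text \<open>Derivations act on globally defined functions, so local functions have to be cut off.
  One \<open>\<theta>\<close> and one \<open>V\<close> serve all \<open>h\<close>. Smoothness across
  the boundary of \<open>U\<close> depends on the Hausdorff property: off the image \<open>K\<close>
  of a closed ball the extension is zero, and \<open>K\<close> is compact, hence closed in the
  manifold.\<close>

lemma extension_by_zero:
  assumes B: "open B" "B \<subseteq> \<phi> ` U" and q0: "q0 \<in> U" "\<phi> q0 \<in> B"
  obtains \<theta> :: "'e \<Rightarrow> real" and V where "open V" "q0 \<in> V" "V \<subseteq> U" "\<phi> ` V \<subseteq> B" "open (\<phi> ` V)"
    "\<And>q. q \<in> V \<Longrightarrow> \<theta> (\<phi> q) = 1" "\<And>z. z \<notin> B \<Longrightarrow> \<theta> z = 0"
    "\<And>h. smooth_on B h \<Longrightarrow> (\<lambda>q. if q \<in> U then \<theta> (\<phi> q) * h (\<phi> q) else 0) \<in> smooth_functions A"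
proof -
  obtain r where r: "0 < r" "cball (\<phi> q0) r \<subseteq> B" using B q0 open_contains_cball by blast
  obtain \<theta> :: "'e \<Rightarrow> real" where \<theta>: "smooth_on UNIV \<theta>" "\<And>z. z \<notin> ball (\<phi> q0) r \<Longrightarrow> \<theta> z = 0"
    "\<And>z. z \<in> ball (\<phi> q0) (r / 2) \<Longrightarrow> \<theta> z = 1"
    using smooth_bump[OF r(1)] by metis
  define V where "V = U \<inter> \<phi> -` ball (\<phi> q0) (r / 2)"
  have V: "open V" unfolding V_def by (rule open_chart_preimage[OF open_ball])
  have VO: "\<phi> ` V \<subseteq> B" using r by (auto simp: V_def)
  define K where "K = par ` cball (\<phi> q0) r"
  have "compact K"
    unfolding K_def
    by (intro compact_continuous_image continuous_on_subset[OF continuous_on_par] compact_cball)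
      (use r B in auto)
  then have K: "closed K" by (rule compact_imp_closed)
  have inK: "q \<in> K \<longleftrightarrow> q \<in> U \<and> \<phi> q \<in> cball (\<phi> q0) r" for q
  proof
    assume "q \<in> K"
    then obtain z where z: "z \<in> cball (\<phi> q0) r" "q = par z" unfolding K_def by blast
    then have "z \<in> \<phi> ` U" using r B by blast
    then show "q \<in> U \<and> \<phi> q \<in> cball (\<phi> q0) r" using z chart_par par_in by simp
  next
    assume "q \<in> U \<and> \<phi> q \<in> cball (\<phi> q0) r"
    then show "q \<in> K" unfolding K_def using par_chart by (metis image_eqI)
  qed
  have ext: "(\<lambda>q. if q \<in> U then \<theta> (\<phi> q) * h (\<phi> q) else 0) \<in> smooth_functions A" (is "?F \<in> _")
    if h: "smooth_on B h" for h
  proof (rule smooth_functionsI)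
    fix V' \<psi> assume V': "(V', \<psi>) \<in> A"
    interpret V: manifold_chart A V' \<psi> by (rule atlas_chart[OF V'])
    show "smooth_on (\<psi> ` V') (\<lambda>z. ?F (V.par z))"
    proof (rule smooth_on_local)
      fix z assume z: "z \<in> \<psi> ` V'"
      \<comment> \<open>\<open>K\<close> lies in the open part of \<open>U\<close> whose coordinates
        are in \<open>B\<close>, so that part and the complement of \<open>K\<close> cover the
        manifold; the extension is smooth on each.\<close>
      show "\<exists>T. open T \<and> z \<in> T \<and> smooth_on T (\<lambda>z. ?F (V.par z))"
      proof (cases "V.par z \<in> K")
        case True
        let ?T = "\<psi> ` (V' \<inter> (U \<inter> \<phi> -` B))"
        have T: "open ?T"
          by (rule V.open_chart_image) (auto intro: V.open_domain open_chart_preimage B)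
        have pT: "V.par y \<in> U" "\<phi> (V.par y) \<in> B" if "y \<in> ?T" for y using that V.par_chart by auto
        have s: "smooth_on ?T (\<lambda>z. \<phi> (V.par z))"
          by (rule smooth_on_subset[OF smooth_transition(2)[OF V']]) auto
        have "smooth_on ?T (\<lambda>z. \<theta> (\<phi> (V.par z)))" by (rule smooth_on_compose[OF T s \<theta>(1)]) simp
        moreover have "smooth_on ?T (\<lambda>z. h (\<phi> (V.par z)))"
          by (rule smooth_on_compose[OF T s h]) (use pT in auto)
        ultimately have "smooth_on ?T (\<lambda>z. \<theta> (\<phi> (V.par z)) * h (\<phi> (V.par z)))"
          by (rule smooth_on_mult[OF T])
        then have "smooth_on ?T (\<lambda>z. ?F (V.par z))"
          by (rule smooth_on_cong[OF _ T]) (simp add: pT)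
        moreover have "z \<in> ?T"
          using True inK[of "V.par z"] r(2) V.chart_par[OF z] V.par_in[OF z]
          by (intro image_eqI[of _ _ "V.par z"]) auto
        ultimately show ?thesis using T by blast
      next
        case False
        let ?T = "\<psi> ` (V' - K)"
        have T: "open ?T" by (rule V.open_chart_image) (auto intro: V.open_domain K)
        have "smooth_on ?T (\<lambda>z. ?F (V.par z))"
        proof (rule smooth_on_cong[OF smooth_on_const[OF T, of 0] T])
          fix y assume "y \<in> ?T"
          then have "V.par y \<notin> K" using V.par_chart by auto
          then have "V.par y \<in> U \<Longrightarrow> \<phi> (V.par y) \<notin> ball (\<phi> q0) r" unfolding inK by auto
          then show "0 = ?F (V.par y)" using \<theta>(2) by simp
        qed
        moreover have "z \<in> ?T"
          using False V.chart_par[OF z] V.par_in[OF z] by (intro image_eqI[of _ _ "V.par z"]) auto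
        ultimately show ?thesis using T by blast
      qed
    qed
  qed
  have out: "\<theta> z = 0" if "z \<notin> B" for z
    by (rule \<theta>(2)) (use that r(2) ball_subset_cball in blast)
  show ?thesis
    by (rule that[OF V _ _ VO open_chart_image[OF V] _ out ext]) (use q0 r \<theta>(3) in \<open>auto simp: V_def\<close>)
qed

end

text \<open>With a smooth \<open>b\<close> that is 1 at \<open>p\<close> and zero off
  \<open>W\<close>, the product \<open>(f - g) b\<close> is zero; by the Leibniz rule
  \<open>v\<close> maps it to \<open>v f - v g\<close>, as \<open>f - g\<close> vanishes at
  \<open>p\<close>.\<close>

lemma (in smooth_manifold) tangent_vector_local:
  assumes v: "v \<in> tangent_space A p" and f: "f \<in> smooth_functions A" and g: "g \<in> smooth_functions A"
    and W: "open W" "p \<in> W" and eq: "\<And>q. q \<in> W \<Longrightarrow> f q = g q"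
  shows "v f = v g"
proof -
  obtain U \<phi> where U: "(U, \<phi>) \<in> A" "p \<in> U" by (rule atlas_cover)
  interpret manifold_chart A U \<phi> by (rule atlas_chart[OF U(1)])
  have "open (\<phi> ` (U \<inter> W))" "\<phi> ` (U \<inter> W) \<subseteq> \<phi> ` U" "p \<in> U" "\<phi> p \<in> \<phi> ` (U \<inter> W)"
    using U W by (auto intro!: open_chart_image open_domain)
  then obtain \<theta> :: "'e \<Rightarrow> real" and V where "open V" and \<theta>1: "p \<in> V" and "V \<subseteq> U" "\<phi> ` V \<subseteq> \<phi> ` (U \<inter> W)"
    "open (\<phi> ` V)" and \<theta>: "\<And>q. q \<in> V \<Longrightarrow> \<theta> (\<phi> q) = 1" "\<And>z. z \<notin> \<phi> ` (U \<inter> W) \<Longrightarrow> \<theta> z = 0"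
    and ext: "\<And>h. smooth_on (\<phi> ` (U \<inter> W)) h
      \<Longrightarrow> (\<lambda>q. if q \<in> U then \<theta> (\<phi> q) * h (\<phi> q) else 0) \<in> smooth_functions A"
    by (rule extension_by_zero) blast
  define b where "b q = (if q \<in> U then \<theta> (\<phi> q) * 1 else 0)" for q
  have b: "b \<in> smooth_functions A"
    unfolding b_def by (rule ext[OF smooth_on_const]) (auto intro!: open_chart_image open_domain W)
  have b1: "b p = 1" using \<theta>(1)[OF \<theta>1] U by (simp add: b_def)
  have b0: "b q = 0" if "q \<notin> W" for q
  proof (cases "q \<in> U")
    case True
    have "\<phi> q \<notin> \<phi> ` (U \<inter> W)" using that True par_chart by (metis IntE imageE)
    then show ?thesis using \<theta>(2) by (simp add: b_def)
  qed (simp add: b_def)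
  have "(f q - g q) * b q = 0" for q using eq b0 by (cases "q \<in> W") auto
  then have "(\<lambda>q. (f q - g q) * b q) = (\<lambda>q. 0)" by blast
  then have "v (\<lambda>q. (f q - g q) * b q) = 0" using tangent_space_zero_function[OF v] by (simp only:)
  moreover have "v (\<lambda>q. (f q - g q) * b q) = (f p - g p) * v b + b p * v (\<lambda>q. f q - g q)"
    by (rule tangent_spaceD(3)[OF v smooth_functions_diff[OF f g] b])
  ultimately show ?thesis
    using eq[OF W(2)] by (simp add: b1 tangent_space_diff[OF v f g])
qed

section \<open>Tangent vectors in coordinates\<close>

text \<open>The value 0 on other functions is the convention of \<open>tangent_space\<close>, so
  that equality with a derivation can be equality in HOL.\<close>

definition coord_vec ::
  "('a::t2_space, 'e::euclidean_space) chart set \<Rightarrow> 'a set \<Rightarrow> ('a \<Rightarrow> 'e) \<Rightarrow> 'a \<Rightarrow> 'e \<Rightarrow> 'a tvec" where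
  "coord_vec A U \<phi> q u = (\<lambda>f. if f \<in> smooth_functions A
     then frechet_derivative (\<lambda>z. f (inv_into U \<phi> z)) (at (\<phi> q)) u else 0)"

definition coord ::
  "('a::t2_space, 'e::euclidean_space) chart set \<Rightarrow> 'a set \<Rightarrow> ('a \<Rightarrow> 'e) \<Rightarrow> 'a \<Rightarrow> 'a tvec \<Rightarrow> 'e" where
  "coord A U \<phi> q v = (THE u. coord_vec A U \<phi> q u = v)"

definition lie :: "('a \<Rightarrow> 'a tvec) \<Rightarrow> ('a \<Rightarrow> 'a tvec) \<Rightarrow> 'a \<Rightarrow> 'a tvec" where
  "lie X Y p = (\<lambda>f. X p (\<lambda>q. Y q f) - Y p (\<lambda>q. X q f))"

context smooth_manifold
begin

lemma tangent_spaceI: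
  assumes "\<And>f g. f \<in> smooth_functions A \<Longrightarrow> g \<in> smooth_functions A \<Longrightarrow> v (\<lambda>q. f q + g q) = v f + v g"
    and "\<And>a f. f \<in> smooth_functions A \<Longrightarrow> v (\<lambda>q. a * f q) = a * v f"
    and "\<And>f g. f \<in> smooth_functions A \<Longrightarrow> g \<in> smooth_functions A
      \<Longrightarrow> v (\<lambda>q. f q * g q) = f p * v g + g p * v f"
    and "\<And>f. f \<notin> smooth_functions A \<Longrightarrow> v f = 0"
  shows "v \<in> tangent_space A p"
  using assms unfolding tangent_space_def by blast

lemma tangent_space_zero: "0 \<in> tangent_space A p"
  by (rule tangent_spaceI) simp_all

lemma tangent_space_add:
  assumes "v \<in> tangent_space A p" "w \<in> tangent_space A p"
  shows "v + w \<in> tangent_space A p"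
  by (rule tangent_spaceI)
    (simp_all add: tangent_spaceD[OF assms(1)] tangent_spaceD[OF assms(2)] algebra_simps)

lemma tangent_space_scale:
  assumes "v \<in> tangent_space A p"
  shows "scale a v \<in> tangent_space A p"
  by (rule tangent_spaceI) (simp_all add: scale_def tangent_spaceD[OF assms] algebra_simps)

lemma tangent_space_minus:
  assumes "v \<in> tangent_space A p" "w \<in> tangent_space A p"
  shows "v - w \<in> tangent_space A p"
  by (rule tangent_spaceI)
    (simp_all add: tangent_spaceD[OF assms(1)] tangent_spaceD[OF assms(2)] algebra_simps)

lemma vector_fieldsD:
  assumes "X \<in> vector_fields A"
  shows "X p \<in> tangent_space A p" and "f \<in> smooth_functions A \<Longrightarrow> (\<lambda>p. X p f) \<in> smooth_functions A"
  using assms by (auto simp: vector_fields_def)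

lemma vector_fieldsI:
  "(\<And>p. X p \<in> tangent_space A p) \<Longrightarrow> (\<And>f. f \<in> smooth_functions A \<Longrightarrow> (\<lambda>p. X p f) \<in> smooth_functions A)
    \<Longrightarrow> X \<in> vector_fields A"
  by (simp add: vector_fields_def)

lemma lie_in_tangent_space:
  assumes X: "X \<in> vector_fields A" and Y: "Y \<in> vector_fields A"
  shows "lie X Y p \<in> tangent_space A p"
proof (rule tangent_spaceI)
  note x = tangent_spaceD[OF vector_fieldsD(1)[OF X]] and y = tangent_spaceD[OF vector_fieldsD(1)[OF Y]]
    and sx = vector_fieldsD(2)[OF X] and sy = vector_fieldsD(2)[OF Y]
  show "lie X Y p (\<lambda>q. f q + g q) = lie X Y p f + lie X Y p g"
    if "f \<in> smooth_functions A" "g \<in> smooth_functions A" for f g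
    using that by (simp add: lie_def x(1) y(1) sx sy)
  show "lie X Y p (\<lambda>q. a * f q) = a * lie X Y p f" if "f \<in> smooth_functions A" for a f
    using that by (simp add: lie_def x(2) y(2) sx sy algebra_simps)
  show "lie X Y p (\<lambda>q. f q * g q) = f p * lie X Y p g + g p * lie X Y p f"
    if "f \<in> smooth_functions A" "g \<in> smooth_functions A" for f g
    using that by (simp add: lie_def x(1,3) y(1,3) sx sy smooth_functions_mult algebra_simps)
  show "lie X Y p f = 0" if "f \<notin> smooth_functions A" for f
    using that by (simp add: lie_def x(4) y(4) tangent_space_zero_function[OF vector_fieldsD(1)[OF X]]
        tangent_space_zero_function[OF vector_fieldsD(1)[OF Y]])
qed

end

context manifold_chart
begin

abbreviation cvec :: "'a \<Rightarrow> 'e \<Rightarrow> 'a tvec" where "cvec \<equiv> coord_vec A U \<phi>"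
abbreviation crd :: "'a \<Rightarrow> 'a tvec \<Rightarrow> 'e" where "crd \<equiv> coord A U \<phi>"

lemma coord_vec_apply:
  "f \<in> smooth_functions A \<Longrightarrow> cvec q u f = frechet_derivative (\<lambda>z. f (par z)) (at (\<phi> q)) u"
  by (simp add: coord_vec_def)

lemma chart_has_derivative:
  assumes "f \<in> smooth_functions A" "q \<in> U"
  shows "((\<lambda>z. f (par z)) has_derivative (\<lambda>u. cvec q u f)) (at (\<phi> q))"
  unfolding coord_vec_apply[OF assms(1)]
  by (rule smooth_on_has_derivative[OF smooth_function_in_chart[OF assms(1)]]) (rule imageI[OF assms(2)])

lemma coord_vec_eqI:
  assumes "q \<in> U" "\<And>f. f \<in> smooth_functions A \<Longrightarrow> ((\<lambda>z. f (par z)) has_derivative D f) (at (\<phi> q))"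
    and "\<And>f. f \<in> smooth_functions A \<Longrightarrow> v f = D f u" "\<And>f. f \<notin> smooth_functions A \<Longrightarrow> v f = 0"
  shows "v = cvec q u"
proof
  fix f
  show "v f = cvec q u f"
  proof (cases "f \<in> smooth_functions A")
    case True
    show ?thesis
      using has_derivative_unique[OF chart_has_derivative[OF True assms(1)] assms(2)[OF True]] assms(3)[OF True]
      by metis
  next
    case False
    then show ?thesis by (simp add: assms(4) coord_vec_def)
  qed
qed

lemma coord_vec_in_tangent_space:
  assumes q: "q \<in> U"
  shows "cvec q u \<in> tangent_space A q"
proof (rule tangent_spaceI)
  note d = chart_has_derivative[OF _ q]
  show "cvec q u (\<lambda>q. f q + g q) = cvec q u f + cvec q u g"
    if f: "f \<in> smooth_functions A" and g: "g \<in> smooth_functions A" for f g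
    using has_derivative_unique[OF d[OF smooth_functions_add[OF f g]] has_derivative_add[OF d[OF f] d[OF g]]]
    by metis
  show "cvec q u (\<lambda>q. a * f q) = a * cvec q u f" if f: "f \<in> smooth_functions A" for a f
    using has_derivative_unique[OF d[OF smooth_functions_cmult[OF f]] has_derivative_mult_right[OF d[OF f]]]
    by metis
  show "cvec q u (\<lambda>q. f q * g q) = f q * cvec q u g + g q * cvec q u f"
    if f: "f \<in> smooth_functions A" and g: "g \<in> smooth_functions A" for f g
  proof -
    have "(\<lambda>u. cvec q u (\<lambda>q. f q * g q))
        = (\<lambda>u. f (par (\<phi> q)) * cvec q u g + cvec q u f * g (par (\<phi> q)))"
      by (rule has_derivative_unique[OF d[OF smooth_functions_mult[OF f g]] has_derivative_mult[OF d[OF f] d[OF g]]])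
    from fun_cong[OF this, of u] show ?thesis by (simp add: par_chart[OF q])
  qed
qed (simp add: coord_vec_def)

lemma coord_vec_linear:
  assumes q: "q \<in> U"
  shows "cvec q (u + w) = cvec q u + cvec q w" and "cvec q (a *\<^sub>R u) = scale a (cvec q u)"
proof -
  have l: "linear (\<lambda>u. cvec q u f)" if "f \<in> smooth_functions A" for f
    by (rule has_derivative_linear[OF chart_has_derivative[OF that q]])
  have "cvec q (u + w) f = (cvec q u + cvec q w) f" for f
    by (cases "f \<in> smooth_functions A") (simp_all add: linear_add[OF l], simp add: coord_vec_def)
  then show "cvec q (u + w) = cvec q u + cvec q w" by (rule ext)
  have "cvec q (a *\<^sub>R u) f = scale a (cvec q u) f" for f
    by (cases "f \<in> smooth_functions A") (simp_all add: linear_scale[OF l] scale_def, simp add: coord_vec_def)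
  then show "cvec q (a *\<^sub>R u) = scale a (cvec q u)" by (rule ext)
qed

text \<open>Coordinates exist on \<open>U\<close> only; cut off, they become global smooth functions
  on which tangent vectors can be evaluated to read off components.\<close>

lemma coordinate_functions:
  assumes q: "q \<in> U"
  obtains \<xi> V where "open V" "q \<in> V" "V \<subseteq> U" "open (\<phi> ` V)" "\<And>b. \<xi> b \<in> smooth_functions A"
    "\<And>b p. p \<in> V \<Longrightarrow> \<xi> b p = \<phi> p \<bullet> b"
proof -
  obtain \<theta> :: "'e \<Rightarrow> real" and V where V: "open V" "q \<in> V" "V \<subseteq> U" "\<phi> ` V \<subseteq> \<phi> ` U" "open (\<phi> ` V)"
    and \<theta>: "\<And>q. q \<in> V \<Longrightarrow> \<theta> (\<phi> q) = 1" "\<And>z. z \<notin> \<phi> ` U \<Longrightarrow> \<theta> z = 0"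
    and e: "\<And>h. smooth_on (\<phi> ` U) h
      \<Longrightarrow> (\<lambda>q. if q \<in> U then \<theta> (\<phi> q) * h (\<phi> q) else 0) \<in> smooth_functions A"
    by (rule extension_by_zero[OF open_image order_refl q imageI[OF q]]) blast
  show ?thesis
  proof (rule that[OF V(1,2,3,5)])
    show "(\<lambda>p. if p \<in> U then \<theta> (\<phi> p) * (\<phi> p \<bullet> b) else 0) \<in> smooth_functions A" for b
      by (rule e) (rule smooth_on_inner_left[OF open_image smooth_on_id[OF open_image]])
    show "(if p \<in> U then \<theta> (\<phi> p) * (\<phi> p \<bullet> b) else 0) = \<phi> p \<bullet> b" if "p \<in> V" for b p
      using that V(3) \<theta>(1) by auto
  qed
qed

lemma coord_vec_coordinate_function:
  assumes V: "open V" "p \<in> V" "V \<subseteq> U" and x: "x \<in> smooth_functions A" "\<And>p. p \<in> V \<Longrightarrow> x p = \<phi> p \<bullet> b"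
  shows "cvec p u x = u \<bullet> b"
proof -
  have o: "open (\<phi> ` V)" by (rule open_chart_image[OF V(1,3)])
  have "((\<lambda>z. z \<bullet> b) has_derivative (\<lambda>u. u \<bullet> b)) (at (\<phi> p))"
    by (rule has_derivative_inner_left[OF has_derivative_ident])
  then have "((\<lambda>z. x (par z)) has_derivative (\<lambda>u. u \<bullet> b)) (at (\<phi> p))"
  proof (rule has_derivative_transform_within_open[OF _ o])
    show "\<phi> p \<in> \<phi> ` V" using V(2) by (rule imageI)
    show "z \<bullet> b = x (par z)" if "z \<in> \<phi> ` V" for z
      using that V(3) x(2) par_chart by auto
  qed
  then show ?thesis
    using has_derivative_unique[OF chart_has_derivative[OF x(1)]] V by (metis subsetD)
qed

lemma coord_vec_inj:
  assumes "q \<in> U" "cvec q u = cvec q w"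
  shows "u = w"
proof -
  obtain \<xi> V where V: "open V" "q \<in> V" "V \<subseteq> U" "open (\<phi> ` V)" "\<And>b. \<xi> b \<in> smooth_functions A"
    "\<And>b p. p \<in> V \<Longrightarrow> \<xi> b p = \<phi> p \<bullet> b"
    by (rule coordinate_functions[OF assms(1)]) blast
  have eq: "u \<bullet> b = w \<bullet> b" for b
    using coord_vec_coordinate_function[OF V(1,2,3) V(5,6)] assms(2) by metis
  show ?thesis by (rule euclidean_eqI) (rule eq)
qed

text \<open>Hadamard's lemma writes \<open>f\<close> near \<open>q\<close> as \<open>f q\<close>
  plus a sum of products \<open>x b * g b\<close> with \<open>x b\<close> vanishing at
  \<open>q\<close>. A derivation kills the constant and, by the Leibniz rule, sends each product to
  the value of \<open>g b\<close> at \<open>q\<close> times its own value on \<open>x b\<close>; the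
  numbers \<open>v (E (x b))\<close> are therefore the components of \<open>u\<close>.\<close>

lemma tangent_vector_coordinates:
  assumes q: "q \<in> U" and v: "v \<in> tangent_space A q"
  obtains u where "v = cvec q u"
proof -
  obtain r where r: "0 < r" "ball (\<phi> q) r \<subseteq> \<phi> ` U"
    using open_image q open_contains_ball by blast
  let ?B = "ball (\<phi> q) r"
  have "\<phi> q \<in> ?B" using r by simp
  then obtain \<theta> :: "'e \<Rightarrow> real" and V where V: "open V" "q \<in> V" "V \<subseteq> U" "\<phi> ` V \<subseteq> ?B" "open (\<phi> ` V)"
    and \<theta>: "\<And>q. q \<in> V \<Longrightarrow> \<theta> (\<phi> q) = 1" "\<And>z. z \<notin> ?B \<Longrightarrow> \<theta> z = 0"
    and e: "\<And>h. smooth_on ?B h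
      \<Longrightarrow> (\<lambda>q. if q \<in> U then \<theta> (\<phi> q) * h (\<phi> q) else 0) \<in> smooth_functions A"
    by (rule extension_by_zero[OF open_ball r(2) q]) blast
  define E where "E h p = (if p \<in> U then \<theta> (\<phi> p) * h (\<phi> p) else 0)" for h p
  have E: "E h \<in> smooth_functions A" if "smooth_on ?B h" for h
    using e[OF that] unfolding E_def .
  have EV: "E h p = h (\<phi> p)" if "p \<in> V" for h p using that V(3) \<theta>(1) by (auto simp: E_def)
  define x where "x b z = (z - \<phi> q) \<bullet> b" for b z
  have x: "smooth_on ?B (x b)" for b
    unfolding x_def by (intro smooth_on_inner_left smooth_on_diff smooth_on_id smooth_on_const open_ball)
  define u where "u = (\<Sum>b\<in>Basis. v (E (x b)) *\<^sub>R b)"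
  have "v f = cvec q u f" for f
  proof (cases "f \<in> smooth_functions A")
    case f: True
    have fs: "smooth_on ?B (\<lambda>z. f (par z))"
      by (rule smooth_on_subset[OF smooth_function_in_chart[OF f] r(2)])
    obtain g where g: "\<And>b. smooth_on ?B (g b)"
      "\<And>z. z \<in> ?B \<Longrightarrow> f (par z) = f (par (\<phi> q)) + (\<Sum>b\<in>Basis. ((z - \<phi> q) \<bullet> b) * g b z)"
      "\<And>b. g b (\<phi> q) = frechet_derivative (\<lambda>z. f (par z)) (at (\<phi> q)) b"
      by (rule Hadamard[OF fs]) blast
    have s: "(\<lambda>p. E (x b) p * E (g b) p) \<in> smooth_functions A" for b
      by (rule smooth_functions_mult[OF E[OF x] E[OF g(1)]])
    have "v f = v (\<lambda>p. f q + (\<Sum>b\<in>Basis. E (x b) p * E (g b) p))"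
    proof (rule tangent_vector_local[OF v f _ V(1,2)])
      show "(\<lambda>p. f q + (\<Sum>b\<in>Basis. E (x b) p * E (g b) p)) \<in> smooth_functions A"
        by (intro smooth_functions_add smooth_functions_const smooth_functions_sum s)
      show "f p = f q + (\<Sum>b\<in>Basis. E (x b) p * E (g b) p)" if p: "p \<in> V" for p
      proof -
        have "\<phi> p \<in> ?B" "p \<in> U" using V(3,4) p by auto
        then show ?thesis using g(2)[of "\<phi> p"] by (simp add: EV[OF p] x_def par_chart q)
      qed
    qed
    also have "\<dots> = v (\<lambda>p. f q) + v (\<lambda>p. \<Sum>b\<in>Basis. E (x b) p * E (g b) p)"
      by (rule tangent_spaceD(1)[OF v smooth_functions_const smooth_functions_sum[OF s]])
    also have "\<dots> = (\<Sum>b\<in>Basis. v (\<lambda>p. E (x b) p * E (g b) p))"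
      by (simp only: tangent_space_const[OF v] tangent_space_sum[OF v s] add_0_left)
    also have "\<dots> = (\<Sum>b\<in>Basis. cvec q b f * v (E (x b)))"
    proof (rule sum.cong[OF refl])
      fix b
      have "v (\<lambda>p. E (x b) p * E (g b) p) = E (x b) q * v (E (g b)) + E (g b) q * v (E (x b))"
        by (rule tangent_spaceD(3)[OF v E[OF x] E[OF g(1)]])
      then show "v (\<lambda>p. E (x b) p * E (g b) p) = cvec q b f * v (E (x b))"
        by (simp add: EV[OF V(2)] g(3) coord_vec_apply[OF f]) (simp add: x_def)
    qed
    also have "\<dots> = u \<bullet> (\<Sum>b\<in>Basis. cvec q b f *\<^sub>R b)"
      unfolding u_def
      by (simp add: inner_sum_right inner_sum_left inner_Basis if_distrib mult.commute cong: if_cong)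
    also have "\<dots> = cvec q u f"
      by (rule has_derivative_gradient[OF chart_has_derivative[OF f q], symmetric])
    finally show ?thesis .
  next
    case False
    then show ?thesis by (simp add: tangent_spaceD(4)[OF v] coord_vec_def)
  qed
  then show ?thesis using that by blast
qed

lemma coord_coord_vec: "q \<in> U \<Longrightarrow> crd q (cvec q u) = u"
  unfolding coord_def by (rule the_equality) (auto dest: coord_vec_inj)

lemma coord_vec_coord: "q \<in> U \<Longrightarrow> v \<in> tangent_space A q \<Longrightarrow> cvec q (crd q v) = v"
  using tangent_vector_coordinates coord_coord_vec by metis

lemma coord_linear:
  assumes "q \<in> U" "v \<in> tangent_space A q" "w \<in> tangent_space A q"
  shows "crd q (v + w) = crd q v + crd q w" and "crd q (scale a v) = a *\<^sub>R crd q v"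
  using assms by (metis coord_coord_vec coord_vec_coord coord_vec_linear(1))
    (use assms in \<open>metis coord_coord_vec coord_vec_coord coord_vec_linear(2)\<close>)

lemma coord_inner:
  assumes "open V" "p \<in> V" "V \<subseteq> U" "x \<in> smooth_functions A" "\<And>p. p \<in> V \<Longrightarrow> x p = \<phi> p \<bullet> b"
    and "v \<in> tangent_space A p"
  shows "crd p v \<bullet> b = v x"
  using coord_vec_coordinate_function[OF assms(1-5), of "crd p v"] coord_vec_coord[of p v] assms by auto

text \<open>Locally the components are the functions \<open>X p (\<xi> b)\<close> for cut-off
  coordinates \<open>\<xi> b\<close>, smooth by the definition of a vector field.\<close>

lemma smooth_coord_field:
  assumes X: "X \<in> vector_fields A"
  shows "smooth_on (\<phi> ` U) (\<lambda>z. crd (par z) (X (par z)))"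
proof (rule smooth_on_euclidean[OF open_image], rule smooth_on_local)
  fix b z assume z: "z \<in> \<phi> ` U"
  obtain \<xi> V where V: "open V" "par z \<in> V" "V \<subseteq> U" "open (\<phi> ` V)" "\<And>b. \<xi> b \<in> smooth_functions A"
    "\<And>b p. p \<in> V \<Longrightarrow> \<xi> b p = \<phi> p \<bullet> b"
    by (rule coordinate_functions[OF par_in[OF z]]) blast
  have pV: "par y \<in> V" if "y \<in> \<phi> ` V" for y using that V(3) par_chart by auto
  have "smooth_on (\<phi> ` V) (\<lambda>z. X (par z) (\<xi> b))"
    by (rule smooth_on_subset[OF smooth_function_in_chart[OF vector_fieldsD(2)[OF X V(5)]] image_mono[OF V(3)]])
  then have "smooth_on (\<phi> ` V) (\<lambda>z. crd (par z) (X (par z)) \<bullet> b)"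
    by (rule smooth_on_cong[OF _ V(4)])
      (rule coord_inner[OF V(1) pV V(3) V(5,6) vector_fieldsD(1)[OF X], symmetric])
  moreover have "z \<in> \<phi> ` V" using V(2) chart_par[OF z] by (metis image_eqI)
  ultimately show "\<exists>T. open T \<and> z \<in> T \<and> smooth_on T (\<lambda>z. crd (par z) (X (par z)) \<bullet> b)"
    using V(4) by blast
qed

text \<open>Smoothness of tensor fields is tested on global vector fields; these fields, constant in
  coordinates near \<open>q\<close>, give access to the columns of the matrix of a tensor
  field.\<close>

lemma constant_field:
  assumes q: "q \<in> U"
  obtains X V where "X \<in> vector_fields A" "open V" "q \<in> V" "V \<subseteq> U" "open (\<phi> ` V)"
    "\<And>p. p \<in> V \<Longrightarrow> X p = cvec p u"
proof -
  obtain \<theta> :: "'e \<Rightarrow> real" and V where V: "open V" "q \<in> V" "V \<subseteq> U" "\<phi> ` V \<subseteq> \<phi> ` U" "open (\<phi> ` V)"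
    and \<theta>: "\<And>q. q \<in> V \<Longrightarrow> \<theta> (\<phi> q) = 1" "\<And>z. z \<notin> \<phi> ` U \<Longrightarrow> \<theta> z = 0"
    and e: "\<And>h. smooth_on (\<phi> ` U) h
      \<Longrightarrow> (\<lambda>q. if q \<in> U then \<theta> (\<phi> q) * h (\<phi> q) else 0) \<in> smooth_functions A"
    by (rule extension_by_zero[OF open_image order_refl q imageI[OF q]]) blast
  define X where "X p = (if p \<in> U then scale (\<theta> (\<phi> p)) (cvec p u) else 0)" for p
  have "X \<in> vector_fields A"
  proof (rule vector_fieldsI)
    show "X p \<in> tangent_space A p" for p
      by (simp add: X_def tangent_space_zero tangent_space_scale coord_vec_in_tangent_space)
    fix f assume f: "f \<in> smooth_functions A"
    have "(\<lambda>p. if p \<in> U then \<theta> (\<phi> p) * frechet_derivative (\<lambda>z. f (par z)) (at (\<phi> p)) u else 0)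
        \<in> smooth_functions A"
      by (rule e) (rule smooth_on_frechet_derivative[OF smooth_function_in_chart[OF f]])
    moreover have "(\<lambda>p. if p \<in> U then \<theta> (\<phi> p) * frechet_derivative (\<lambda>z. f (par z)) (at (\<phi> p)) u else 0)
        = (\<lambda>p. X p f)"
      by (rule ext) (simp add: X_def scale_def coord_vec_apply[OF f])
    ultimately show "(\<lambda>p. X p f) \<in> smooth_functions A" by simp
  qed
  moreover have "X p = cvec p u" if "p \<in> V" for p
    using that V(3) \<theta>(1) by (auto simp: X_def scale_def)
  ultimately show ?thesis using that V(1,2,3,5) by blast
qed

lemma vector_field_apply:
  assumes "X \<in> vector_fields A" "q \<in> U"
  shows "X q f = cvec q (crd q (X q)) f"
  by (simp add: coord_vec_coord[OF assms(2) vector_fieldsD(1)[OF assms(1)]])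

text \<open>On a coordinate function, \<open>Y\<close> gives a component of \<open>Y\<close>, and
  applying \<open>X\<close> differentiates that component in the direction of \<open>X\<close>.
  Second derivatives of a test function never arise.\<close>

lemma coord_lie:
  assumes X: "X \<in> vector_fields A" and Y: "Y \<in> vector_fields A" and q: "q \<in> U"
  shows "crd q (lie X Y q)
    = frechet_derivative (\<lambda>z. crd (par z) (Y (par z))) (at (\<phi> q)) (crd q (X q))
    - frechet_derivative (\<lambda>z. crd (par z) (X (par z))) (at (\<phi> q)) (crd q (Y q))"
proof -
  obtain \<xi> V where V: "open V" "q \<in> V" "V \<subseteq> U" "open (\<phi> ` V)" "\<And>b. \<xi> b \<in> smooth_functions A"
    "\<And>b p. p \<in> V \<Longrightarrow> \<xi> b p = \<phi> p \<bullet> b"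
    by (rule coordinate_functions[OF q]) blast
  have pV: "par y \<in> V" if "y \<in> \<phi> ` V" for y using that V(3) par_chart by auto
  have part: "Z q (\<lambda>p. Y p (\<xi> b))
      = frechet_derivative (\<lambda>z. crd (par z) (Y (par z))) (at (\<phi> q)) (crd q (Z q)) \<bullet> b"
    if Y: "Y \<in> vector_fields A" and Z: "Z \<in> vector_fields A" for Y Z b
  proof -
    have "((\<lambda>z. crd (par z) (Y (par z)) \<bullet> b) has_derivative
        (\<lambda>u. frechet_derivative (\<lambda>z. crd (par z) (Y (par z))) (at (\<phi> q)) u \<bullet> b)) (at (\<phi> q))"
      by (rule has_derivative_inner_left[OF smooth_on_has_derivative[OF smooth_coord_field[OF Y] imageI[OF q]]])
    then have "((\<lambda>z. Y (par z) (\<xi> b)) has_derivative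
        (\<lambda>u. frechet_derivative (\<lambda>z. crd (par z) (Y (par z))) (at (\<phi> q)) u \<bullet> b)) (at (\<phi> q))"
      by (rule has_derivative_transform_within_open[OF _ V(4) imageI[OF V(2)]])
        (rule coord_inner[OF V(1) pV V(3) V(5,6) vector_fieldsD(1)[OF Y]])
    from has_derivative_unique[OF chart_has_derivative[OF vector_fieldsD(2)[OF Y V(5)] q] this]
    have "cvec q u (\<lambda>p. Y p (\<xi> b)) = frechet_derivative (\<lambda>z. crd (par z) (Y (par z))) (at (\<phi> q)) u \<bullet> b" for u
      by (rule fun_cong)
    then show ?thesis
      using vector_field_apply[OF Z q] by (simp only:)
  qed
  have c: "crd q (lie X Y q) \<bullet> b = lie X Y q (\<xi> b)" for b
    by (rule coord_inner[OF V(1,2,3) V(5,6) lie_in_tangent_space[OF X Y]])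
  show ?thesis
    by (rule euclidean_eqI) (simp only: c, simp only: lie_def part[OF Y X] part[OF X Y] inner_diff_left)
qed

end

section \<open>Slices and changes of charts\<close>

text \<open>A subspace of a Euclidean space is cut out by the functionals of its orthogonal
  complement; these vanish on \<open>c\<close>, hence on its derivative.\<close>

lemma derivative_in_subspace:
  fixes c :: "real \<Rightarrow> 'e::euclidean_space"
  assumes S: "subspace S" and c: "(c has_derivative D) (at x)"
    and T: "open T" "x \<in> T" and cS: "\<And>t. t \<in> T \<Longrightarrow> c t \<in> S"
  shows "D h \<in> S"
proof -
  have "orthogonal a (D h)" if a: "a \<in> orthogonal_comp S" for a
  proof -
    have "((\<lambda>t. c t \<bullet> a) has_derivative (\<lambda>h. D h \<bullet> a)) (at x)"
      by (rule has_derivative_inner_left[OF c])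
    then have "((\<lambda>t. 0) has_derivative (\<lambda>h. D h \<bullet> a)) (at x)"
    proof (rule has_derivative_transform_within_open[OF _ T])
      show "c t \<bullet> a = 0" if "t \<in> T" for t
        using a cS[OF that] by (simp add: orthogonal_comp_def orthogonal_def)
    qed
    from has_derivative_unique[OF has_derivative_const this] have "D h \<bullet> a = 0" by metis
    then show ?thesis by (simp add: orthogonal_def inner_commute)
  qed
  then have "D h \<in> orthogonal_comp (orthogonal_comp S)" by (simp add: orthogonal_comp_def)
  then show ?thesis by (simp add: orthogonal_comp_self[OF S])
qed

text \<open>The zero vectors ensure that a real vector, whose imaginary part is 0, belongs to the
  complexification. This carries the condition on integral manifolds, stated over the complex
  numbers, back to real tangent spaces.\<close>

lemma complexify_eq_iff:
  assumes "0 \<in> V" "0 \<in> W"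
  shows "complexify V = complexify W \<longleftrightarrow> V = W"
proof
  have iff: "v \<in> V \<longleftrightarrow> (\<lambda>f. complex_of_real (v f)) \<in> complexify V" if "0 \<in> V"
    for v :: "'a tvec" and V
    using that by (simp add: complexify_def zero_fun_def)
  show "complexify V = complexify W \<Longrightarrow> V = W"
    using iff[OF assms(1)] iff[OF assms(2)] by (intro set_eqI) simp
qed simp

context manifold_chart
begin

lemma velocity_eq_coord_vec:
  assumes q: "q \<in> U" and T: "open T" "0 \<in> T" "\<And>t. t \<in> T \<Longrightarrow> \<gamma> t \<in> U" and \<gamma>0: "\<gamma> 0 = q"
    and d: "((\<lambda>t. \<phi> (\<gamma> t)) has_derivative D) (at 0)"
  shows "velocity A \<gamma> = cvec q (D 1)"
proof (rule coord_vec_eqI[OF q chart_has_derivative[OF _ q]])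
  fix f assume f: "f \<in> smooth_functions A"
  have lD: "D h = h *\<^sub>R D 1" for h
    using linear_scale[OF has_derivative_linear[OF d], of h 1] by simp
  have "((\<lambda>z. f (par z)) has_derivative (\<lambda>u. cvec q u f)) (at (\<phi> (\<gamma> 0)))"
    unfolding \<gamma>0 by (rule chart_has_derivative[OF f q])
  from has_derivative_compose[OF d this]
  have "((\<lambda>t. f (\<gamma> t)) has_derivative (\<lambda>h. cvec q (D h) f)) (at 0)"
    by (rule has_derivative_transform_within_open[OF _ T(1,2)]) (simp add: par_chart T(3))
  moreover have "(\<lambda>h. cvec q (D h) f) = (*) (cvec q (D 1) f)"
    by (rule ext, subst lD) (simp add: coord_vec_linear[OF q] scale_def mult.commute)
  ultimately have "((\<lambda>t. f (\<gamma> t)) has_real_derivative cvec q (D 1) f) (at 0)"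
    by (simp add: has_field_derivative_def)
  from DERIV_imp_deriv[OF this] show "velocity A \<gamma> f = cvec q (D 1) f"
    by (simp add: velocity_def f comp_def)
qed (simp_all add: velocity_def)

text \<open>A curve in \<open>N\<close> has coordinates in \<open>S\<close>, and so has their
  derivative; conversely the straight line \<open>\<phi> q + t u\<close> with \<open>u\<close> in
  \<open>S\<close> remains in the slice for small \<open>t\<close> and has velocity
  \<open>u\<close>.\<close>

lemma slice_tangent_space:
  assumes S: "subspace S" and slice: "\<phi> ` (U \<inter> N) = \<phi> ` U \<inter> S" and q: "q \<in> U" "q \<in> N"
  shows "submanifold_tangent_space A N q = cvec q ` S"
proof (intro equalityI subsetI)
  fix v assume "v \<in> submanifold_tangent_space A N q"
  then obtain \<epsilon> \<gamma> where \<epsilon>: "0 < \<epsilon>" and sc: "smooth_curve A \<epsilon> \<gamma>" and \<gamma>: "\<gamma> 0 = q" "\<gamma> ` {-\<epsilon><..<\<epsilon>} \<subseteq> N"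
    and v: "v = velocity A \<gamma>"
    unfolding submanifold_tangent_space_def by blast
  \<comment> \<open>\<open>smooth_curve\<close> speaks about charts of \<open>A\<close>, so
    smoothness in the slice chart is obtained through a transition map.\<close>
  obtain V \<psi> where V: "(V, \<psi>) \<in> A" "q \<in> V" by (rule atlas_cover)
  interpret V: manifold_chart A V \<psi> by (rule atlas_chart[OF V(1)])
  define T where "T = {-\<epsilon><..<\<epsilon>} \<inter> \<gamma> -` (U \<inter> V)"
  have T: "open T"
    unfolding T_def
    by (rule continuous_open_preimage) (use sc in \<open>auto simp: smooth_curve_def open_domain V.open_domain\<close>)
  have T0: "0 \<in> T" using \<epsilon> \<gamma>(1) q V(2) by (simp add: T_def)
  have TU: "\<gamma> t \<in> U" "\<gamma> t \<in> V" "\<gamma> t \<in> N" if "t \<in> T" for t using that \<gamma>(2) by (auto simp: T_def)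
  have "smooth_on {t\<in>{-\<epsilon><..<\<epsilon>}. \<gamma> t \<in> V} (\<psi> \<circ> \<gamma>)" using sc V(1) by (auto simp: smooth_curve_def)
  then have "smooth_on T (\<lambda>t. \<psi> (\<gamma> t))" unfolding comp_def by (rule smooth_on_subset) (auto simp: T_def)
  then have "smooth_on T (\<lambda>t. \<phi> (V.par (\<psi> (\<gamma> t))))"
    by (rule smooth_on_compose[OF T _ smooth_transition(2)[OF V(1)]]) (use TU in auto)
  then have "smooth_on T (\<lambda>t. \<phi> (\<gamma> t))"
    by (rule smooth_on_cong[OF _ T]) (simp add: V.par_chart TU)
  from smooth_on_has_derivative[OF this T0] obtain D where
    D: "((\<lambda>t. \<phi> (\<gamma> t)) has_derivative D) (at 0)" by blast
  have "\<phi> (\<gamma> t) \<in> S" if "t \<in> T" for t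
    using slice TU[OF that] by blast
  then have "D 1 \<in> S" by (rule derivative_in_subspace[OF S D T T0])
  moreover have "velocity A \<gamma> = cvec q (D 1)"
    by (rule velocity_eq_coord_vec[where \<gamma> = \<gamma>, OF q(1) T T0 _ \<gamma>(1) D]) (rule TU(1))
  ultimately show "v \<in> cvec q ` S" unfolding v by blast
next
  fix v assume "v \<in> cvec q ` S"
  then obtain u where u: "u \<in> S" "v = cvec q u" by blast
  obtain r where r: "0 < r" "ball (\<phi> q) r \<subseteq> \<phi> ` U" using open_image q(1) open_contains_ball by blast
  \<comment> \<open>Gives \<open>abs t * norm u < r\<close>, so the line stays in the chart; the
    added 1 allows \<open>u = 0\<close>.\<close>
  define \<epsilon> where "\<epsilon> = r / (norm u + 1)"
  have n: "0 < norm u + 1" by (simp add: add_nonneg_pos)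
  have \<epsilon>: "0 < \<epsilon>" using r(1) n by (simp add: \<epsilon>_def)
  define c where "c t = \<phi> q + t *\<^sub>R u" for t
  have c: "c t \<in> \<phi> ` U" if "t \<in> {-\<epsilon><..<\<epsilon>}" for t
  proof -
    have "\<bar>t\<bar> * norm u \<le> \<bar>t\<bar> * (norm u + 1)" by (rule mult_left_mono) simp_all
    also have "\<dots> < \<epsilon> * (norm u + 1)" using that by (intro mult_strict_right_mono n) auto
    also have "\<dots> = r" using n by (simp add: \<epsilon>_def)
    finally have "c t \<in> ball (\<phi> q) r" by (simp add: c_def dist_norm)
    then show ?thesis using r(2) by blast
  qed
  have qS: "\<phi> q \<in> S" using slice q by blast
  have cN: "par (c t) \<in> N" if "t \<in> {-\<epsilon><..<\<epsilon>}" for t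
  proof -
    have "c t \<in> S" unfolding c_def by (intro subspace_add[OF S] subspace_mul[OF S] qS u)
    then have "c t \<in> \<phi> ` (U \<inter> N)" using c[OF that] slice by blast
    then show ?thesis using par_chart by auto
  qed
  have cs: "smooth_on T c" if "open T" for T
    unfolding c_def
    by (intro smooth_on_add smooth_on_const smooth_on_scaleR smooth_on_id that)
  have "smooth_curve A \<epsilon> (\<lambda>t. par (c t))"
    unfolding smooth_curve_def
  proof (intro conjI ballI)
    show cont: "continuous_on {-\<epsilon><..<\<epsilon>} (\<lambda>t. par (c t))"
      by (rule continuous_on_compose2[OF continuous_on_par smooth_on_imp_continuous_on[OF cs]]) (use c in auto)
    fix k assume k: "k \<in> A"
    obtain V \<psi> where V: "k = (V, \<psi>)" by (cases k)
    interpret V: manifold_chart A V \<psi> by (rule atlas_chart) (use k V in simp)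
    let ?T = "{t \<in> {-\<epsilon><..<\<epsilon>}. par (c t) \<in> V}"
    have "open ({-\<epsilon><..<\<epsilon>} \<inter> (\<lambda>t. par (c t)) -` V)"
      by (rule continuous_open_preimage[OF cont _ V.open_domain]) simp
    moreover have "{-\<epsilon><..<\<epsilon>} \<inter> (\<lambda>t. par (c t)) -` V = ?T" by blast
    ultimately have T: "open ?T" by simp
    have "smooth_on ?T (\<lambda>t. \<psi> (par (c t)))"
    proof (rule smooth_on_compose[OF T cs[OF T]])
      show "smooth_on (\<phi> ` (U \<inter> V)) (\<lambda>z. \<psi> (par z))" by (rule smooth_transition) (use k V in simp)
      show "c ` ?T \<subseteq> \<phi> ` (U \<inter> V)"
      proof (rule image_subsetI)
        fix t assume "t \<in> ?T"
        then show "c t \<in> \<phi> ` (U \<inter> V)"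
          using c[of t] by (intro image_eqI[of _ _ "par (c t)"]) (auto simp: chart_par par_in)
      qed
    qed
    then show "case k of (U, \<psi>) \<Rightarrow> smooth_on {t \<in> {-\<epsilon><..<\<epsilon>}. par (c t) \<in> U} (\<psi> \<circ> (\<lambda>t. par (c t)))"
      by (simp add: V comp_def)
  qed
  moreover have "par (c 0) = q" by (simp add: c_def par_chart[OF q(1)])
  moreover have "velocity A (\<lambda>t. par (c t)) = v"
  proof -
    have "(c has_derivative (\<lambda>h. 0 + h *\<^sub>R u)) (at 0)"
      unfolding c_def
      by (rule has_derivative_add[OF has_derivative_const has_derivative_scaleR_left[OF has_derivative_ident]])
    then have "((\<lambda>t. \<phi> (par (c t))) has_derivative (\<lambda>h. 0 + h *\<^sub>R u)) (at 0)"
      by (rule has_derivative_transform_within_open[of _ _ _ _ "{-\<epsilon><..<\<epsilon>}"])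
        (use \<epsilon> c chart_par in auto)
    from velocity_eq_coord_vec[OF q(1) open_greaterThanLessThan[of "-\<epsilon>" \<epsilon>] _ par_in[OF c] \<open>par (c 0) = q\<close> this]
    show ?thesis using \<epsilon> u(2) by simp
  qed
  moreover have "(\<lambda>t. par (c t)) ` {-\<epsilon><..<\<epsilon>} \<subseteq> N" using cN by blast
  ultimately show "v \<in> submanifold_tangent_space A N q"
    unfolding submanifold_tangent_space_def mem_Collect_eq using \<epsilon>
    by (intro exI[of _ \<epsilon>] exI[of _ "\<lambda>t. par (c t)"] conjI) (simp_all only:)
qed

text \<open>\<open>\<Phi>\<close> is the coordinate change from \<open>\<phi>2\<close> to
  \<open>\<phi>\<close>, so this is the chain rule.\<close>

lemma coord_vec_reparametrize:
  assumes c2: "manifold_chart A U2 \<phi>2" and q: "q \<in> U2" "q \<in> U" and T: "open T" "\<phi>2 q \<in> T"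
    and par2: "\<And>x. x \<in> T \<Longrightarrow> inv_into U2 \<phi>2 x = par (\<Phi> x)"
    and \<Phi>: "(\<Phi> has_derivative D) (at (\<phi>2 q))" "\<Phi> (\<phi>2 q) = \<phi> q"
  shows "coord_vec A U2 \<phi>2 q s = cvec q (D s)"
proof (rule manifold_chart.coord_vec_eqI[OF c2 q(1), symmetric])
  show "((\<lambda>z. f (inv_into U2 \<phi>2 z)) has_derivative (\<lambda>s. cvec q (D s) f)) (at (\<phi>2 q))"
    if f: "f \<in> smooth_functions A" for f
  proof -
    have "((\<lambda>x. f (par (\<Phi> x))) has_derivative (\<lambda>s. cvec q (D s) f)) (at (\<phi>2 q))"
      by (rule has_derivative_compose[OF \<Phi>(1)]) (simp add: \<Phi>(2) chart_has_derivative[OF f q(2)])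
    then show ?thesis
      by (rule has_derivative_transform_within_open[OF _ T]) (simp add: par2)
  qed
qed (simp_all add: coord_vec_def)

text \<open>Turns the straightening diffeomorphism of the Euclidean Frobenius theorem into a chart
  of the maximal atlas, as the slice condition for submanifolds demands.\<close>

lemma smooth_chart_reparametrize:
  assumes W: "open W" "W \<subseteq> \<phi> ` U" "open W'" and \<Theta>: "smooth_on W \<Theta>" and \<Phi>: "smooth_on W' \<Phi>"
    and im: "\<Theta> ` W \<subseteq> W'" "\<Phi> ` W' \<subseteq> W"
    and inv: "\<And>z. z \<in> W \<Longrightarrow> \<Phi> (\<Theta> z) = z" "\<And>x. x \<in> W' \<Longrightarrow> \<Theta> (\<Phi> x) = x"
  defines "U2 \<equiv> U \<inter> \<phi> -` W" and "\<phi>2 \<equiv> \<lambda>q. \<Theta> (\<phi> q)"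
  shows "smooth_chart A (U2, \<phi>2)" and "\<phi>2 ` U2 = W'"
    and "\<And>x. x \<in> W' \<Longrightarrow> inv_into U2 \<phi>2 x = par (\<Phi> x)"
proof -
  have U2: "open U2" unfolding U2_def by (rule open_chart_preimage[OF W(1)])
  have pU2: "par (\<Phi> x) \<in> U2" "\<phi>2 (par (\<Phi> x)) = x" if "x \<in> W'" for x
  proof -
    have "\<Phi> x \<in> W" "\<Phi> x \<in> \<phi> ` U" using that im(2) W(2) by auto
    then show "par (\<Phi> x) \<in> U2" "\<phi>2 (par (\<Phi> x)) = x"
      using that by (simp_all add: U2_def \<phi>2_def par_in chart_par inv(2))
  qed
  have p2: "par (\<Phi> (\<phi>2 q)) = q" "\<phi>2 q \<in> W'" if "q \<in> U2" for q
    using that im(1) by (auto simp: U2_def \<phi>2_def inv(1) par_chart)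
  show img: "\<phi>2 ` U2 = W'" using pU2 p2(2) by (metis image_eqI image_subsetI subsetI subset_antisym)
  have inj: "inj_on \<phi>2 U2" using p2(1) by (metis inj_onI)
  show par2: "inv_into U2 \<phi>2 x = par (\<Phi> x)" if "x \<in> W'" for x
    by (rule inv_into_f_eq[OF inj]) (use pU2[OF that] in auto)
  have sub: "U2 \<subseteq> U" by (auto simp: U2_def)
  have "homeomorphism U2 (\<phi>2 ` U2) \<phi>2 (inv_into U2 \<phi>2)"
  proof (rule homeomorphismI)
    show "continuous_on U2 \<phi>2"
      unfolding \<phi>2_def
      by (rule continuous_on_compose2[OF smooth_on_imp_continuous_on[OF \<Theta>] continuous_on_subset[OF continuous_on_chart sub]])
        (auto simp: U2_def)
    have "continuous_on W' (\<lambda>x. par (\<Phi> x))"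
      by (rule continuous_on_compose2[OF continuous_on_par smooth_on_imp_continuous_on[OF \<Phi>]])
        (use im W in auto)
    then show "continuous_on (\<phi>2 ` U2) (inv_into U2 \<phi>2)"
      unfolding img by (rule continuous_on_eq) (simp add: par2)
  qed (use img par2 pU2 p2 in auto)
  then have "is_chart (U2, \<phi>2)" using U2 W(3) img by (simp add: is_chart_def)
  moreover have "smooth_compatible (U2, \<phi>2) d" if "d \<in> A" for d
  proof -
    obtain V \<psi> where d: "d = (V, \<psi>)" by (cases d)
    have VA: "(V, \<psi>) \<in> A" using that d by simp
    interpret V: manifold_chart A V \<psi> by (rule atlas_chart[OF VA])
    let ?S = "\<phi>2 ` (U2 \<inter> V)" and ?T = "\<psi> ` (U2 \<inter> V)"
    have T: "open ?T" by (rule V.open_chart_image) (auto intro: U2 V.open_domain)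
    have "?S = W' \<inter> \<Phi> -` (\<phi> ` (U2 \<inter> V))"
    proof (intro equalityI subsetI)
      fix x assume "x \<in> ?S"
      then obtain q where q: "q \<in> U2" "q \<in> V" "x = \<phi>2 q" by blast
      then have "\<Phi> x = \<phi> q" by (simp add: U2_def \<phi>2_def inv(1))
      then show "x \<in> W' \<inter> \<Phi> -` (\<phi> ` (U2 \<inter> V))" using q p2(2) by auto
    next
      fix x assume x: "x \<in> W' \<inter> \<Phi> -` (\<phi> ` (U2 \<inter> V))"
      then obtain q where q: "q \<in> U2" "q \<in> V" "\<Phi> x = \<phi> q" by blast
      then have "x = \<phi>2 q" using x inv(2)[of x] by (simp add: \<phi>2_def)
      then show "x \<in> ?S" using q by blast
    qed
    moreover have "open (W' \<inter> \<Phi> -` (\<phi> ` (U2 \<inter> V)))"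
      by (rule continuous_open_preimage[OF smooth_on_imp_continuous_on[OF \<Phi>] W(3)])
        (rule open_chart_image, use U2 V.open_domain sub in auto)
    ultimately have S: "open ?S" and S_im: "\<Phi> ` ?S \<subseteq> \<phi> ` (U \<inter> V)" and SW: "?S \<subseteq> W'" using sub by auto
    have "smooth_on ?S (\<lambda>x. \<psi> (par (\<Phi> x)))"
      by (rule smooth_on_compose[OF S smooth_on_subset[OF \<Phi> SW] smooth_transition(1)[OF VA] S_im])
    then have "smooth_on ?S (\<psi> \<circ> inv_into U2 \<phi>2)"
      by (rule smooth_on_cong[OF _ S]) (simp add: par2[OF subsetD[OF SW]])
    moreover have "smooth_on ?T (\<lambda>z. \<Theta> (\<phi> (V.par z)))"
      by (rule smooth_on_compose[OF T smooth_on_subset[OF smooth_transition(2)[OF VA]] \<Theta>])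
        (auto simp: U2_def V.par_chart)
    ultimately show ?thesis by (simp add: d smooth_compatible_def comp_def \<phi>2_def)
  qed
  ultimately show "smooth_chart A (U2, \<phi>2)" by (simp add: smooth_chart_def)
qed

end

section \<open>Projection fields\<close>

lemma scale_zero: "scale (0::real) v = 0" "scale a (0 :: 'b \<Rightarrow> real) = 0"
  by (auto simp: scale_def)

lemma tensor_field_11D:
  assumes "tensor_field_11 A T"
  shows "v \<in> tangent_space A p \<Longrightarrow> T p v \<in> tangent_space A p"
    and "v \<in> tangent_space A p \<Longrightarrow> w \<in> tangent_space A p \<Longrightarrow> T p (v + w) = T p v + T p w"
    and "v \<in> tangent_space A p \<Longrightarrow> T p (scale a v) = scale a (T p v)"
    and "X \<in> vector_fields A \<Longrightarrow> (\<lambda>p. T p (X p)) \<in> vector_fields A"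
  using assms unfolding tensor_field_11_def by blast+

lemma (in smooth_manifold) tensor_field_11_zero:
  "tensor_field_11 A T \<Longrightarrow> T p 0 = 0"
  using tensor_field_11D(3)[OF _ tangent_space_zero, of T p 0] by (simp add: scale_zero)

text \<open>To be instantiated with the real projections whose complex extensions are
  \<open>l\<close> and \<open>m\<close>.\<close>

locale projection_field = smooth_manifold A for A :: "('a::t2_space, 'e::euclidean_space) chart set" +
  fixes P :: "'a \<Rightarrow> 'a tvec \<Rightarrow> 'a tvec"
  assumes tensor: "tensor_field_11 A P"
    and idem: "v \<in> tangent_space A p \<Longrightarrow> P p (P p v) = P p v"
begin

lemmas P_in = tensor_field_11D(1)[OF tensor] and P_add = tensor_field_11D(2)[OF tensor]
  and P_scale = tensor_field_11D(3)[OF tensor] and P_field = tensor_field_11D(4)[OF tensor]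
  and P_zero = tensor_field_11_zero[OF tensor]

text \<open>Since \<open>P\<close> is a projection, the sections of its image are exactly the fields
  \<open>P X\<close>, and a tangent vector \<open>v\<close> lies in the image iff
  \<open>P v = v\<close>; so this is involutivity of the image distribution.\<close>

definition involutive :: bool where
  "involutive \<longleftrightarrow> (\<forall>X\<in>vector_fields A. \<forall>Y\<in>vector_fields A. \<forall>p.
     P p (lie (\<lambda>p. P p (X p)) (\<lambda>p. P p (Y p)) p) = lie (\<lambda>p. P p (X p)) (\<lambda>p. P p (Y p)) p)"

end

section \<open>Projection fields in coordinates\<close>

locale projection_chart = manifold_chart A U \<phi> + projection_field A P
  for A :: "('a::t2_space, 'e::euclidean_space) chart set" and U \<phi> P
begin

definition mat :: "'e \<Rightarrow> 'e \<Rightarrow>\<^sub>L 'e" where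
  "mat z = Blinfun (\<lambda>u. crd (par z) (P (par z) (cvec (par z) u)))"

lemma mat_apply:
  assumes "z \<in> \<phi> ` U"
  shows "mat z u = crd (par z) (P (par z) (cvec (par z) u))"
proof -
  note z = par_in[OF assms]
  note t = coord_vec_in_tangent_space[OF z] and Pt = P_in[OF coord_vec_in_tangent_space[OF z]]
  have "linear (\<lambda>u. crd (par z) (P (par z) (cvec (par z) u)))"
  proof (rule linearI)
    show "crd (par z) (P (par z) (cvec (par z) (u + w)))
        = crd (par z) (P (par z) (cvec (par z) u)) + crd (par z) (P (par z) (cvec (par z) w))" for u w
      by (simp only: coord_vec_linear(1)[OF z] P_add[OF t t] coord_linear(1)[OF z Pt Pt])
    show "crd (par z) (P (par z) (cvec (par z) (a *\<^sub>R u))) = a *\<^sub>R crd (par z) (P (par z) (cvec (par z) u))"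
      for a u
      by (simp only: coord_vec_linear(2)[OF z] P_scale[OF t] coord_linear(2)[OF z Pt Pt])
  qed
  then show ?thesis
    unfolding mat_def by (simp add: bounded_linear_Blinfun_apply linear_conv_bounded_linear)
qed

lemma coord_vec_mat:
  assumes "q \<in> U"
  shows "cvec q (mat (\<phi> q) u) = P q (cvec q u)"
  using mat_apply[OF imageI[OF assms], of u]
  by (simp only: par_chart[OF assms] coord_vec_coord[OF assms P_in[OF coord_vec_in_tangent_space[OF assms]]])

lemma mat_idem:
  assumes "z \<in> \<phi> ` U"
  shows "mat z (mat z u) = mat z u"
proof -
  obtain q where q: "q \<in> U" "z = \<phi> q" using assms by blast
  have "cvec q (mat z (mat z u)) = cvec q (mat z u)"
    unfolding q(2) coord_vec_mat[OF q(1)] by (rule idem[OF coord_vec_in_tangent_space[OF q(1)]])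
  then show ?thesis by (rule coord_vec_inj[OF q(1)])
qed

lemma mat_constant_field:
  assumes "\<And>p. p \<in> V \<Longrightarrow> X p = cvec p u" "V \<subseteq> U" "z \<in> \<phi> ` V"
  shows "crd (par z) (P (par z) (X (par z))) = mat z u"
proof -
  have "par z \<in> V" using assms(2,3) par_chart by auto
  then show ?thesis using assms by (subst mat_apply) (auto simp: assms(1))
qed

lemma smooth_on_mat: "smooth_on (\<phi> ` U) mat"
proof (rule smooth_on_blinfun[OF open_image], rule smooth_on_local)
  fix u z assume z: "z \<in> \<phi> ` U"
  obtain X V where X: "X \<in> vector_fields A" and V: "open V" "par z \<in> V" "V \<subseteq> U" "open (\<phi> ` V)"
    "\<And>p. p \<in> V \<Longrightarrow> X p = cvec p u"
    by (rule constant_field[OF par_in[OF z]]) blast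
  have "smooth_on (\<phi> ` V) (\<lambda>z. crd (par z) (P (par z) (X (par z))))"
    by (rule smooth_on_subset[OF smooth_coord_field[OF P_field[OF X]] image_mono[OF V(3)]])
  then have "smooth_on (\<phi> ` V) (\<lambda>z. mat z u)"
    by (rule smooth_on_cong[OF _ V(4)]) (rule mat_constant_field[OF V(5) V(3)])
  moreover have "z \<in> \<phi> ` V" using V(2) chart_par[OF z] by (metis image_eqI)
  ultimately show "\<exists>T. open T \<and> z \<in> T \<and> smooth_on T (\<lambda>z. mat z u)" using V(4) by blast
qed

lemma image_projection:
  assumes q: "q \<in> U"
  shows "P q ` tangent_space A q = cvec q ` range (blinfun_apply (mat (\<phi> q)))"
proof (intro equalityI subsetI)
  fix v assume "v \<in> P q ` tangent_space A q"
  then obtain w where "w \<in> tangent_space A q" "v = P q w" by blast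
  then have "v = cvec q (mat (\<phi> q) (crd q w))" by (simp add: coord_vec_mat[OF q] coord_vec_coord[OF q])
  then show "v \<in> cvec q ` range (blinfun_apply (mat (\<phi> q)))" by blast
next
  fix v assume "v \<in> cvec q ` range (blinfun_apply (mat (\<phi> q)))"
  then obtain u where "v = cvec q (mat (\<phi> q) u)" by blast
  then show "v \<in> P q ` tangent_space A q"
    by (simp add: coord_vec_mat[OF q] coord_vec_in_tangent_space[OF q])
qed

text \<open>Involutivity is applied to \<open>P X\<close> and \<open>P Y\<close> with
  \<open>X\<close> and \<open>Y\<close> constant in coordinates near the point, with values
  \<open>u\<close> and \<open>w\<close>. There \<open>P X\<close> has coordinates
  \<open>mat z u\<close>, and \<open>coord_lie\<close> turns the bracket into the stated
  expression.\<close>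

lemma involutive_mat:
  assumes inv: involutive and z: "z \<in> \<phi> ` U"
  shows "mat z (frechet_derivative mat (at z) (mat z u) w - frechet_derivative mat (at z) (mat z w) u)
    = frechet_derivative mat (at z) (mat z u) w - frechet_derivative mat (at z) (mat z w) u"
proof -
  define q where "q = par z"
  have q: "q \<in> U" "\<phi> q = z" unfolding q_def using par_in[OF z] chart_par[OF z] by simp_all
  have field: "\<exists>X. X \<in> vector_fields A \<and> crd q (P q (X q)) = mat z u \<and>
      frechet_derivative (\<lambda>z. crd (par z) (P (par z) (X (par z)))) (at z)
      = (\<lambda>a. frechet_derivative mat (at z) a u)" for u
  proof -
    obtain X V where X: "X \<in> vector_fields A" and V: "open V" "q \<in> V" "V \<subseteq> U" "open (\<phi> ` V)"
      "\<And>p. p \<in> V \<Longrightarrow> X p = cvec p u"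
      by (rule constant_field[OF q(1)]) blast
    have m: "crd (par z) (P (par z) (X (par z))) = mat z u" if "z \<in> \<phi> ` V" for z
      by (rule mat_constant_field[OF _ V(3) that]) (rule V(5))
    have zV: "z \<in> \<phi> ` V" using V(2) q(2) by blast
    have "frechet_derivative (\<lambda>z. crd (par z) (P (par z) (X (par z)))) (at z)
        = frechet_derivative (\<lambda>z. mat z u) (at z)"
      by (rule frechet_derivative_cong[OF V(4) zV m])
    also have "\<dots> = (\<lambda>a. frechet_derivative mat (at z) a u)"
      by (rule frechet_derivative_at[OF frechet_derivative_blinfun_apply[OF smooth_on_mat z], symmetric])
    finally show ?thesis using X m[OF zV] unfolding q_def by blast
  qed
  obtain X where X: "X \<in> vector_fields A" "crd q (P q (X q)) = mat z u"
    "frechet_derivative (\<lambda>z. crd (par z) (P (par z) (X (par z)))) (at z)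
      = (\<lambda>a. frechet_derivative mat (at z) a u)" using field by blast
  obtain Y where Y: "Y \<in> vector_fields A" "crd q (P q (Y q)) = mat z w"
    "frechet_derivative (\<lambda>z. crd (par z) (P (par z) (Y (par z)))) (at z)
      = (\<lambda>a. frechet_derivative mat (at z) a w)" using field by blast
  let ?b = "lie (\<lambda>p. P p (X p)) (\<lambda>p. P p (Y p)) q"
  have b: "?b \<in> tangent_space A q" by (rule lie_in_tangent_space[OF P_field[OF X(1)] P_field[OF Y(1)]])
  have "crd q ?b = frechet_derivative mat (at z) (mat z u) w - frechet_derivative mat (at z) (mat z w) u"
    using coord_lie[OF P_field[OF X(1)] P_field[OF Y(1)] q(1)] by (simp only: q(2) X(2,3) Y(2,3))
  moreover have "mat z (crd q ?b) = crd q ?b"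
  proof (rule coord_vec_inj[OF q(1)])
    have "cvec q (mat z (crd q ?b)) = P q ?b"
      using coord_vec_mat[OF q(1)] coord_vec_coord[OF q(1) b] by (simp only: q(2))
    also have "\<dots> = ?b" using inv X(1) Y(1) unfolding involutive_def by blast
    also have "\<dots> = cvec q (crd q ?b)" by (rule coord_vec_coord[OF q(1) b, symmetric])
    finally show "cvec q (mat z (crd q ?b)) = cvec q (crd q ?b)" .
  qed
  ultimately show ?thesis by simp
qed

end

section \<open>Frobenius' theorem and its converse on the manifold\<close>

context projection_field
begin

text \<open>The leaf is a slice of the straightened chart. Its tangent space in that chart is
  \<open>S\<close>; the derivative of \<open>\<Phi>\<close> carries \<open>S\<close> to the range of
  \<open>mat\<close>, which is the image of \<open>P\<close> in the original chart.\<close>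

lemma Frobenius:
  assumes inv: involutive
  shows "integrable_distribution A (\<lambda>p. complexify (P p ` tangent_space A p))"
  unfolding integrable_distribution_def
proof
  fix p
  obtain U \<phi> where U: "(U, \<phi>) \<in> A" "p \<in> U" by (rule atlas_cover)
  interpret manifold_chart A U \<phi> by (rule atlas_chart[OF U(1)])
  interpret projection_chart A U \<phi> P ..
  have z0: "\<phi> p \<in> \<phi> ` U" using U(2) by (rule imageI)
  obtain W W' S and \<Theta> \<Phi> :: "'e \<Rightarrow> 'e" where W: "open W" "\<phi> p \<in> W" "W \<subseteq> \<phi> ` U" "open W'"
    and s: "smooth_on W \<Theta>" "smooth_on W' \<Phi>" and im: "\<Theta> ` W \<subseteq> W'" "\<Phi> ` W' \<subseteq> W"
    and inv: "\<And>z. z \<in> W \<Longrightarrow> \<Phi> (\<Theta> z) = z" "\<And>x. x \<in> W' \<Longrightarrow> \<Theta> (\<Phi> x) = x"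
    and S: "subspace S" "\<Theta> (\<phi> p) \<in> S"
    and D: "\<And>x. x \<in> W' \<Longrightarrow> x \<in> S
      \<Longrightarrow> frechet_derivative \<Phi> (at x) ` S = range (blinfun_apply (mat (\<Phi> x)))"
    by (rule Frobenius_euclidean[OF open_image z0 smooth_on_mat mat_idem involutive_mat[OF inv]])
      (assumption, assumption, blast)
  define U2 where "U2 = U \<inter> \<phi> -` W"
  define \<phi>2 where "\<phi>2 = (\<lambda>q. \<Theta> (\<phi> q))"
  note r = smooth_chart_reparametrize[OF W(1,3,4) s im inv, folded U2_def \<phi>2_def]
  interpret c2: manifold_chart A U2 \<phi>2 by unfold_locales (rule r(1))
  define N where "N = {q \<in> U2. \<phi>2 q \<in> S}"
  have slice: "\<phi>2 ` (U2 \<inter> N) = \<phi>2 ` U2 \<inter> S" by (auto simp: N_def)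
  have pN: "p \<in> N" using U(2) W(2) S(2) by (simp add: N_def U2_def \<phi>2_def)
  have emb: "embedded_submanifold A (dim S) N"
    unfolding embedded_submanifold_def
    using r(1) S(1) slice by (intro ballI exI[of _ U2] exI[of _ \<phi>2] exI[of _ S]) (auto simp: N_def)
  have T: "submanifold_tangent_space A N q = P q ` tangent_space A q" if qN: "q \<in> N" for q
  proof -
    have q: "q \<in> U2" "q \<in> U" "\<phi>2 q \<in> S" "\<phi>2 q \<in> W'" "\<Phi> (\<phi>2 q) = \<phi> q"
      using qN im(1) inv(1) by (auto simp: N_def U2_def \<phi>2_def)
    have "coord_vec A U2 \<phi>2 q s = cvec q (frechet_derivative \<Phi> (at (\<phi>2 q)) s)" for s
      by (rule coord_vec_reparametrize[OF c2.manifold_chart_axioms q(1,2) W(4) q(4) r(3)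
            smooth_on_has_derivative[OF s(2) q(4)] q(5)])
    then have "coord_vec A U2 \<phi>2 q ` S = cvec q ` (frechet_derivative \<Phi> (at (\<phi>2 q)) ` S)"
      by (simp add: image_image)
    then show ?thesis
      by (simp add: c2.slice_tangent_space[OF S(1) slice q(1) qN] D[OF q(4,3)] q(5) image_projection[OF q(2)])
  qed
  have "integral_manifold A (\<lambda>p. complexify (P p ` tangent_space A p)) N"
    unfolding integral_manifold_def
    using emb by (intro conjI ballI exI[of _ "dim S"]) (simp_all only: T)
  with pN show "\<exists>N. p \<in> N \<and> integral_manifold A (\<lambda>p. complexify (P p ` tangent_space A p)) N"
    by (intro exI[of _ N] conjI)
qed

text \<open>In a slice chart around \<open>p\<close> the fields \<open>P X\<close> and
  \<open>P Y\<close> have coordinates in \<open>S\<close> along the slice. Each term of the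
  coordinate formula for the bracket differentiates one of them in a direction of \<open>S\<close>,
  so the bracket at \<open>p\<close> has coordinates in \<open>S\<close>, which represents the image
  of \<open>P\<close>.\<close>

lemma integrable_imp_involutive:
  assumes int: "integrable_distribution A (\<lambda>p. complexify (P p ` tangent_space A p))"
  shows involutive
  unfolding involutive_def
proof (intro ballI allI)
  fix X Y p assume X: "X \<in> vector_fields A" and Y: "Y \<in> vector_fields A"
  obtain N where pN: "p \<in> N" and N: "integral_manifold A (\<lambda>p. complexify (P p ` tangent_space A p)) N"
    using int unfolding integrable_distribution_def by blast
  obtain k where emb: "embedded_submanifold A k N"
    and NT: "\<And>q. q \<in> N \<Longrightarrow> complexify (submanifold_tangent_space A N q) = complexify (P q ` tangent_space A q)"
    using N unfolding integral_manifold_def by blast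
  obtain U \<phi> S where c: "smooth_chart A (U, \<phi>)" and pU: "p \<in> U" and S: "subspace S"
    and slice: "\<phi> ` (U \<inter> N) = \<phi> ` U \<inter> S"
    using emb pN unfolding embedded_submanifold_def by blast
  interpret manifold_chart A U \<phi> by unfold_locales (rule c)
  have cvec0: "cvec q 0 = 0" if "q \<in> U" for q
    using coord_vec_linear(2)[OF that, of 0 0] by (simp add: scale_zero)
  have T: "cvec q ` S = P q ` tangent_space A q" if q: "q \<in> U" "q \<in> N" for q
  proof -
    have "0 \<in> cvec q ` S" using cvec0[OF q(1)] subspace_0[OF S] by (metis image_eqI)
    moreover have "0 \<in> P q ` tangent_space A q" using P_zero tangent_space_zero by (metis image_eqI)
    ultimately show ?thesis
      using NT[OF q(2)] by (simp add: slice_tangent_space[OF S slice q] complexify_eq_iff)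
  qed
  have inS: "crd q (P q (Z q)) \<in> S" if q: "q \<in> U" "q \<in> N" and Z: "Z \<in> vector_fields A" for q Z
  proof -
    have "P q (Z q) \<in> cvec q ` S" unfolding T[OF q] by (rule imageI[OF vector_fieldsD(1)[OF Z]])
    then show ?thesis using coord_coord_vec[OF q(1)] by auto
  qed
  have inS': "crd (par z) (P (par z) (Z (par z))) \<in> S" if z: "z \<in> \<phi> ` U" "z \<in> S" and Z: "Z \<in> vector_fields A" for z Z
  proof (rule inS[OF _ _ Z])
    have "z \<in> \<phi> ` (U \<inter> N)" using z slice by blast
    then show "par z \<in> U" "par z \<in> N" using par_chart by auto
  qed
  have pS: "\<phi> p \<in> S" using slice pU pN by blast
  \<comment> \<open>The derivative in direction \<open>s\<close> is computed along the line through
    \<open>\<phi> p\<close>, which stays in the slice since \<open>s\<close> is in \<open>S\<close>;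
    off the slice nothing is known about the coordinates of the field.\<close>
  have deriv: "frechet_derivative (\<lambda>z. crd (par z) (P (par z) (Z (par z)))) (at (\<phi> p)) s \<in> S" (is "?D s \<in> S")
    if Z: "Z \<in> vector_fields A" and s: "s \<in> S" for Z s
  proof -
    have c: "((\<lambda>t. \<phi> p + t *\<^sub>R s) has_derivative (\<lambda>h. 0 + h *\<^sub>R s)) (at 0)"
      by (rule has_derivative_add[OF has_derivative_const has_derivative_scaleR_left[OF has_derivative_ident]])
    have "((\<lambda>z. crd (par z) (P (par z) (Z (par z)))) has_derivative ?D) (at (\<phi> p + 0 *\<^sub>R s))"
      using smooth_on_has_derivative[OF smooth_coord_field[OF P_field[OF Z]] imageI[OF pU]] by simp
    from has_derivative_compose[OF c this]
    have d: "((\<lambda>t. crd (par (\<phi> p + t *\<^sub>R s)) (P (par (\<phi> p + t *\<^sub>R s)) (Z (par (\<phi> p + t *\<^sub>R s)))))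
        has_derivative (\<lambda>h. ?D (0 + h *\<^sub>R s))) (at 0)" .
    let ?T = "(\<lambda>t. \<phi> p + t *\<^sub>R s) -` (\<phi> ` U)"
    have "?D (0 + 1 *\<^sub>R s) \<in> S"
    proof (rule derivative_in_subspace[OF S d])
      show "open ?T" by (rule open_vimage[OF open_image]) (intro continuous_intros)
      show "0 \<in> ?T" using pU by simp
      fix t assume t: "t \<in> ?T"
      show "crd (par (\<phi> p + t *\<^sub>R s)) (P (par (\<phi> p + t *\<^sub>R s)) (Z (par (\<phi> p + t *\<^sub>R s)))) \<in> S"
        by (rule inS'[OF _ _ Z]) (use t in simp, intro subspace_add[OF S] subspace_mul[OF S] pS s)
    qed
    then show ?thesis by simp
  qed
  let ?b = "lie (\<lambda>p. P p (X p)) (\<lambda>p. P p (Y p)) p"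
  have b: "?b \<in> tangent_space A p" by (rule lie_in_tangent_space[OF P_field[OF X] P_field[OF Y]])
  have "crd p ?b \<in> S"
    unfolding coord_lie[OF P_field[OF X] P_field[OF Y] pU]
    by (intro subspace_diff[OF S] deriv X Y inS pU pN)
  then have "?b \<in> cvec p ` S" by (rule image_eqI[rotated]) (rule coord_vec_coord[OF pU b, symmetric])
  then obtain w where w: "w \<in> tangent_space A p" "?b = P p w" unfolding T[OF pU pN] by blast
  show "P p ?b = ?b" unfolding w(2) by (rule idem[OF w(1)])
qed

lemma integrable_iff_involutive:
  "integrable_distribution A (\<lambda>p. complexify (P p ` tangent_space A p)) \<longleftrightarrow> involutive"
  using Frobenius integrable_imp_involutive by blast

end

section \<open>F-structures\<close>

context smooth_manifold
begin

lemma vector_fields_comb: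
  assumes "X \<in> vector_fields A" "Y \<in> vector_fields A"
  shows "(\<lambda>p. scale a (X p) + scale b (Y p)) \<in> vector_fields A"
proof (rule vector_fieldsI)
  note x = vector_fieldsD[OF assms(1)] and y = vector_fieldsD[OF assms(2)]
  show "scale a (X p) + scale b (Y p) \<in> tangent_space A p" for p
    by (intro tangent_space_add tangent_space_scale x(1) y(1))
  show "(\<lambda>p. (scale a (X p) + scale b (Y p)) f) \<in> smooth_functions A" if "f \<in> smooth_functions A" for f
    using that by (simp add: scale_def smooth_functions_add smooth_functions_cmult x(2) y(2))
qed

lemma tensor_field_11_comb:
  assumes S: "tensor_field_11 A S" and T: "tensor_field_11 A T"
  shows "tensor_field_11 A (\<lambda>p v. scale a (S p v) + scale b (T p v))"
  unfolding tensor_field_11_def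
proof (intro conjI allI ballI)
  fix p v w and c :: real
  assume v: "v \<in> tangent_space A p"
  note s = tensor_field_11D[OF S] and t = tensor_field_11D[OF T]
  show "scale a (S p v) + scale b (T p v) \<in> tangent_space A p"
    by (intro tangent_space_add tangent_space_scale s(1) t(1) v)
  show "scale a (S p (scale c v)) + scale b (T p (scale c v)) = scale c (scale a (S p v) + scale b (T p v))"
    by (simp add: s(3)[OF v] t(3)[OF v]) (simp add: scale_def fun_eq_iff algebra_simps)
  assume w: "w \<in> tangent_space A p"
  show "scale a (S p (v + w)) + scale b (T p (v + w))
      = scale a (S p v) + scale b (T p v) + (scale a (S p w) + scale b (T p w))"
    by (simp add: s(2)[OF v w] t(2)[OF v w]) (simp add: scale_def fun_eq_iff algebra_simps)
next
  fix X assume X: "X \<in> vector_fields A"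
  show "(\<lambda>p. scale a (S p (X p)) + scale b (T p (X p))) \<in> vector_fields A"
    by (rule vector_fields_comb[OF tensor_field_11D(4)[OF S X] tensor_field_11D(4)[OF T X]])
qed

lemma tensor_field_11_compose:
  assumes S: "tensor_field_11 A S" and T: "tensor_field_11 A T"
  shows "tensor_field_11 A (\<lambda>p v. S p (T p v))"
  unfolding tensor_field_11_def
proof (intro conjI allI ballI)
  fix p v w and c :: real
  assume v: "v \<in> tangent_space A p"
  note s = tensor_field_11D[OF S] and t = tensor_field_11D[OF T]
  show "S p (T p v) \<in> tangent_space A p" by (intro s(1) t(1) v)
  show "S p (T p (scale c v)) = scale c (S p (T p v))" by (simp only: s(3) t(3) t(1) v)
  assume w: "w \<in> tangent_space A p"
  show "S p (T p (v + w)) = S p (T p v) + S p (T p w)" by (simp only: s(2) t(2) t(1) v w)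
next
  fix X assume "X \<in> vector_fields A"
  then show "(\<lambda>p. S p (T p (X p))) \<in> vector_fields A"
    by (rule tensor_field_11D(4)[OF S tensor_field_11D(4)[OF T]])
qed

lemma tensor_field_11_id: "tensor_field_11 A (\<lambda>p v. v)"
  by (simp add: tensor_field_11_def)

lemma tensor_field_11_power:
  assumes "tensor_field_11 A F"
  shows "tensor_field_11 A (\<lambda>p v. (F p ^^ k) v)"
proof (induction k)
  case (Suc k)
  from tensor_field_11_compose[OF assms this] show ?case by simp
qed (simp add: tensor_field_11_id)

end

section \<open>Complexified vectors and operators\<close>

lemma cext_power:
  "(cext F p ^^ k) w = (\<lambda>f. Complex ((F p ^^ k) (\<lambda>g. Re (w g)) f) ((F p ^^ k) (\<lambda>g. Im (w g)) f))"
  by (induction k) (simp_all add: cext_def)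

lemma cext_image:
  "cext T p ` complexify V = complexify (T p ` V)"
proof (intro equalityI subsetI)
  fix w assume "w \<in> cext T p ` complexify V"
  then show "w \<in> complexify (T p ` V)" by (auto simp: cext_def complexify_def)
next
  fix w assume "w \<in> complexify (T p ` V)"
  then obtain u v where u: "u \<in> V" "(\<lambda>f. Re (w f)) = T p u" and v: "v \<in> V" "(\<lambda>f. Im (w f)) = T p v"
    by (auto simp: complexify_def)
  have "w = cext T p (\<lambda>f. Complex (u f) (v f))"
    unfolding cext_def using fun_cong[OF u(2)] fun_cong[OF v(2)] by (auto simp: complex_eq_iff)
  moreover have "(\<lambda>f. Complex (u f) (v f)) \<in> complexify V" using u v by (simp add: complexify_def)
  ultimately show "w \<in> cext T p ` complexify V" by (rule image_eqI)
qed

lemma cfield_in_ctangent_space: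
  assumes "X p \<in> V" "0 \<in> V"
  shows "cfield X p \<in> complexify V"
  using assms by (simp add: complexify_def cfield_def zero_fun_def)

lemma cfield_eq_iff: "cfield X = cfield Y \<longleftrightarrow> X = Y"
  by (simp add: cfield_def fun_eq_iff)

lemma cfield_arith:
  "cfield X - cfield Y = cfield (\<lambda>p. X p - Y p)" "cfield X + cfield Y = cfield (\<lambda>p. X p + Y p)"
  "- cfield X = cfield (\<lambda>p. - X p)" "0 = cfield (\<lambda>p. 0)"
  by (simp_all add: cfield_def fun_eq_iff)

text \<open>A real field has imaginary part 0, which \<open>T p\<close> must send to 0 for the image
  to be real again.\<close>

lemma cext_cfield:
  assumes "T p 0 = 0"
  shows "cext T p (cfield X p) = cfield (\<lambda>p. T p (X p)) p"
proof -
  have "T p (\<lambda>g. 0) = (\<lambda>g. 0)" using assms by (simp add: zero_fun_def)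
  then show ?thesis by (simp add: cext_def cfield_def complex_eq_iff fun_eq_iff)
qed

section \<open>Brackets of real fields and the projections of an F-structure\<close>

context smooth_manifold
begin

lemma bracket_cfield:
  assumes X: "X \<in> vector_fields A" and Y: "Y \<in> vector_fields A"
  shows "bracket (cfield X) (cfield Y) = cfield (lie X Y)"
  by (intro ext)
    (simp add: bracket_def cfield_def capply_def lie_def
      tangent_space_zero_function[OF vector_fieldsD(1)[OF X]] tangent_space_zero_function[OF vector_fieldsD(1)[OF Y]])

lemma lie_add:
  assumes "X \<in> vector_fields A" "X' \<in> vector_fields A" "Y \<in> vector_fields A" "Y' \<in> vector_fields A"
  shows "lie (\<lambda>p. X p + X' p) Y p = lie X Y p + lie X' Y p"
    and "lie X (\<lambda>p. Y p + Y' p) p = lie X Y p + lie X Y' p"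
proof -
  have add: "Z p (\<lambda>q. V q f + W q f) = Z p (\<lambda>q. V q f) + Z p (\<lambda>q. W q f)"
    if "Z \<in> vector_fields A" "V \<in> vector_fields A" "W \<in> vector_fields A" for Z V W f
  proof (cases "f \<in> smooth_functions A")
    case True
    show ?thesis
      by (rule tangent_spaceD(1)[OF vector_fieldsD(1)[OF that(1)]
            vector_fieldsD(2)[OF that(2) True] vector_fieldsD(2)[OF that(3) True]])
  next
    case False
    have "V q f = 0" "W q f = 0" for q
      by (rule tangent_spaceD(4)[OF vector_fieldsD(1)[OF that(2)] False]
          tangent_spaceD(4)[OF vector_fieldsD(1)[OF that(3)] False])+
    then show ?thesis
      by (simp add: tangent_space_zero_function[OF vector_fieldsD(1)[OF that(1)]])
  qed
  show "lie (\<lambda>p. X p + X' p) Y p = lie X Y p + lie X' Y p"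
    by (rule ext) (simp add: lie_def add[OF assms(3,1,2)])
  show "lie X (\<lambda>p. Y p + Y' p) p = lie X Y p + lie X Y' p"
    by (rule ext) (simp add: lie_def add[OF assms(1,3,4)])
qed

text \<open>On a real vector the structure equation splits into \<open>F = L F\<close> and
  \<open>J F = 0\<close>, where \<open>J\<close> collects the imaginary parts of \<alpha> and
  \<beta>. As \<open>2 \<le> K\<close>, every power in \<open>L\<close> and \<open>J\<close>
  contains a factor \<open>F\<close>, whence \<open>L L = L\<close> and \<open>J = L J\<close>.
  Moreover \<open>F J = J F = 0\<close>, and each term of \<open>L\<close> applies \<open>F\<close>
  at least once, so \<open>J = L J = 0\<close>.\<close>

lemma F_structure_projection:
  assumes F: "tensor_field_11 A F" and K: "2 \<le> K"
    and eq: "\<And>p w. w \<in> ctangent_space A p \<Longrightarrow>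
      scale \<alpha> ((cext F p ^^ (K + 1)) w) + scale \<beta> ((cext F p ^^ K) w) + cext F p w = 0"
  defines "L \<equiv> \<lambda>p v. scale (- Re \<alpha>) ((F p ^^ K) v) + scale (- Re \<beta>) ((F p ^^ (K - 1)) v)"
  shows "projection_field A L"
    and "w \<in> ctangent_space A p \<Longrightarrow> l_op F K \<alpha> \<beta> p w = cext L p w"
proof -
  obtain n where n: "K = Suc (Suc n)" using K by (metis add_2_eq_Suc le_Suc_ex)
  have T: "tensor_field_11 A (\<lambda>p v. scale a ((F p ^^ i) v) + scale b ((F p ^^ j) v))" for a b i j
    by (intro tensor_field_11_comb tensor_field_11_power F)
  have TL: "tensor_field_11 A L" unfolding L_def by (rule T)
  \<comment> \<open>On a real vector \<open>v\<close>, \<open>l v = L v - \<i> J v\<close>; the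
    claim about \<open>l\<close> thus amounts to \<open>J = 0\<close>.\<close>
  define J where "J p v = scale (Im \<alpha>) ((F p ^^ K) v) + scale (Im \<beta>) ((F p ^^ (K - 1)) v)" for p v
  have TJ: "tensor_field_11 A J" unfolding J_def by (rule T)
  note F_in = tensor_field_11D(1)[OF F] and F_add = tensor_field_11D(2)[OF F]
    and F_scale = tensor_field_11D(3)[OF F]
  have Fk: "(F p ^^ k) v \<in> tangent_space A p" if "v \<in> tangent_space A p" for k p v
    using tensor_field_11D(1)[OF tensor_field_11_power[OF F] that] .
  have Fk0: "(F p ^^ k) 0 = 0" for k p
    using tensor_field_11_zero[OF tensor_field_11_power[OF F]] .
  have comm: "F p (scale a ((F p ^^ i) v) + scale b ((F p ^^ j) v))
      = scale a ((F p ^^ Suc i) v) + scale b ((F p ^^ Suc j) v)"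
    "scale a ((F p ^^ Suc i) v) + scale b ((F p ^^ Suc j) v)
      = scale a ((F p ^^ i) (F p v)) + scale b ((F p ^^ j) (F p v))"
    if v: "v \<in> tangent_space A p" for p v a b i j
    by (simp_all add: F_add F_scale Fk tangent_space_scale v funpow_swap1)
  have re: "F p v = L p (F p v)" and im: "J p (F p v) = 0" if v: "v \<in> tangent_space A p" for p v
  proof -
    have "(\<lambda>f. complex_of_real (v f)) \<in> ctangent_space A p"
      using v tangent_space_zero by (simp add: complexify_def zero_fun_def)
    from eq[OF this] have e: "\<alpha> * Complex ((F p ^^ (K + 1)) v f) ((F p ^^ (K + 1)) (\<lambda>g. 0) f)
        + \<beta> * Complex ((F p ^^ K) v f) ((F p ^^ K) (\<lambda>g. 0) f)
        + Complex ((F p ^^ 1) v f) ((F p ^^ 1) (\<lambda>g. 0) f) = 0" for f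
      using cext_power[where F = F and p = p and k = 1] by (simp add: cext_power scale_def fun_eq_iff)
    have z: "(F p ^^ k) (\<lambda>g. 0) = (\<lambda>g. 0)" "F p (\<lambda>g. 0) = (\<lambda>g. 0)" for k
      using Fk0[where p = p and k = k] tensor_field_11_zero[OF F, of p] by (simp_all add: zero_fun_def)
    have e': "Re \<alpha> * (F p ^^ Suc K) v f + Re \<beta> * (F p ^^ Suc (K - 1)) v f + F p v f = 0"
      "Im \<alpha> * (F p ^^ Suc K) v f + Im \<beta> * (F p ^^ Suc (K - 1)) v f = 0" for f
      using arg_cong[OF e[of f], of Re] arg_cong[OF e[of f], of Im] by (simp_all add: z n)
    have "F p v = scale (- Re \<alpha>) ((F p ^^ Suc K) v) + scale (- Re \<beta>) ((F p ^^ Suc (K - 1)) v)"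
    proof
      show "F p v f = (scale (- Re \<alpha>) ((F p ^^ Suc K) v) + scale (- Re \<beta>) ((F p ^^ Suc (K - 1)) v)) f" for f
        using e'(1)[of f] unfolding scale_def plus_fun_apply by linarith
    qed
    then show "F p v = L p (F p v)" unfolding L_def by (simp only: comm(2)[OF v])
    have "scale (Im \<alpha>) ((F p ^^ Suc K) v) + scale (Im \<beta>) ((F p ^^ Suc (K - 1)) v) = 0"
      using e'(2) by (simp add: scale_def fun_eq_iff)
    then show "J p (F p v) = 0" unfolding J_def by (simp only: comm(2)[OF v])
  qed
  \<comment> \<open>With \<open>K = n + 2\<close>, the exponents \<open>K\<close> and
    \<open>K - 1\<close> leave \<open>Suc n\<close> and \<open>n\<close> after one \<open>F\<close>
    is split off.\<close>
  have LF: "L p v = F p (scale (- Re \<alpha>) ((F p ^^ Suc n) v) + scale (- Re \<beta>) ((F p ^^ n) v))"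
    and JF: "J p v = F p (scale (Im \<alpha>) ((F p ^^ Suc n) v) + scale (Im \<beta>) ((F p ^^ n) v))"
    if v: "v \<in> tangent_space A p" for p v
    unfolding L_def J_def comm(1)[OF v] by (simp_all add: n)
  have comb: "scale a ((F p ^^ i) v) + scale b ((F p ^^ j) v) \<in> tangent_space A p"
    if "v \<in> tangent_space A p" for a b i j p v
    by (intro tangent_space_add tangent_space_scale Fk that)
  have "L p (L p v) = L p v" if v: "v \<in> tangent_space A p" for p v
    unfolding LF[OF v] by (rule re[OF comb[OF v], symmetric])
  then show "projection_field A L" by unfold_locales (use TL in auto)
  have J0: "J p v = 0" if v: "v \<in> tangent_space A p" for p v
  proof -
    have "F p (J p v) = J p (F p v)" unfolding J_def by (simp only: comm[OF v])
    then have FJ: "F p (J p v) = 0" using im[OF v] by simp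
    have "J p v = L p (J p v)" using re[OF comb[OF v]] unfolding JF[OF v] .
    also have "\<dots> = 0"
      using FJ by (simp add: L_def n funpow_swap1 scale_zero) (simp add: Fk0 funpow_swap1[symmetric] scale_zero tensor_field_11_zero[OF F])
    finally show ?thesis .
  qed
  assume w: "w \<in> ctangent_space A p"
  then have u: "(\<lambda>f. Re (w f)) \<in> tangent_space A p" and v: "(\<lambda>f. Im (w f)) \<in> tangent_space A p"
    by (simp_all add: complexify_def)
  have j: "Im \<alpha> * (F p ^^ K) v f + Im \<beta> * (F p ^^ (K - 1)) v f = 0" if "v \<in> tangent_space A p" for v f
    using fun_cong[OF J0[OF that], of f] by (simp add: J_def scale_def)
  show "l_op F K \<alpha> \<beta> p w = cext L p w"
  proof
    fix f
    show "l_op F K \<alpha> \<beta> p w f = cext L p w f"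
      using j[OF u, of f] j[OF v, of f]
      by (simp add: l_op_def cext_power cext_def L_def scale_def complex_eq_iff)
  qed
qed

lemma projection_field_complement:
  assumes "projection_field A L"
  shows "projection_field A (\<lambda>p v. v - L p v)"
proof -
  interpret L: projection_field A L by fact
  have "tensor_field_11 A (\<lambda>p v. scale 1 v + scale (-1) (L p v))"
    by (rule tensor_field_11_comb[OF tensor_field_11_id L.tensor])
  moreover have "(\<lambda>p v. scale 1 v + scale (-1) (L p v)) = (\<lambda>p v. v - L p v)"
    by (simp add: scale_def fun_eq_iff)
  ultimately have T: "tensor_field_11 A (\<lambda>p v. v - L p v)" by simp
  show ?thesis
  proof (unfold_locales, rule T)
    fix v p assume v: "v \<in> tangent_space A p"
    have "L p v + L p (v - L p v) = L p (L p v + (v - L p v))"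
      using L.P_add[OF L.P_in[OF v] tangent_space_minus[OF v L.P_in[OF v]]] L.idem[OF v] by simp
    then have "L p (v - L p v) = 0" by simp
    then show "v - L p v - L p (v - L p v) = v - L p v" by simp
  qed
qed

text \<open>Split \<open>X\<close> and \<open>Y\<close> into their \<open>L\<close> and
  \<open>M\<close> parts and expand bilinearly, using \<open>L L = L\<close>. The mixed brackets
  occur only under \<open>L\<close>, each once with each sign, and cancel;
  \<open>L [L X, L Y]\<close> remains with coefficient -1 and \<open>L [M X, M Y]\<close> with
  coefficient 1.\<close>

lemma nijenhuis_projection:
  assumes L: "projection_field A L" and X: "X \<in> vector_fields A" and Y: "Y \<in> vector_fields A"
    and M: "\<And>p v. M p v = v - L p v"
  shows "lie (\<lambda>p. L p (X p)) (\<lambda>p. L p (Y p)) p - L p (lie (\<lambda>p. L p (X p)) Y p)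
      - L p (lie X (\<lambda>p. L p (Y p)) p) + L p (L p (lie X Y p))
    = M p (lie (\<lambda>p. L p (X p)) (\<lambda>p. L p (Y p)) p) + L p (lie (\<lambda>p. M p (X p)) (\<lambda>p. M p (Y p)) p)"
proof -
  interpret L: projection_field A L by fact
  have "M = (\<lambda>p v. v - L p v)" by (simp add: M fun_eq_iff)
  then interpret M: projection_field A M using projection_field_complement[OF L] by simp
  define a b c d where "a = (\<lambda>p. L p (X p))" and "b = (\<lambda>p. M p (X p))"
    and "c = (\<lambda>p. L p (Y p))" and "d = (\<lambda>p. M p (Y p))"
  have f: "a \<in> vector_fields A" "b \<in> vector_fields A" "c \<in> vector_fields A" "d \<in> vector_fields A"
    unfolding a_def b_def c_def d_def by (rule L.P_field M.P_field X Y)+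
  have XY: "X = (\<lambda>p. a p + b p)" "Y = (\<lambda>p. c p + d p)" by (simp_all add: a_def b_def c_def d_def M)
  note t = lie_in_tangent_space[OF f(1) f(3)] lie_in_tangent_space[OF f(1) f(4)]
    lie_in_tangent_space[OF f(2) f(3)] lie_in_tangent_space[OF f(2) f(4)]
  have ad: "lie a Y p = lie a c p + lie a d p" "lie X c p = lie a c p + lie b c p"
    "lie X Y p = (lie a c p + lie b c p) + (lie a d p + lie b d p)"
    unfolding XY using f vector_fields_comb[OF f(1,2), of 1 1]
    by (simp_all add: lie_add scale_def)
  have "lie a c p - L p (lie a Y p) - L p (lie X c p) + L p (L p (lie X Y p))
      = M p (lie a c p) + L p (lie b d p)"
    unfolding L.idem[OF lie_in_tangent_space[OF X Y]] unfolding ad M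
    by (simp add: L.P_add t tangent_space_add)
  then show ?thesis by (simp only: a_def b_def c_def d_def)
qed

end

theorem theorem5p3:
  fixes A :: "('a::{t2_space,second_countable_topology}, real ^ 'n) chart set"
    and F :: "'a \<Rightarrow> 'a tvec \<Rightarrow> 'a tvec"
    and r K :: nat
    and \<alpha> \<beta> :: complex
  defines "l \<equiv> l_op F K \<alpha> \<beta>"
    and "m \<equiv> m_op F K \<alpha> \<beta>"
  assumes "F_structure_manifold A F r K \<alpha> \<beta>"
  shows "(integrable_distribution A (image_distribution A l) \<and>
          integrable_distribution A (image_distribution A m) \<longleftrightarrow>
            (\<forall>X\<in>vector_fields A. \<forall>Y\<in>vector_fields A.
               nijenhuis l (cfield X) (cfield Y) = 0)) \<and>
         (integrable_distribution A (image_distribution A l) \<and>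
          integrable_distribution A (image_distribution A m) \<longleftrightarrow>
            (\<forall>X\<in>vector_fields A. \<forall>Y\<in>vector_fields A.
               tapply l (bracket (tapply m (cfield X)) (tapply m (cfield Y))) =
               - tapply m (bracket (tapply l (cfield X)) (tapply l (cfield Y)))))"
proof -
  have F: "smooth_atlas A" "tensor_field_11 A F" "2 \<le> K"
    "\<And>p w. w \<in> ctangent_space A p \<Longrightarrow>
      scale \<alpha> ((cext F p ^^ (K + 1)) w) + scale \<beta> ((cext F p ^^ K) w) + cext F p w = 0"
    using assms(3) by (auto simp: F_structure_manifold_def)
  interpret smooth_manifold A by unfold_locales (rule F(1))
  define L where "L p v = scale (- Re \<alpha>) ((F p ^^ K) v) + scale (- Re \<beta>) ((F p ^^ (K - 1)) v)" for p v
  define M where "M p v = v - L p v" for p v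
  have Leq: "L = (\<lambda>p v. scale (- Re \<alpha>) ((F p ^^ K) v) + scale (- Re \<beta>) ((F p ^^ (K - 1)) v))"
    by (simp add: L_def fun_eq_iff)
  have Meq: "M = (\<lambda>p v. v - L p v)" by (simp add: M_def fun_eq_iff)
  have pL: "projection_field A L" unfolding Leq by (rule F_structure_projection(1)[OF F(2,3,4)])
  have pM: "projection_field A M" unfolding Meq by (rule projection_field_complement[OF pL])
  interpret L: projection_field A L by fact
  interpret M: projection_field A M by fact
  have l: "l p w = cext L p w" if "w \<in> ctangent_space A p" for p w
    unfolding l_def Leq by (rule F_structure_projection(2)[OF F(2,3,4) that])
  have m: "m p w = cext M p w" if "w \<in> ctangent_space A p" for p w
  proof -
    have "m p w = w - l p w" by (simp add: m_def l_def m_op_def l_op_def)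
    also have "\<dots> = cext M p w"
      unfolding l[OF that] by (simp add: cext_def M_def fun_eq_iff complex_eq_iff)
    finally show ?thesis .
  qed
  \<comment> \<open>Complex extension commutes with taking images, so both distributions are
    complexifications of images of real projections and the real criterion applies.\<close>
  have "image_distribution A l = (\<lambda>p. complexify (L p ` tangent_space A p))"
    "image_distribution A m = (\<lambda>p. complexify (M p ` tangent_space A p))"
    unfolding image_distribution_def cext_image[symmetric]
    by (intro ext image_cong refl l m, assumption)+
  then have int: "integrable_distribution A (image_distribution A l) \<and>
      integrable_distribution A (image_distribution A m) \<longleftrightarrow> L.involutive \<and> M.involutive"
    by (simp only: L.integrable_iff_involutive M.integrable_iff_involutive)
  have tl: "tapply l (cfield X) = cfield (\<lambda>p. L p (X p))"
    and tm: "tapply m (cfield X) = cfield (\<lambda>p. M p (X p))" if "\<And>p. X p \<in> tangent_space A p" for X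
  proof -
    have c: "cfield X p \<in> ctangent_space A p" for p
      by (rule cfield_in_ctangent_space[OF that tangent_space_zero])
    show "tapply l (cfield X) = cfield (\<lambda>p. L p (X p))" "tapply m (cfield X) = cfield (\<lambda>p. M p (X p))"
      unfolding tapply_def by (simp_all add: l[OF c] m[OF c] cext_cfield L.P_zero M.P_zero)
  qed
  define ll where "ll X Y = lie (\<lambda>p. L p (X p)) (\<lambda>p. L p (Y p))" for X Y
  define mm where "mm X Y = lie (\<lambda>p. M p (X p)) (\<lambda>p. M p (Y p))" for X Y
  \<comment> \<open>Both conditions of the theorem unfold to the same pointwise identity
    \<open>M [L X, L Y] + L [M X, M Y] = 0\<close>.\<close>
  have N: "nijenhuis l (cfield X) (cfield Y) = 0 \<longleftrightarrow> (\<forall>p. M p (ll X Y p) + L p (mm X Y p) = 0)"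
    and B: "tapply l (bracket (tapply m (cfield X)) (tapply m (cfield Y))) =
        - tapply m (bracket (tapply l (cfield X)) (tapply l (cfield Y)))
        \<longleftrightarrow> (\<forall>p. M p (ll X Y p) + L p (mm X Y p) = 0)"
    if X: "X \<in> vector_fields A" and Y: "Y \<in> vector_fields A" for X Y
  proof -
    note LX = L.P_field[OF X] and LY = L.P_field[OF Y] and MX = M.P_field[OF X] and MY = M.P_field[OF Y]
    note x = vector_fieldsD(1)[OF X] and y = vector_fieldsD(1)[OF Y]
    have "nijenhuis l (cfield X) (cfield Y) = cfield (\<lambda>p. M p (ll X Y p) + L p (mm X Y p))"
      unfolding nijenhuis_def ll_def mm_def
      by (simp only: tl x y bracket_cfield X Y LX LY lie_in_tangent_space L.P_in cfield_arith
          nijenhuis_projection[OF pL X Y M_def])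
    then show "nijenhuis l (cfield X) (cfield Y) = 0 \<longleftrightarrow> (\<forall>p. M p (ll X Y p) + L p (mm X Y p) = 0)"
      by (simp only: cfield_arith(4) cfield_eq_iff fun_eq_iff[of _ "\<lambda>p. 0"])
    have "tapply l (bracket (tapply m (cfield X)) (tapply m (cfield Y))) = cfield (\<lambda>p. L p (mm X Y p))"
      "- tapply m (bracket (tapply l (cfield X)) (tapply l (cfield Y))) = cfield (\<lambda>p. - M p (ll X Y p))"
      unfolding ll_def mm_def
      by (simp_all only: tl tm x y bracket_cfield LX LY MX MY lie_in_tangent_space cfield_arith)
    then show "tapply l (bracket (tapply m (cfield X)) (tapply m (cfield Y))) =
        - tapply m (bracket (tapply l (cfield X)) (tapply l (cfield Y)))
        \<longleftrightarrow> (\<forall>p. M p (ll X Y p) + L p (mm X Y p) = 0)"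
      by (simp only: cfield_eq_iff fun_eq_iff[of _ "\<lambda>p. - M p (ll X Y p)"] eq_neg_iff_add_eq_0 add.commute)
  qed
  have "L.involutive \<and> M.involutive \<longleftrightarrow>
      (\<forall>X\<in>vector_fields A. \<forall>Y\<in>vector_fields A. \<forall>p. M p (ll X Y p) + L p (mm X Y p) = 0)"
  proof -
    \<comment> \<open>Applying \<open>L\<close> isolates the second summand because
      \<open>L M = 0\<close>; so a vanishing sum makes both summands vanish, which says that each
      bracket lies in the image of its own projection.\<close>
    have "M p (ll X Y p) + L p (mm X Y p) = 0 \<longleftrightarrow> L p (ll X Y p) = ll X Y p \<and> M p (mm X Y p) = mm X Y p"
      if X: "X \<in> vector_fields A" and Y: "Y \<in> vector_fields A" for X Y p
    proof -
      have ll: "ll X Y p \<in> tangent_space A p" and mm: "mm X Y p \<in> tangent_space A p"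
        unfolding ll_def mm_def
        by (intro lie_in_tangent_space L.P_field M.P_field X Y)+
      have "L p (M p (ll X Y p) + L p (mm X Y p)) = L p (mm X Y p)"
        using L.P_add[OF M.P_in[OF ll] L.P_in[OF mm]] L.idem[OF mm] L.P_zero
          L.P_add[OF L.P_in[OF ll] M.P_in[OF ll]] L.idem[OF ll] by (simp add: M_def)
      then have "M p (ll X Y p) + L p (mm X Y p) = 0 \<longleftrightarrow> M p (ll X Y p) = 0 \<and> L p (mm X Y p) = 0"
        using L.P_zero by auto
      then show ?thesis by (auto simp: M_def)
    qed
    then show ?thesis
      unfolding L.involutive_def M.involutive_def ll_def[symmetric] mm_def[symmetric] by blast
  qed
  then show ?thesis using int N B by simp
qed

end
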